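(* Let $W\subset X^+$ be a nonempty antichain of Lyndon words of arbitrary cardinality with $W\cap X=\emptyset$, let $A=K\langle X\rangle/(W)$, let $\mathfrak N$ be the set of normal words modulo $(W)$, and let $N=N(W)$ be the set of Lyndon atoms. (1) The set $$\{\, l_1^{k_1}l_2^{k_2}\cdots l_s^{k_s} \mid s\ge 1,\ \{l_1>l_2>\cdots>l_s\}\subseteq N,\ k_i\ge 0,\ 1\le i\le s \,\}$$ is a $K$-basis of $A$. It coincides with the set of normal words $\mathfrak N$. (2) The following conditions are equivalent: (i) $N$ is a finite set; (ii) $A$ has polynomial growth; (iii) $A$ is a PI algebra; (iv) $A$ can be embedded in a matrix ring over $K$. In this case $N=\{l_1>l_2>\cdots>l_d\}$, the algebra $A$ has a Poincaré-Birkhoff-Witt type $K$-basis $\mathfrak N=\{l_1^{\alpha_1}l_2^{\alpha_2}\cdots l_d^{\alpha_d}\mid \alpha_i\ge 0,\ 1\le i\le d\}$, so the Gelfand-Kirillov dimension of $A$ is $d$, and the Hilbert series of $A$ is $$H_A(t)=\prod_{1\le i\le d}\frac{1}{1-t^{|l_i|}}.$$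
   Context: $K$ is a field; $X=\{x_1,\dots,x_g\}$, $g\ge 2$, is a finite alphabet ordered by $x_1<\cdots<x_g$; $X^*$ is the free monoid on $X$ with empty word $1$; $X^+=X^*\setminus\{1\}$; $|w|$ is the length of $w$; $K\langle X\rangle$ is the free associative algebra, graded by length of words; $(W)$ is the two-sided ideal generated by $W$. The lexicographic order on $X^+$: $u<v$ iff either $u$ is a proper left factor of $v$ (i.e. $v=uz$ with $z\in X^+$), or $u=axb$, $v=ayc$ with $x,y\in X$, $x<y$, $a,b,c\in X^*$. A word $u\in X^+$ is a Lyndon word if it is nonperiodic (not a proper power) and minimal in its conjugacy class: $u=ab$ with $a,b\in X^+$ implies $u<ba$. $L$ denotes the set of all Lyndon words (so $X\subset L$). A set $W\subset X^+$ is an antichain if no element of $W$ is a proper subword (contiguous factor) of another. A word in $X^*$ is normal modulo $(W)$ if no element of $W$ is a subword of it; $\mathfrak N$ is the set of normal words (including $1$). The set of Lyndon atoms is $N=N(W)=\mathfrak N\cap L$. The graded algebra $A=\bigoplus_n A_n$ is said to have polynomial growth if there are a real number $d$ and a positive constant $C$ such that $\dim_K A_n\le C n^d$ for all $n\ge 0$; the infimum of the possible $d$'s is called the Gelfand-Kirillov dimension of $A$. $H_A(t)=\sum_n \dim_K(A_n)t^n$.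
   Formalization: (iv) is read as a K-algebra embedding into matrices over an extension field of K (over K itself it is false, as A is infinite-dimensional); GK dimension uses dim(A_0+...+A_n), since single A_n would give d-1; the polynomial growth bound is required only for n ≥ 1. *)

theory Defs
  imports
    "HOL-Algebra.Algebra"
    "HOL-Library.Sublist"
    "HOL-Library.Extended_Real"
    "HOL-Computational_Algebra.Formal_Power_Series"
begin

section \<open>Words\<close>

text \<open>Words over the alphabet are lists over a type; the alphabet itself is the whole type.\<close>

definition word_power :: "'x list \<Rightarrow> nat \<Rightarrow> 'x list" where
  "word_power w k = concat (replicate k w)"

text \<open>
  The library relation \<^const>\<open>lexord\<close> has exactly the two required clauses: proper left factor, or
  a smaller letter at the first difference.
\<close>

definition lex_less :: "'x::linorder list \<Rightarrow> 'x list \<Rightarrow> bool" where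
  "lex_less u v \<longleftrightarrow> (u, v) \<in> lexord {(x, y). x < y}"

definition lyndon :: "'x::linorder list \<Rightarrow> bool" where
  "lyndon u \<longleftrightarrow> u \<noteq> []
     \<and> \<not> (\<exists>v k. 2 \<le> k \<and> u = word_power v k)
     \<and> (\<forall>a b. a \<noteq> [] \<and> b \<noteq> [] \<and> u = a @ b \<longrightarrow> lex_less u (b @ a))"

definition word_antichain :: "'x list set \<Rightarrow> bool" where
  "word_antichain W \<longleftrightarrow> (\<forall>u\<in>W. \<forall>v\<in>W. \<not> strict_sublist u v)"

definition normal_words :: "'x list set \<Rightarrow> 'x list set" where
  "normal_words W = {u. \<forall>w\<in>W. \<not> sublist w u}"

definition lyndon_atoms :: "'x::linorder list set \<Rightarrow> 'x list set" where
  "lyndon_atoms W = normal_words W \<inter> {u. lyndon u}"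

definition lex_decreasing :: "'x::linorder list list \<Rightarrow> bool" where
  "lex_decreasing ls \<longleftrightarrow> sorted_wrt (\<lambda>u v. lex_less v u) ls"

text \<open>The word \<open>l\<^sub>1\<^bsup>k\<^sub>1\<^esup> \<dots> l\<^sub>s\<^bsup>k\<^sub>s\<^esup>\<close>, for lists of equal length \<open>s\<close>.\<close>

definition power_product :: "'x list list \<Rightarrow> nat list \<Rightarrow> 'x list" where
  "power_product ls ks = concat (map2 word_power ls ks)"


section \<open>The free associative algebra and its monomial quotients\<close>

text \<open>
  Elements are the finitely supported coefficient functions on words; the coefficient of \<open>w\<close> in a
  product is the sum over all factorisations of \<open>w\<close> into a left and a right factor.
\<close>

definition free_algebra :: "('k, 'm) ring_scheme \<Rightarrow> ('x list \<Rightarrow> 'k) ring" where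
  "free_algebra K = \<lparr>
     carrier = {f. range f \<subseteq> carrier K \<and> finite {w. f w \<noteq> \<zero>\<^bsub>K\<^esub>}},
     monoid.mult = (\<lambda>f g w. \<Oplus>\<^bsub>K\<^esub>i\<in>{..length w}. f (take i w) \<otimes>\<^bsub>K\<^esub> g (drop i w)),
     one = (\<lambda>w. if w = [] then \<one>\<^bsub>K\<^esub> else \<zero>\<^bsub>K\<^esub>),
     ring.zero = (\<lambda>w. \<zero>\<^bsub>K\<^esub>),
     add = (\<lambda>f g w. f w \<oplus>\<^bsub>K\<^esub> g w)\<rparr>"

definition term_elem :: "('k, 'm) ring_scheme \<Rightarrow> 'k \<Rightarrow> 'x list \<Rightarrow> ('x list \<Rightarrow> 'k)" where
  "term_elem K c w = (\<lambda>v. if v = w then c else \<zero>\<^bsub>K\<^esub>)"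

definition word_ideal :: "('k, 'm) ring_scheme \<Rightarrow> 'x list set \<Rightarrow> ('x list \<Rightarrow> 'k) set" where
  "word_ideal K W = Idl\<^bsub>free_algebra K\<^esub> (term_elem K \<one>\<^bsub>K\<^esub> ` W)"

definition word_algebra :: "('k, 'm) ring_scheme \<Rightarrow> 'x list set \<Rightarrow> ('x list \<Rightarrow> 'k) set ring" where
  "word_algebra K W = free_algebra K Quot word_ideal K W"

definition residue_class ::
  "('k, 'm) ring_scheme \<Rightarrow> 'x list set \<Rightarrow> ('x list \<Rightarrow> 'k) \<Rightarrow> ('x list \<Rightarrow> 'k) set" where
  "residue_class K W f = word_ideal K W +>\<^bsub>free_algebra K\<^esub> f"

definition word_class ::
  "('k, 'm) ring_scheme \<Rightarrow> 'x list set \<Rightarrow> 'x list \<Rightarrow> ('x list \<Rightarrow> 'k) set" where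
  "word_class K W w = residue_class K W (term_elem K \<one>\<^bsub>K\<^esub> w)"

text \<open>
  Throughout, a \<open>K\<close>-algebra is given by a ring \<open>A\<close> together with its structure map \<open>K \<rightarrow> A\<close>. The vector
  space notions of the library (\<^const>\<open>ring.Span\<close>, \<^const>\<open>ring.independent\<close>, \<^const>\<open>ring.dim\<close>) are
  then used with the image of \<open>K\<close> as the field of scalars.
\<close>

definition structure_map ::
  "('k, 'm) ring_scheme \<Rightarrow> 'x list set \<Rightarrow> 'k \<Rightarrow> ('x list \<Rightarrow> 'k) set" where
  "structure_map K W c = residue_class K W (term_elem K c [])"

definition scalars :: "('k, 'm) ring_scheme \<Rightarrow> 'x list set \<Rightarrow> ('x list \<Rightarrow> 'k) set set" where
  "scalars K W = structure_map K W ` carrier K"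

text \<open>
  \<open>S\<close> is the field of scalars. The lists in the library's \<^const>\<open>ring.independent\<close> may not repeat
  entries, so a possibly infinite set is independent iff all its distinct lists are.
\<close>

definition vs_basis :: "('a, 'm) ring_scheme \<Rightarrow> 'a set \<Rightarrow> 'a set \<Rightarrow> bool" where
  "vs_basis A S B \<longleftrightarrow> B \<subseteq> carrier A
     \<and> (\<forall>us. distinct us \<and> set us \<subseteq> B \<longrightarrow> ring.independent A S us)
     \<and> (\<forall>a\<in>carrier A. \<exists>us. set us \<subseteq> B \<and> a \<in> ring.Span A S us)"

text \<open>A set of words is a basis of the quotient if the words have distinct classes forming a basis.\<close>

definition words_form_basis :: "('k, 'm) ring_scheme \<Rightarrow> 'x list set \<Rightarrow> 'x list set \<Rightarrow> bool" where
  "words_form_basis K W B \<longleftrightarrow> inj_on (word_class K W) B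
     \<and> vs_basis (word_algebra K W) (scalars K W) (word_class K W ` B)"


section \<open>Grading, growth and Hilbert series\<close>

definition graded_component ::
  "('k, 'm) ring_scheme \<Rightarrow> 'x list set \<Rightarrow> nat \<Rightarrow> ('x list \<Rightarrow> 'k) set set" where
  "graded_component K W n = residue_class K W `
     {f \<in> carrier (free_algebra K). \<forall>w. f w \<noteq> \<zero>\<^bsub>K\<^esub> \<longrightarrow> length w = n}"

definition graded_dim :: "('k, 'm) ring_scheme \<Rightarrow> 'x list set \<Rightarrow> nat \<Rightarrow> nat" where
  "graded_dim K W n =
     ring.dim (word_algebra K W) (scalars K W) (graded_component K W n)"

text \<open>
  The bound is required for \<open>n \<ge> 1\<close> only: the component of degree \<open>0\<close> is never zero for a proper
  quotient, while \<open>C * 0 powr d = 0\<close>.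
\<close>

definition polynomial_growth :: "('k, 'm) ring_scheme \<Rightarrow> 'x list set \<Rightarrow> bool" where
  "polynomial_growth K W \<longleftrightarrow>
     (\<exists>(d::real) C. 0 < C \<and> (\<forall>n\<ge>1. real (graded_dim K W n) \<le> C * real n powr d))"

text \<open>
  The Gelfand-Kirillov dimension refers to the growth of \<open>A\<^sub>0 \<oplus> \<dots> \<oplus> A\<^sub>n\<close>; the growth of the single
  components \<open>A\<^sub>n\<close> would give one less (a polynomial ring in one variable would get \<open>0\<close>).
  It is \<open>\<infinity>\<close> if there is no polynomial bound.
\<close>

definition GK_dim :: "('k, 'm) ring_scheme \<Rightarrow> 'x list set \<Rightarrow> ereal" where
  "GK_dim K W = Inf {ereal d | d. \<exists>C>0. \<forall>n\<ge>1.
     real (\<Sum>i\<le>n. graded_dim K W i) \<le> C * real n powr d}"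

definition hilbert_series :: "('k, 'm) ring_scheme \<Rightarrow> 'x list set \<Rightarrow> rat fps" where
  "hilbert_series K W = Abs_fps (\<lambda>n. of_nat (graded_dim K W n))"


section \<open>Polynomial identities and matrix representations\<close>

text \<open>Value of a noncommutative polynomial under a substitution \<open>\<phi>\<close>; \<open>\<iota>\<close> is the structure map of \<open>A\<close>.\<close>

definition nc_eval :: "('k, 'm) ring_scheme \<Rightarrow> ('a, 'n) ring_scheme \<Rightarrow> ('k \<Rightarrow> 'a) \<Rightarrow>
    ('y \<Rightarrow> 'a) \<Rightarrow> ('y list \<Rightarrow> 'k) \<Rightarrow> 'a" where
  "nc_eval K A \<iota> \<phi> f =
     (\<Oplus>\<^bsub>A\<^esub>w\<in>{w. f w \<noteq> \<zero>\<^bsub>K\<^esub>}. \<iota> (f w) \<otimes>\<^bsub>A\<^esub> foldr (\<otimes>\<^bsub>A\<^esub>) (map \<phi> w) \<one>\<^bsub>A\<^esub>)"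

definition PI_algebra ::
  "('k, 'm) ring_scheme \<Rightarrow> ('a, 'n) ring_scheme \<Rightarrow> ('k \<Rightarrow> 'a) \<Rightarrow> bool" where
  "PI_algebra K A \<iota> \<longleftrightarrow>
     (\<exists>f\<in>carrier (free_algebra K :: (nat list \<Rightarrow> 'k) ring). f \<noteq> \<zero>\<^bsub>free_algebra K\<^esub> \<and>
        (\<forall>\<phi>. range \<phi> \<subseteq> carrier A \<longrightarrow> nc_eval K A \<iota> \<phi> f = \<zero>\<^bsub>A\<^esub>))"

text \<open>The \<open>n \<times> n\<close> matrices over \<open>F\<close>; entries outside the index range are normalised to zero.\<close>

definition scalar_matrix :: "('f, 'm) ring_scheme \<Rightarrow> nat \<Rightarrow> 'f \<Rightarrow> (nat \<Rightarrow> nat \<Rightarrow> 'f)" where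
  "scalar_matrix F n c = (\<lambda>i j. if i < n \<and> i = j then c else \<zero>\<^bsub>F\<^esub>)"

definition matrix_ring :: "('f, 'm) ring_scheme \<Rightarrow> nat \<Rightarrow> (nat \<Rightarrow> nat \<Rightarrow> 'f) ring" where
  "matrix_ring F n = \<lparr>
     carrier = {M. \<forall>i j. M i j \<in> carrier F \<and> (\<not> (i < n \<and> j < n) \<longrightarrow> M i j = \<zero>\<^bsub>F\<^esub>)},
     monoid.mult = (\<lambda>M N i j. \<Oplus>\<^bsub>F\<^esub>k\<in>{..<n}. M i k \<otimes>\<^bsub>F\<^esub> N k j),
     one = scalar_matrix F n \<one>\<^bsub>F\<^esub>,
     ring.zero = (\<lambda>i j. \<zero>\<^bsub>F\<^esub>),
     add = (\<lambda>M N i j. M i j \<oplus>\<^bsub>F\<^esub> N i j)\<rparr>"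

text \<open>
  Representability: an injective unital \<open>K\<close>-algebra homomorphism into \<open>M\<^sub>n(F)\<close> for an extension field
  \<open>\<sigma> : K \<rightarrow> F\<close>. An extension has to be allowed, since \<open>M\<^sub>n(K)\<close> itself is finite-dimensional.
  The carrier type of \<open>F\<close> is no restriction for a finitely generated \<open>A\<close>: the entries of the images of
  generators generate a finitely generated extension of \<open>K\<close>, whose cardinality is at most
  \<open>max |K| \<aleph>\<^sub>0\<close>, and \<open>|nat \<Rightarrow> 'k|\<close> is at least that because \<open>'k\<close> has two elements.
\<close>

definition matrix_embeddable ::
  "('k, 'm) ring_scheme \<Rightarrow> ('a, 'n) ring_scheme \<Rightarrow> ('k \<Rightarrow> 'a) \<Rightarrow> bool" where
  "matrix_embeddable K A \<iota> \<longleftrightarrow>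
     (\<exists>(F :: (nat \<Rightarrow> 'k) ring) \<sigma> n \<phi>. field F \<and> \<sigma> \<in> ring_hom K F
        \<and> \<phi> \<in> ring_hom A (matrix_ring F n) \<and> inj_on \<phi> (carrier A)
        \<and> (\<forall>c\<in>carrier K. \<phi> (\<iota> c) = scalar_matrix F n (\<sigma> c)))"

end

theory Submission
  imports Defs "HOL-Library.List_Lexorder" "HOL-Combinatorics.Permutations"
begin

text \<open>
  A Lyndon factor of a nonincreasing product of Lyndon words lies inside one of the factors; hence a word
  is normal iff all words of its Lyndon factorisation are atoms, and the normal words are the power
  products of atoms. The normal words always form a basis of a monomial quotient, so for finitely many
  atoms the Hilbert series and the growth are those of a polynomial ring with generators in degrees
  \<open>|l|\<close>, while infinitely many atoms give more than any polynomial growth.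

  For finitely many atoms, an automaton whose states are the proper suffixes of the atoms yields a
  representation by matrices over a field of large transcendence degree, which is faithful because a path
  determines the Lyndon factorisation of its label. A matrix ring satisfies a standard identity. Finally, if
  \<open>v\<^sub>1 > \<dots> > v\<^sub>D\<close> are atoms, then \<open>v\<^sub>1 \<cdots> v\<^sub>D\<close> differs from every other product of at most \<open>D\<close> of them, and
  no polynomial of degree \<open>D\<close> is an identity.\<close>

section \<open>Lyndon words\<close>

text \<open>One fact carries the combinatorics: a Lyndon word that starts inside a factor of a
  nonincreasing product of Lyndon words cannot run past the end of that factor. Besides the
  normality criterion it shows that such a product is the unique shortest way to write its value as
  a product of Lyndon words in any order. The PI argument needs this stronger form, because a degree
  bound on an identity is a bound on the number of factors.

  Commuting weights can separate noncommutative words here because the order of the factors is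
  forced: a normal word is determined by the multiset of its atoms. So one independent element per
  atom is enough, and multisets of atoms can be coded as products of distinct primes. The field of
  the representation has to live on the type of sequences over \<open>K\<close>. Dirichlet series
  are such sequences already, and they contain infinitely many independent elements, one for each
  prime.\<close>

lemma lex_less_iff: "lex_less u v \<longleftrightarrow> u < v"
  by (simp add: lex_less_def list_less_def)

lemma append_less_append_iff: "u @ a < u @ b \<longleftrightarrow> a < (b :: 'x::linorder list)"
  by (induction u) auto

lemma less_append_same: "a \<noteq> [] \<Longrightarrow> u < u @ (a :: 'x::linorder list)"
  using append_less_append_iff[of u "[]" a] by (cases a) auto

lemma prefix_imp_le: "prefix u v \<Longrightarrow> u \<le> (v :: 'x::linorder list)"
  by (metis append.right_neutral less_append_same order.order_iff_strict prefixE)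

text \<open>As \<open>u\<close> is not a prefix of \<open>v\<close>, the comparison is decided by a
  letter inside both words, and nothing appended can change it.\<close>

lemma less_append_append:
  assumes "u < v" "\<not> prefix u (v :: 'x::linorder list)"
  shows "u @ a < v @ b"
  using assms
proof (induction u arbitrary: v)
  case (Cons x u)
  then show ?case by (cases v) auto
qed simp

lemma lyndon_nonempty: "lyndon u \<Longrightarrow> u \<noteq> []"
  by (simp add: lyndon_def)

text \<open>Suppose \<open>b < a @ b\<close>. If \<open>b\<close> is not a prefix of
  \<open>a @ b\<close>, the inequality survives appending \<open>a\<close> to \<open>b\<close>,
  against minimality among the conjugates. Otherwise \<open>b\<close> is a border,
  \<open>a @ b = b @ c\<close>, and the two rotations \<open>b @ a\<close> and \<open>c @ b\<close>
  give contradictory comparisons of \<open>a\<close> and \<open>c\<close>.\<close>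

lemma lyndon_less_suffix:
  assumes "lyndon (a @ b)" "a \<noteq> []" "b \<noteq> []"
  shows "a @ b < b"
proof (rule ccontr)
  assume "\<not> a @ b < b"
  with assms have less: "b < a @ b" by (metis append_self_conv2 linorder_less_linear)
  have conj: "a @ b < b @ a" using assms unfolding lyndon_def lex_less_iff by blast
  show False
  proof (cases "prefix b (a @ b)")
    case True
    then obtain c where c: "a @ b = b @ c" by (auto elim: prefixE)
    then have len: "length c = length a" by (metis add.commute add_left_cancel length_append)
    with assms have "c \<noteq> []" by auto
    then have rot: "a @ b < c @ b" using assms c unfolding lyndon_def lex_less_iff by metis
    have "c < a" using conj c append_less_append_iff by metis
    moreover have "\<not> prefix c a"
      using len \<open>c < a\<close> by (metis append_eq_append_conv append_Nil2 order_less_irrefl prefixE)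
    ultimately have "c @ b < a @ b" by (rule less_append_append)
    with rot show False by order
  next
    case False
    from less_append_append[OF less False, of a "[]"] conj show False by auto
  qed
qed

text \<open>A proper power of \<open>v\<close> has \<open>v\<close> both as a proper prefix and as a
  proper suffix, so \<open>v < u < v\<close>. For a rotation, \<open>u\<close> is longer than
  \<open>b\<close>, so \<open>u < b\<close> is decided inside \<open>b\<close> and persists when
  \<open>a\<close> is appended.\<close>

lemma lyndonI:
  assumes "u \<noteq> []" and suf: "\<And>a b. u = a @ b \<Longrightarrow> a \<noteq> [] \<Longrightarrow> b \<noteq> [] \<Longrightarrow> u < b"
  shows "lyndon u"
  unfolding lyndon_def lex_less_iff
proof (intro conjI allI impI notI)
  assume "\<exists>v k. 2 \<le> k \<and> u = word_power v k"
  then obtain v k where k: "2 \<le> k" and u: "u = word_power v k" by blast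
  obtain j where j: "k = Suc (Suc j)" using k by (metis add_2_eq_Suc le_Suc_ex)
  have v: "v \<noteq> []" using \<open>u \<noteq> []\<close> u by (auto simp: word_power_def)
  have "u = word_power v (Suc j) @ v"
    unfolding u j word_power_def by (metis append.right_neutral concat.simps(1,2) concat_append replicate_Suc replicate_append_same)
  moreover have "word_power v (Suc j) \<noteq> []" using v by (simp add: word_power_def)
  ultimately have "u < v" using v suf by blast
  moreover have "v < u" using v unfolding u j by (simp add: word_power_def less_append_same)
  ultimately show False by order
next
  fix a b assume ab: "a \<noteq> [] \<and> b \<noteq> [] \<and> u = a @ b"
  then have "u < b" using suf by blast
  moreover have "\<not> prefix u b" using ab prefix_length_le by fastforce
  ultimately show "u < b @ a" using less_append_append[of u b "[]" a] by simp
qed (use assms in auto)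

lemma lyndon_letter: "lyndon [x]"
  by (rule lyndonI) (auto simp: Cons_eq_append_conv)

text \<open>By the suffix criterion. The suffix \<open>v\<close> itself is treated first; a proper
  suffix of \<open>v\<close> lies above \<open>v\<close>; a suffix starting inside \<open>u\<close>
  is \<open>c @ v\<close> with \<open>u < c\<close>, and this is decided inside \<open>c\<close>
  because \<open>c\<close> is shorter than \<open>u\<close>.\<close>

lemma lyndon_append:
  assumes u: "lyndon u" and v: "lyndon v" and "u < v"
  shows "lyndon (u @ v)"
proof (rule lyndonI)
  show "u @ v \<noteq> []" using lyndon_nonempty[OF u] by simp
  have uv: "u @ v < v"
  proof (cases "prefix u v")
    case True
    then obtain v' where v': "v = u @ v'" by (auto elim: prefixE)
    then have "v' \<noteq> []" using \<open>u < v\<close> by auto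
    \<comment> \<open>Here \<open>v'\<close> is a proper suffix of the Lyndon word \<open>v\<close>;
      prefixing \<open>u\<close> to both sides turns \<open>v < v'\<close> into the claim.\<close>
    then have "v < v'" using lyndon_less_suffix v v' lyndon_nonempty[OF u] by blast
    then show ?thesis using append_less_append_iff v' by metis
  next
    case False
    from less_append_append[OF \<open>u < v\<close> False, of v "[]"] show ?thesis by simp
  qed
  fix a b assume ab: "u @ v = a @ b" "a \<noteq> []" "b \<noteq> []"
  from ab(1) consider (l) c where "u = a @ c" "b = c @ v" | (r) c where "a = u @ c" "v = c @ b"
    by (auto simp: append_eq_append_conv2)
  then show "u @ v < b"
  proof cases
    case l
    show ?thesis
    proof (cases "c = []")
      case False
      then have "u < c" using lyndon_less_suffix u l ab by blast
      moreover have "\<not> prefix u c" using l ab prefix_length_le by fastforce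
      ultimately show ?thesis unfolding l(2) by (rule less_append_append)
    qed (use l uv in auto)
  next
    case r
    show ?thesis
    proof (cases "c = []")
      case False
      then have "v < b" using lyndon_less_suffix v r ab by blast
      with uv show ?thesis by order
    qed (use r uv in auto)
  qed
qed

text \<open>The end of \<open>r\<close> falls into some factor \<open>x\<close>, and
  \<open>q\<close> is the nonempty part of \<open>r\<close> inside it. This yields a suffix of
  \<open>r\<close> that can be compared with a factor.\<close>

lemma prefix_concat_ends_in_factor:
  assumes "prefix r (concat vs)" "r \<noteq> []"
  shows "\<exists>x\<in>set vs. \<exists>q. q \<noteq> [] \<and> suffix q r \<and> prefix q x"
  using assms
proof (induction vs arbitrary: r)
  case (Cons x vs)
  show ?case
  proof (cases "prefix r x")
    case False
    then obtain r' where r': "r = x @ r'" "prefix r' (concat vs)"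
      using Cons.prems by (auto simp: prefix_append)
    then have "r' \<noteq> []" using False by auto
    with Cons.IH r' show ?thesis by (metis list.set_intros(2) suffix_append suffixI suffix_order.trans)
  qed (use Cons.prems in auto)
qed simp

text \<open>The Chen-Fox-Lyndon factorisations. The order is weak because a factor may be
  repeated.\<close>

definition lyndon_list :: "'x::linorder list list \<Rightarrow> bool" where
  "lyndon_list vs \<longleftrightarrow> (\<forall>v\<in>set vs. lyndon v) \<and> sorted_wrt (\<ge>) vs"

lemma lyndon_list_Nil [simp]: "lyndon_list []"
  by (simp add: lyndon_list_def)

lemma lyndon_list_Cons:
  "lyndon_list (v # vs) \<longleftrightarrow> lyndon v \<and> (\<forall>x\<in>set vs. x \<le> v) \<and> lyndon_list vs"
  by (auto simp: lyndon_list_def)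

text \<open>If \<open>u\<close> ended inside a later factor \<open>x\<close>, say in the prefix \<open>q\<close> of \<open>x\<close>, then
  \<open>u < q \<le> x \<le> v \<le> s < u\<close>.\<close>

lemma lyndon_prefix_within_factor:
  assumes u: "lyndon u" and pre: "prefix u (s @ concat vs)" and s: "s \<noteq> []" "suffix s v"
    and vs: "lyndon_list (v # vs)"
  shows "prefix u s"
proof (rule ccontr)
  assume "\<not> prefix u s"
  then obtain r where r: "u = s @ r" "prefix r (concat vs)"
    using pre by (auto simp: prefix_append)
  then have "r \<noteq> []" using \<open>\<not> prefix u s\<close> by auto
  with r obtain x q where x: "x \<in> set vs" and q: "q \<noteq> []" "suffix q r" "prefix q x"
    using prefix_concat_ends_in_factor by metis
  obtain a where "r = a @ q" using q by (auto elim: suffixE)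
  then have "u < q" using lyndon_less_suffix[of "s @ a" q] u r q s by simp
  moreover have "q \<le> x" using q prefix_imp_le by blast
  moreover have "x \<le> v" using vs x by (simp add: lyndon_list_Cons)
  moreover have "v \<le> s"
  proof -
    obtain b where b: "v = b @ s" using s by (auto elim: suffixE)
    show ?thesis
    proof (cases "b = []")
      case False
      then have "b @ s < s" using lyndon_less_suffix vs b s by (metis lyndon_list_Cons)
      then show ?thesis using b by simp
    qed (use b in simp)
  qed
  moreover have "s < u" using r \<open>r \<noteq> []\<close> less_append_same by blast
  ultimately show False by order
qed

text \<open>Look at the factor in which the occurrence of \<open>u\<close> starts: by
  \<open>lyndon_prefix_within_factor\<close> it also ends there. An occurrence starting exactly at
  the end of \<open>v\<close> belongs to the remaining factors.\<close>

lemma lyndon_sublist_within_factor: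
  assumes "lyndon u" "sublist u (concat vs)" "lyndon_list vs"
  shows "\<exists>v\<in>set vs. sublist u v"
  using assms(2,3)
proof (induction vs)
  case Nil
  then show ?case using lyndon_nonempty[OF assms(1)] by simp
next
  case (Cons v vs)
  have IH: ?case if "sublist u (concat vs)"
    using Cons that by (auto simp: lyndon_list_Cons)
  obtain p q where "v @ concat vs = p @ u @ q" using Cons.prems by (auto simp: sublist_def)
  then consider (l) s where "v = p @ s" "s @ concat vs = u @ q" | (r) c where "concat vs = c @ u @ q"
    by (auto simp: append_eq_append_conv2)
  then show ?case
  proof cases
    case l
    show ?thesis
    proof (cases "s = []")
      case True
      then show ?thesis using l IH by simp
    next
      case False
      have "prefix u s"
        using lyndon_prefix_within_factor[OF assms(1) _ False _ Cons.prems(2)] l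
        by (metis prefixI suffixI)
      then obtain t where "v = p @ u @ t" using l by (auto elim: prefixE)
      then show ?thesis by (auto intro: sublist_appendI)
    qed
  next
    case r
    then show ?thesis using IH by (metis sublist_appendI)
  qed
qed

text \<open>No word of \<open>us\<close> straddles the end of \<open>s\<close>: being Lyndon and
  starting inside \<open>s\<close>, it stays there. The statement is about a suffix \<open>s\<close>
  of \<open>v\<close> because the induction consumes \<open>v\<close> one word of \<open>us\<close>
  at a time.\<close>

lemma lyndon_factors_split:
  assumes "\<forall>u\<in>set us. lyndon u" "concat us = s @ concat vs" "suffix s v" "lyndon_list (v # vs)"
  shows "\<exists>us1 us2. us = us1 @ us2 \<and> concat us1 = s \<and> concat us2 = concat vs"
  using assms(1-3)
proof (induction us arbitrary: s)
  case Nil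
  then show ?case by auto
next
  case (Cons u us)
  show ?case
  proof (cases "s = []")
    case True
    then show ?thesis using Cons.prems by (metis append_Nil concat.simps(1))
  next
    case False
    have "prefix u s"
      using lyndon_prefix_within_factor[of u s vs v] Cons.prems False assms(4)
      by (metis concat.simps(2) list.set_intros(1) prefixI)
    then obtain s' where s': "s = u @ s'" by (auto elim: prefixE)
    then have "concat us = s' @ concat vs" "suffix s' v"
      using Cons.prems by (auto simp: suffix_def)
    then obtain us1 us2 where "us = us1 @ us2" "concat us1 = s'" "concat us2 = concat vs"
      using Cons.IH Cons.prems(1) by auto
    then show ?thesis using s' by (intro exI[of _ "u # us1"] exI[of _ us2]) simp
  qed
qed

text \<open>By \<open>lyndon_factors_split\<close> every \<open>v\<close> is the product of a block
  of \<open>us\<close>, and each block is nonempty. If \<open>us\<close> is not longer than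
  \<open>vs\<close>, all blocks are single words. The order of \<open>us\<close> is left arbitrary,
  as the substitution into a polynomial identity requires.\<close>

lemma lyndon_list_shortest:
  assumes "\<forall>u\<in>set us. lyndon u" "lyndon_list vs" "concat us = concat vs" "length us \<le> length vs"
  shows "us = vs"
  using assms
proof (induction vs arbitrary: us)
  case (Cons v vs)
  obtain us1 us2 where us: "us = us1 @ us2" "concat us1 = v" "concat us2 = concat vs"
    using lyndon_factors_split[OF Cons.prems(1) _ _ Cons.prems(2), of v] Cons.prems(3) by auto
  have "lyndon v" using Cons.prems(2) by (simp add: lyndon_list_Cons)
  then have "us1 \<noteq> []" using us(2) lyndon_nonempty by force
  then have len: "length us1 \<ge> 1" by (cases us1) auto
  have "us2 = vs"
    using Cons.IH[of us2] Cons.prems us len by (auto simp: lyndon_list_Cons)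
  then have "length us1 = 1" using Cons.prems(4) us len by simp
  then have "us1 = [v]" using us(2) by (auto simp: length_Suc_conv)
  then show ?case using us \<open>us2 = vs\<close> by simp
qed simp

lemma lyndon_list_unique:
  assumes "lyndon_list us" "lyndon_list vs" "concat us = concat vs"
  shows "us = vs"
  using lyndon_list_shortest assms unfolding lyndon_list_def by (metis linear)

text \<open>\<open>u\<close> absorbs the next factor as long as that factor is greater, and the
  merged word is Lyndon by \<open>lyndon_append\<close>. Once the next factor is not greater, the
  list is nonincreasing.\<close>

lemma lyndon_list_prepend:
  assumes "lyndon u" "lyndon_list vs"
  shows "\<exists>us. lyndon_list us \<and> concat us = u @ concat vs"
  using assms
proof (induction vs arbitrary: u)
  case Nil
  then show ?case by (intro exI[of _ "[u]"]) (simp add: lyndon_list_Cons)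
next
  case (Cons v vs)
  show ?case
  proof (cases "v \<le> u")
    case True
    then show ?thesis using Cons.prems
      by (intro exI[of _ "u # v # vs"]) (auto simp: lyndon_list_Cons)
  next
    case False
    then show ?thesis
      using Cons.IH[of "u @ v"] Cons.prems lyndon_append[of u v] by (auto simp: lyndon_list_Cons)
  qed
qed

lemma lyndon_list_exists: "\<exists>vs. lyndon_list vs \<and> concat vs = w"
proof (induction w)
  case Nil
  show ?case by (intro exI[of _ "[]"]) simp
next
  case (Cons x w)
  then show ?case using lyndon_list_prepend[OF lyndon_letter] by (metis append_Cons append_Nil)
qed

definition lyndon_factors :: "'x::linorder list \<Rightarrow> 'x list list" where
  "lyndon_factors w = (THE vs. lyndon_list vs \<and> concat vs = w)"

lemma lyndon_factors: "lyndon_list (lyndon_factors w)" "concat (lyndon_factors w) = w"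
proof -
  have "\<exists>!vs. lyndon_list vs \<and> concat vs = w" using lyndon_list_exists lyndon_list_unique by metis
  from theI'[OF this] show "lyndon_list (lyndon_factors w)" "concat (lyndon_factors w) = w"
    unfolding lyndon_factors_def by auto
qed

lemma lyndon_factors_concat: "lyndon_list vs \<Longrightarrow> lyndon_factors (concat vs) = vs"
  using lyndon_factors lyndon_list_unique by blast

section \<open>Normality read off from the Lyndon factors\<close>

lemma normal_sublist: "w \<in> normal_words W \<Longrightarrow> sublist u w \<Longrightarrow> u \<in> normal_words W"
  unfolding normal_words_def using sublist_order.order_trans[of _ u w] by auto

text \<open>The Lyndon hypothesis on \<open>W\<close> enters from right to left: a forbidden word
  inside the product would lie inside a single factor, which is an atom and therefore
  normal.\<close>

lemma concat_in_normal_words_iff: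
  assumes "\<forall>w\<in>W. lyndon w" "lyndon_list vs"
  shows "concat vs \<in> normal_words W \<longleftrightarrow> set vs \<subseteq> lyndon_atoms W"
proof
  assume "concat vs \<in> normal_words W"
  moreover have "sublist v (concat vs)" if "v \<in> set vs" for v
    using that by (metis concat.simps(2) concat_append split_list sublist_appendI)
  ultimately show "set vs \<subseteq> lyndon_atoms W"
    using assms(2) normal_sublist unfolding lyndon_atoms_def lyndon_list_def by fastforce
next
  assume "set vs \<subseteq> lyndon_atoms W"
  then show "concat vs \<in> normal_words W"
    using lyndon_sublist_within_factor[OF _ _ assms(2)] assms(1)
    unfolding lyndon_atoms_def normal_words_def by blast
qed

lemma normal_iff_factors:
  assumes "\<forall>w\<in>W. lyndon w"
  shows "u \<in> normal_words W \<longleftrightarrow> set (lyndon_factors u) \<subseteq> lyndon_atoms W"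
  using concat_in_normal_words_iff[OF assms lyndon_factors(1)] by (simp add: lyndon_factors(2))

section \<open>Power products\<close>

text \<open>\<open>power_product\<close> before the final concatenation, so that power products can
  be compared with Lyndon factorisations as lists of factors.\<close>

definition power_list :: "'a list \<Rightarrow> nat list \<Rightarrow> 'a list" where
  "power_list ls ks = concat (map2 (\<lambda>l k. replicate k l) ls ks)"

lemma power_list_simps [simp]:
  "power_list [] ks = []" "power_list ls [] = []"
  "power_list (l # ls) (k # ks) = replicate k l @ power_list ls ks"
  by (auto simp: power_list_def)

lemma power_product_eq: "power_product ls ks = concat (power_list ls ks)"
proof (induction ls arbitrary: ks)
  case (Cons l ls)
  then show ?case by (cases ks) (auto simp: power_product_def word_power_def)
qed (simp add: power_product_def)

lemma set_power_list: "set (power_list ls ks) \<subseteq> set ls"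
proof (induction ls arbitrary: ks)
  case (Cons l ls)
  then show ?case by (cases ks) (auto split: if_splits dest: subsetD)
qed simp

lemma sorted_power_list:
  fixes ls :: "'a::linorder list"
  assumes "sorted_wrt (>) ls"
  shows "sorted_wrt (\<ge>) (power_list ls ks)"
  using assms
proof (induction ls arbitrary: ks)
  case (Cons l ls)
  show ?case
  proof (cases ks)
    case (Cons k ks')
    have "sorted_wrt (\<ge>) (replicate k l)" by (induction k) auto
    moreover have "\<forall>x\<in>set (power_list ls ks'). x \<le> l"
      using set_power_list[of ls ks'] Cons.prems by (auto dest!: subsetD)
    ultimately show ?thesis using Cons.IH[of ks'] Cons.prems Cons
      by (auto simp: sorted_wrt_append)
  qed simp
qed simp

lemma power_list_surj:
  fixes ls :: "'a::linorder list"
  assumes "sorted_wrt (>) ls" "sorted_wrt (\<ge>) vs" "set vs \<subseteq> set ls"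
  shows "\<exists>ks. length ks = length ls \<and> vs = power_list ls ks"
  using assms
proof (induction ls arbitrary: vs)
  case (Cons l ls)
  \<comment> \<open>The leading run of \<open>l\<close>, possibly empty; its length is the exponent
    of \<open>l\<close>, so an atom that does not occur gets the exponent 0.\<close>
  define t d where "t = takeWhile ((=) l) vs" and "d = dropWhile ((=) l) vs"
  have vs: "vs = t @ d" by (simp add: t_def d_def)
  have "\<forall>x\<in>set t. x = l" by (auto simp: t_def dest: set_takeWhileD)
  then obtain n where t: "t = replicate n l" using replicate_length_same by metis
  have srt: "sorted_wrt (\<ge>) d" using Cons.prems(2) vs by (simp add: sorted_wrt_append)
  \<comment> \<open>The head of \<open>d\<close> differs from \<open>l\<close> and is therefore
    smaller, and everything after it is at most the head.\<close>
  have "l \<notin> set d"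
  proof
    assume l: "l \<in> set d"
    then obtain x d' where d': "d = x # d'" by (cases d) auto
    then have "x \<noteq> l" using hd_dropWhile[of "(=) l" vs] unfolding d_def by force
    moreover have "x \<in> set (l # ls)" using Cons.prems(3) vs d' by auto
    ultimately have "x < l" using Cons.prems(1) by auto
    moreover have "l \<le> x" using srt d' l by auto
    ultimately show False by order
  qed
  then have "set d \<subseteq> set ls" using Cons.prems(3) vs by auto
  moreover have "sorted_wrt (>) ls" using Cons.prems(1) by simp
  ultimately obtain ks where ks: "length ks = length ls" "d = power_list ls ks"
    using Cons.IH[OF _ srt] by blast
  have "vs = power_list (l # ls) (n # ks)" unfolding vs t ks(2) by simp
  with ks(1) show ?case by (intro exI[of _ "n # ks"]) simp
qed simp

text \<open>\<open>l\<close> does not recur among the later bases, so the leading run of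
  \<open>l\<close> has exactly the first exponent as its length.\<close>

lemma power_list_inj:
  assumes "distinct ls" "length ks = length ls" "length ks' = length ls"
    "power_list ls ks = power_list ls ks'"
  shows "ks = ks'"
  using assms
proof (induction ls arbitrary: ks ks')
  case (Cons l ls)
  obtain k r k' r' where ks: "ks = k # r" "ks' = k' # r'" "length r = length ls" "length r' = length ls"
    using Cons.prems by (metis length_Suc_conv)
  have nin: "l \<notin> set (power_list ls q)" for q using set_power_list[of ls q] Cons.prems(1) by auto
  have tw: "takeWhile ((=) l) (replicate m l @ power_list ls q) = replicate m l" for m q
    using nin[of q] by (subst takeWhile_append2) (auto simp: takeWhile_eq_Nil_iff neq_Nil_conv)
  have eq: "replicate k l @ power_list ls r = replicate k' l @ power_list ls r'"
    using Cons.prems(4) ks by simp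
  have "replicate k l = replicate k' l" using arg_cong[OF eq, of "takeWhile ((=) l)"] tw by simp
  then have "k = k'" by (metis length_replicate)
  with eq Cons.IH[of r r'] Cons.prems(1) ks show ?case by simp
qed simp

lemma lyndon_list_power_list:
  assumes "sorted_wrt (>) ls" "\<forall>l\<in>set ls. lyndon l"
  shows "lyndon_list (power_list ls ks)"
  using sorted_power_list[OF assms(1)] set_power_list[of ls ks] assms(2) by (auto simp: lyndon_list_def)

lemma lex_decreasing_iff: "lex_decreasing ls \<longleftrightarrow> sorted_wrt (>) ls"
  by (simp add: lex_decreasing_def lex_less_iff)

lemma decreasing_list_exists:
  assumes "finite (A :: 'a::linorder set)"
  shows "\<exists>ls. sorted_wrt (>) ls \<and> set ls = A"
proof -
  have "sorted_wrt (>) (rev (sorted_list_of_set A))"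
    using strict_sorted_list_of_set[of A] by (simp add: sorted_wrt_rev)
  then show ?thesis using assms by (intro exI[of _ "rev (sorted_list_of_set A)"]) simp
qed

lemma power_product_normal:
  assumes "\<forall>w\<in>W. lyndon w" "sorted_wrt (>) ls" "set ls \<subseteq> lyndon_atoms W"
  shows "power_product ls ks \<in> normal_words W"
  unfolding power_product_eq
proof -
  have "\<forall>l\<in>set ls. lyndon l" using assms(3) by (auto simp: lyndon_atoms_def)
  then have "lyndon_list (power_list ls ks)" by (rule lyndon_list_power_list[OF assms(2)])
  moreover have "set (power_list ls ks) \<subseteq> lyndon_atoms W"
    using set_power_list[of ls ks] assms(3) by simp
  ultimately show "concat (power_list ls ks) \<in> normal_words W"
    using concat_in_normal_words_iff[OF assms(1)] by blast
qed

lemma power_product_inj: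
  assumes "sorted_wrt (>) ls" "\<forall>l\<in>set ls. lyndon l"
  shows "inj_on (power_product ls) {ks. length ks = length ls}"
proof (rule inj_onI)
  fix ks ks' assume ks: "ks \<in> {ks. length ks = length ls}" "ks' \<in> {ks. length ks = length ls}"
    and "power_product ls ks = power_product ls ks'"
  then have "power_list ls ks = power_list ls ks'"
    unfolding power_product_eq by (intro lyndon_list_unique lyndon_list_power_list[OF assms])
  moreover have "distinct ls"
    using assms(1) by (induction ls) auto
  ultimately show "ks = ks'" using power_list_inj ks by blast
qed

lemma normal_as_power_product:
  assumes "\<forall>w\<in>W. lyndon w" "sorted_wrt (>) ls" "u \<in> normal_words W"
    "set (lyndon_factors u) \<subseteq> set ls"
  shows "\<exists>ks. length ks = length ls \<and> u = power_product ls ks"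
  using power_list_surj[OF assms(2) _ assms(4)] lyndon_factors[of u]
  unfolding power_product_eq lyndon_list_def by metis

lemma letter_atom:
  assumes "\<forall>w\<in>W. lyndon w" "\<forall>x. [x] \<notin> W"
  shows "[x] \<in> lyndon_atoms W"
proof -
  have "[x] \<in> normal_words W"
    using assms lyndon_nonempty unfolding normal_words_def
    by (auto simp: sublist_Cons_right prefix_Cons)
  then show ?thesis by (simp add: lyndon_atoms_def lyndon_letter)
qed

lemma normal_words_eq_decreasing_products:
  assumes "\<forall>w\<in>W. lyndon w" "\<forall>x. [x] \<notin> W"
  shows "{power_product ls ks | ls ks. length ls \<ge> 1 \<and> length ks = length ls
          \<and> lex_decreasing ls \<and> set ls \<subseteq> lyndon_atoms W} = normal_words W" (is "?P = _")
proof (intro equalityI subsetI)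
  fix u assume "u \<in> ?P"
  then show "u \<in> normal_words W"
    unfolding lex_decreasing_iff using power_product_normal[OF assms(1)] by blast
next
  fix u assume u: "u \<in> normal_words W"
  \<comment> \<open>The empty word has no Lyndon factors, but at least one base is demanded. An
    additional letter makes the list nonempty for every \<open>u\<close>; if it is not a factor, its
    exponent is 0.\<close>
  obtain x where x: "[x] \<in> lyndon_atoms W" using letter_atom[OF assms] by blast
  let ?A = "insert [x] (set (lyndon_factors u))"
  have A: "?A \<subseteq> lyndon_atoms W" using x u normal_iff_factors[OF assms(1)] by blast
  obtain ls where ls: "sorted_wrt (>) ls" "set ls = ?A"
    using decreasing_list_exists[of ?A] by auto
  then have "length ls \<ge> 1" by (cases ls) auto
  moreover obtain ks where "length ks = length ls" "u = power_product ls ks"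
    using normal_as_power_product[OF assms(1) ls(1) u] ls(2) by auto
  ultimately show "u \<in> ?P" unfolding lex_decreasing_iff using ls A by blast
qed

lemma normal_words_eq_power_products:
  assumes "\<forall>w\<in>W. lyndon w" "sorted_wrt (>) ls" "set ls = lyndon_atoms W"
  shows "normal_words W = {power_product ls \<alpha>s | \<alpha>s. length \<alpha>s = length ls}"
  using power_product_normal[OF assms(1,2)] normal_as_power_product[OF assms(1,2)]
    normal_iff_factors[OF assms(1)] assms(3) by blast

section \<open>Convolution rings and the free algebra\<close>

context abelian_monoid
begin

lemma finsum_Sigma:
  assumes "finite A" "\<And>a. a \<in> A \<Longrightarrow> finite (B a)"
    "\<And>a b. a \<in> A \<Longrightarrow> b \<in> B a \<Longrightarrow> f a b \<in> carrier G"
  shows "(\<Oplus>a\<in>A. \<Oplus>b\<in>B a. f a b) = (\<Oplus>p\<in>Sigma A B. f (fst p) (snd p))"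
  using assms
proof (induction A)
  case (insert a A)
  have eq: "Sigma (insert a A) B = Pair a ` B a \<union> Sigma A B" by auto
  have "(\<Oplus>p\<in>Sigma (insert a A) B. f (fst p) (snd p))
      = (\<Oplus>p\<in>Pair a ` B a. f (fst p) (snd p)) \<oplus> (\<Oplus>p\<in>Sigma A B. f (fst p) (snd p))"
    unfolding eq using insert by (intro finsum_Un_disjoint) auto
  also have "(\<Oplus>p\<in>Pair a ` B a. f (fst p) (snd p)) = (\<Oplus>b\<in>B a. f a b)"
    using insert by (subst finsum_reindex) (auto simp: inj_on_def)
  also have "(\<Oplus>p\<in>Sigma A B. f (fst p) (snd p)) = (\<Oplus>a\<in>A. \<Oplus>b\<in>B a. f a b)"
    using insert by simp
  finally show ?case
    using insert by (subst finsum_insert) (auto intro!: finsum_closed)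
qed simp

lemma finsum_swap:
  assumes "finite A" "finite B" "\<And>a b. a \<in> A \<Longrightarrow> b \<in> B \<Longrightarrow> f a b \<in> carrier G"
  shows "(\<Oplus>a\<in>A. \<Oplus>b\<in>B. f a b) = (\<Oplus>b\<in>B. \<Oplus>a\<in>A. f a b)"
  using assms
proof (induction A)
  case (insert a A)
  then have "(\<Oplus>b\<in>B. \<Oplus>x\<in>insert a A. f x b) = (\<Oplus>b\<in>B. f a b \<oplus> (\<Oplus>x\<in>A. f x b))"
    by (intro finsum_cong') (auto intro!: finsum_closed)
  also have "\<dots> = (\<Oplus>b\<in>B. f a b) \<oplus> (\<Oplus>b\<in>B. \<Oplus>x\<in>A. f x b)"
    using insert by (intro finsum_addf) (auto intro!: finsum_closed)
  finally show ?case using insert by (simp add: finsum_insert finsum_closed Pi_def)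
qed simp

lemma finsum_eq_single:
  assumes "finite A" "a \<in> A" "f a \<in> carrier G" "\<And>x. x \<in> A \<Longrightarrow> x \<noteq> a \<Longrightarrow> f x = \<zero>"
  shows "finsum G f A = f a"
proof -
  have "f \<in> A \<rightarrow> carrier G" using assms(3,4) by (metis Pi_I zero_closed)
  then have "finsum G f {a} = finsum G f A"
    using assms by (intro add.finprod_mono_neutral_cong_left) auto
  then show ?thesis using assms(3) by simp
qed

lemma finsum_eq_zero: "(\<And>x. x \<in> A \<Longrightarrow> f x = \<zero>) \<Longrightarrow> finsum G f A = \<zero>"
  by (rule add.finprod_one_eqI)

end

text \<open>Transfers the ring axioms to a separate record whose operations have to agree only on
  \<open>H\<close>. The free algebra is obtained in this way from the convolution ring over
  words.\<close>

lemma (in ring) ring_of_subring: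
  assumes "subring H R" "carrier S = H" "\<one>\<^bsub>S\<^esub> = \<one>" "\<zero>\<^bsub>S\<^esub> = \<zero>"
    "\<And>x y. x \<in> H \<Longrightarrow> y \<in> H \<Longrightarrow> x \<otimes>\<^bsub>S\<^esub> y = x \<otimes> y"
    "\<And>x y. x \<in> H \<Longrightarrow> y \<in> H \<Longrightarrow> x \<oplus>\<^bsub>S\<^esub> y = x \<oplus> y"
  shows "ring S"
proof -
  note H = subringE[OF assms(1)]
  have inv: "\<exists>y\<in>H. x \<oplus> y = \<zero>" if "x \<in> H" for x
    using H(1,5) that r_neg by blast
  have sub: "x \<in> carrier R" if "x \<in> H" for x using H(1) that by blast
  show ?thesis
    by (intro ringI abelian_groupI monoidI)
      (simp_all add: assms(2-) H sub inv a_ac m_assoc l_distr r_distr)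
qed

definition splits :: "'w set \<Rightarrow> ('w \<Rightarrow> 'w \<Rightarrow> 'w) \<Rightarrow> 'w \<Rightarrow> ('w \<times> 'w) set" where
  "splits M f w = {p \<in> M \<times> M. f (fst p) (snd p) = w}"

text \<open>The complete monoid algebra of \<open>M\<close>: supports may be infinite, and the
  product makes sense as soon as every element has finitely many factorisations. Words give
  noncommutative power series, positive integers under multiplication give Dirichlet series.\<close>

definition conv_ring ::
  "('k, 'm) ring_scheme \<Rightarrow> 'w set \<Rightarrow> ('w \<Rightarrow> 'w \<Rightarrow> 'w) \<Rightarrow> 'w \<Rightarrow> ('w \<Rightarrow> 'k) ring" where
  "conv_ring R M f e = \<lparr>
     carrier = {g. \<forall>w. g w \<in> carrier R \<and> (w \<notin> M \<longrightarrow> g w = \<zero>\<^bsub>R\<^esub>)},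
     monoid.mult = (\<lambda>g h w. \<Oplus>\<^bsub>R\<^esub>p\<in>splits M f w. g (fst p) \<otimes>\<^bsub>R\<^esub> h (snd p)),
     one = (\<lambda>w. if w = e then \<one>\<^bsub>R\<^esub> else \<zero>\<^bsub>R\<^esub>),
     ring.zero = (\<lambda>w. \<zero>\<^bsub>R\<^esub>),
     add = (\<lambda>g h w. g w \<oplus>\<^bsub>R\<^esub> h w)\<rparr>"

locale convolution = ring R for R (structure) +
  fixes M :: "'w set" and cat :: "'w \<Rightarrow> 'w \<Rightarrow> 'w" and e :: 'w
  assumes cat_closed: "a \<in> M \<Longrightarrow> b \<in> M \<Longrightarrow> cat a b \<in> M"
    and e_closed: "e \<in> M"
    and cat_assoc: "a \<in> M \<Longrightarrow> b \<in> M \<Longrightarrow> c \<in> M \<Longrightarrow> cat (cat a b) c = cat a (cat b c)"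
    and e_left: "a \<in> M \<Longrightarrow> cat e a = a" and e_right: "a \<in> M \<Longrightarrow> cat a e = a"
    and finite_splits: "finite (splits M cat w)"
begin

abbreviation "C \<equiv> conv_ring R M cat e"

lemma conv_carrierD:
  assumes "f \<in> carrier C"
  shows "f w \<in> carrier R" "w \<notin> M \<Longrightarrow> f w = \<zero>"
  using assms by (auto simp: conv_ring_def)

lemma conv_mult: "(f \<otimes>\<^bsub>C\<^esub> g) w = (\<Oplus>p\<in>splits M cat w. f (fst p) \<otimes> g (snd p))"
  by (simp add: conv_ring_def)

lemma conv_mult_closed:
  assumes "f \<in> carrier C" "g \<in> carrier C"
  shows "f \<otimes>\<^bsub>C\<^esub> g \<in> carrier C"
proof -
  have "(f \<otimes>\<^bsub>C\<^esub> g) w \<in> carrier R" for w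
    unfolding conv_mult using conv_carrierD assms by (intro finsum_closed) auto
  moreover have "splits M cat w = {}" if "w \<notin> M" for w
    using cat_closed that by (auto simp: splits_def)
  ultimately show ?thesis by (auto simp: conv_ring_def)
qed

text \<open>Both bracketings are reindexed to the same sum over the triples with product
  \<open>w\<close>.\<close>

lemma conv_assoc:
  assumes "f \<in> carrier C" "g \<in> carrier C" "h \<in> carrier C"
  shows "f \<otimes>\<^bsub>C\<^esub> g \<otimes>\<^bsub>C\<^esub> h = f \<otimes>\<^bsub>C\<^esub> (g \<otimes>\<^bsub>C\<^esub> h)"
proof
  fix w
  note cl [simp] = assms[THEN conv_carrierD(1)]
  let ?S = "splits M cat"
  let ?T = "{(a, b, c). a \<in> M \<and> b \<in> M \<and> c \<in> M \<and> cat a (cat b c) = w}"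
  let ?F = "\<lambda>(a, b, c). f a \<otimes> g b \<otimes> h c"
  have "(f \<otimes>\<^bsub>C\<^esub> g \<otimes>\<^bsub>C\<^esub> h) w = (\<Oplus>p\<in>?S w. (\<Oplus>q\<in>?S (fst p). f (fst q) \<otimes> g (snd q)) \<otimes> h (snd p))"
    by (simp add: conv_mult)
  also have "\<dots> = (\<Oplus>p\<in>?S w. \<Oplus>q\<in>?S (fst p). ?F (fst q, snd q, snd p))"
    by (intro finsum_cong') (auto simp: finsum_ldistr finite_splits intro!: finsum_closed)
  also have "\<dots> = (\<Oplus>x\<in>Sigma (?S w) (\<lambda>p. ?S (fst p)). ?F (fst (snd x), snd (snd x), snd (fst x)))"
    by (subst finsum_Sigma) (auto simp: finite_splits)
  also have "\<dots> = finsum R ?F ((\<lambda>x. (fst (snd x), snd (snd x), snd (fst x))) ` Sigma (?S w) (\<lambda>p. ?S (fst p)))"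
    by (rule finsum_reindex[symmetric]) (auto simp: inj_on_def splits_def)
  also have "(\<lambda>x. (fst (snd x), snd (snd x), snd (fst x))) ` Sigma (?S w) (\<lambda>p. ?S (fst p)) = ?T"
    by (force simp: splits_def cat_closed cat_assoc image_iff)
  also have "?T = (\<lambda>x. (fst (fst x), fst (snd x), snd (snd x))) ` Sigma (?S w) (\<lambda>p. ?S (snd p))"
    by (force simp: splits_def cat_closed image_iff)
  also have "finsum R ?F \<dots> = (\<Oplus>x\<in>Sigma (?S w) (\<lambda>p. ?S (snd p)). ?F (fst (fst x), fst (snd x), snd (snd x)))"
    by (rule finsum_reindex) (auto simp: inj_on_def splits_def)
  also have "\<dots> = (\<Oplus>p\<in>?S w. \<Oplus>q\<in>?S (snd p). ?F (fst p, fst q, snd q))"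
    by (subst finsum_Sigma) (auto simp: finite_splits)
  also have "\<dots> = (\<Oplus>p\<in>?S w. f (fst p) \<otimes> (\<Oplus>q\<in>?S (snd p). g (fst q) \<otimes> h (snd q)))"
    by (intro finsum_cong') (auto simp: finsum_rdistr finite_splits m_assoc case_prod_beta intro!: finsum_closed)
  also have "\<dots> = (f \<otimes>\<^bsub>C\<^esub> (g \<otimes>\<^bsub>C\<^esub> h)) w" by (simp add: conv_mult)
  finally show "(f \<otimes>\<^bsub>C\<^esub> g \<otimes>\<^bsub>C\<^esub> h) w = (f \<otimes>\<^bsub>C\<^esub> (g \<otimes>\<^bsub>C\<^esub> h)) w" .
qed

lemma conv_one:
  assumes "f \<in> carrier C"
  shows "\<one>\<^bsub>C\<^esub> \<otimes>\<^bsub>C\<^esub> f = f" "f \<otimes>\<^bsub>C\<^esub> \<one>\<^bsub>C\<^esub> = f"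
proof -
  note cl [simp] = conv_carrierD(1)[OF assms]
  have one: "\<one>\<^bsub>C\<^esub> w = (if w = e then \<one> else \<zero>)" for w by (simp add: conv_ring_def)
  have "(\<one>\<^bsub>C\<^esub> \<otimes>\<^bsub>C\<^esub> f) w = f w \<and> (f \<otimes>\<^bsub>C\<^esub> \<one>\<^bsub>C\<^esub>) w = f w" for w
  proof (cases "w \<in> M")
    case True
    have "(\<one>\<^bsub>C\<^esub> \<otimes>\<^bsub>C\<^esub> f) w = \<one>\<^bsub>C\<^esub> (fst (e, w)) \<otimes> f (snd (e, w))"
      unfolding conv_mult by (rule finsum_eq_single)
        (use True in \<open>auto simp: splits_def finite_splits[unfolded splits_def] one e_closed e_left\<close>)
    moreover have "(f \<otimes>\<^bsub>C\<^esub> \<one>\<^bsub>C\<^esub>) w = f (fst (w, e)) \<otimes> \<one>\<^bsub>C\<^esub> (snd (w, e))"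
      unfolding conv_mult by (rule finsum_eq_single)
        (use True in \<open>auto simp: splits_def finite_splits[unfolded splits_def] one e_closed e_right\<close>)
    ultimately show ?thesis by (simp add: one)
  next
    case False
    then have "splits M cat w = {}" using cat_closed by (auto simp: splits_def)
    then show ?thesis using conv_carrierD(2)[OF assms False] by (simp add: conv_mult)
  qed
  then show "\<one>\<^bsub>C\<^esub> \<otimes>\<^bsub>C\<^esub> f = f" "f \<otimes>\<^bsub>C\<^esub> \<one>\<^bsub>C\<^esub> = f" by auto
qed

lemma conv_distr:
  assumes "f \<in> carrier C" "g \<in> carrier C" "h \<in> carrier C"
  shows "(f \<oplus>\<^bsub>C\<^esub> g) \<otimes>\<^bsub>C\<^esub> h = f \<otimes>\<^bsub>C\<^esub> h \<oplus>\<^bsub>C\<^esub> g \<otimes>\<^bsub>C\<^esub> h"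
    "h \<otimes>\<^bsub>C\<^esub> (f \<oplus>\<^bsub>C\<^esub> g) = h \<otimes>\<^bsub>C\<^esub> f \<oplus>\<^bsub>C\<^esub> h \<otimes>\<^bsub>C\<^esub> g"
proof -
  note cl [simp] = assms[THEN conv_carrierD(1)]
  have add: "(f \<oplus>\<^bsub>C\<^esub> g) w = f w \<oplus> g w" for f g w by (simp add: conv_ring_def)
  show "(f \<oplus>\<^bsub>C\<^esub> g) \<otimes>\<^bsub>C\<^esub> h = f \<otimes>\<^bsub>C\<^esub> h \<oplus>\<^bsub>C\<^esub> g \<otimes>\<^bsub>C\<^esub> h"
    "h \<otimes>\<^bsub>C\<^esub> (f \<oplus>\<^bsub>C\<^esub> g) = h \<otimes>\<^bsub>C\<^esub> f \<oplus>\<^bsub>C\<^esub> h \<otimes>\<^bsub>C\<^esub> g"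
    by (auto simp: fun_eq_iff add conv_mult l_distr r_distr finsum_addf)
qed

lemma conv_ring: "ring C"
proof (intro ringI)
  have "\<exists>g\<in>carrier C. g \<oplus>\<^bsub>C\<^esub> f = \<zero>\<^bsub>C\<^esub>" if "f \<in> carrier C" for f
    by (rule bexI[of _ "\<lambda>w. \<ominus> f w"]) (use that in \<open>auto simp: conv_ring_def l_neg\<close>)
  then show "abelian_group C"
    by (intro abelian_groupI) (auto simp: conv_ring_def a_ac)
  have "\<one>\<^bsub>C\<^esub> \<in> carrier C" using e_closed by (auto simp: conv_ring_def)
  then show "Group.monoid C"
    by (intro monoidI) (simp_all add: conv_mult_closed conv_assoc conv_one)
qed (simp_all add: conv_distr)

end

lemma splits_append: "splits UNIV (@) w = (\<lambda>i. (take i w, drop i w)) ` {..length w}"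
proof (intro equalityI subsetI)
  fix p assume "p \<in> splits UNIV (@) w"
  then show "p \<in> (\<lambda>i. (take i w, drop i w)) ` {..length w}"
    by (intro image_eqI[of _ _ "length (fst p)"]) (auto simp: splits_def)
qed (auto simp: splits_def)

lemma (in ring) convolution_words: "convolution R UNIV (@) []"
  by unfold_locales (auto simp: splits_append)

section \<open>The free algebra as the finitely supported part of a convolution ring\<close>

context ring
begin

abbreviation "FA \<equiv> free_algebra R"

lemma free_carrier_iff:
  "f \<in> carrier FA \<longleftrightarrow> (\<forall>w. f w \<in> carrier R) \<and> finite {w. f w \<noteq> \<zero>}"
  by (auto simp: free_algebra_def)

lemma free_carrierD:
  assumes "f \<in> carrier FA"
  shows "f w \<in> carrier R" "finite {w. f w \<noteq> \<zero>}"
  using assms by (simp_all add: free_carrier_iff)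

lemma free_add [simp]: "(f \<oplus>\<^bsub>FA\<^esub> g) w = f w \<oplus> g w"
  and free_zero [simp]: "\<zero>\<^bsub>FA\<^esub> w = \<zero>"
  and free_one: "\<one>\<^bsub>FA\<^esub> = term_elem R \<one> []"
  and free_mult: "(f \<otimes>\<^bsub>FA\<^esub> g) w = (\<Oplus>i\<in>{..length w}. f (take i w) \<otimes> g (drop i w))"
  by (simp_all add: free_algebra_def term_elem_def)

lemma free_mult_eq_conv:
  fixes f g :: "'x list \<Rightarrow> 'a"
  assumes "\<And>w. f w \<in> carrier R" "\<And>w. g w \<in> carrier R"
  shows "f \<otimes>\<^bsub>FA\<^esub> g = f \<otimes>\<^bsub>conv_ring R UNIV (@) []\<^esub> g"
proof
  interpret words: convolution R UNIV "(@)" "[] :: 'x list" by (rule convolution_words)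
  fix w :: "'x list"
  have "inj_on (\<lambda>i. (take i w, drop i w)) {..length w}"
    by (rule inj_onI) (metis Pair_inject atMost_iff length_take min.absorb2)
  then show "(f \<otimes>\<^bsub>FA\<^esub> g) w = (f \<otimes>\<^bsub>conv_ring R UNIV (@) []\<^esub> g) w"
    unfolding free_mult words.conv_mult splits_append
    using assms by (subst finsum_reindex) auto
qed

lemma free_mult_finite_support:
  assumes "f \<in> carrier FA" "g \<in> carrier FA"
  shows "finite {w. (f \<otimes>\<^bsub>FA\<^esub> g) w \<noteq> \<zero>}"
proof (rule finite_subset)
  note fg = assms[THEN free_carrierD(1)]
  show "{w. (f \<otimes>\<^bsub>FA\<^esub> g) w \<noteq> \<zero>} \<subseteq> (\<lambda>(a, b). a @ b) ` ({w. f w \<noteq> \<zero>} \<times> {w. g w \<noteq> \<zero>})"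
  proof
    fix w assume "w \<in> {w. (f \<otimes>\<^bsub>FA\<^esub> g) w \<noteq> \<zero>}"
    then obtain i where i: "f (take i w) \<otimes> g (drop i w) \<noteq> \<zero>"
      unfolding free_mult mem_Collect_eq using finsum_eq_zero by meson
    then have "f (take i w) \<noteq> \<zero>" "g (drop i w) \<noteq> \<zero>"
      using fg by auto
    then show "w \<in> (\<lambda>(a, b). a @ b) ` ({w. f w \<noteq> \<zero>} \<times> {w. g w \<noteq> \<zero>})"
      by (intro image_eqI[of _ _ "(take i w, drop i w)"]) auto
  qed
  show "finite ((\<lambda>(a, b). a @ b) ` ({w. f w \<noteq> \<zero>} \<times> {w. g w \<noteq> \<zero>}))"
    using assms free_carrierD(2) by blast
qed

lemma free_algebra_ring: "ring (free_algebra R :: ('x list \<Rightarrow> 'a) ring)"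
proof -
  interpret words: convolution R UNIV "(@)" "[] :: 'x list" by (rule convolution_words)
  let ?F = "carrier FA :: ('x list \<Rightarrow> 'a) set"
  interpret C: ring words.C by (rule words.conv_ring)
  have sub: "?F \<subseteq> carrier words.C" by (auto simp: free_carrier_iff conv_ring_def)
  have add: "(f \<oplus>\<^bsub>words.C\<^esub> g) w = f w \<oplus> g w" for f g w by (simp add: conv_ring_def)
  have cl: "f w \<in> carrier R" if "f \<in> ?F" for f w using that by (rule free_carrierD)
  have neg: "\<ominus>\<^bsub>words.C\<^esub> f = (\<lambda>w. \<ominus> f w)" if "f \<in> ?F" for f
    using that sub by (intro C.minus_equality)
      (auto simp: conv_ring_def fun_eq_iff l_neg cl)
  have "subring ?F words.C"
  proof (rule C.subringI[OF sub])
    show "\<one>\<^bsub>words.C\<^esub> \<in> ?F" by (auto simp: free_carrier_iff conv_ring_def)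
    show "\<ominus>\<^bsub>words.C\<^esub> f \<in> ?F" if "f \<in> ?F" for f
    proof -
      have "{w. \<ominus> f w \<noteq> \<zero>} \<subseteq> {w. f w \<noteq> \<zero>}" by auto
      then show ?thesis using that unfolding neg[OF that] free_carrier_iff
        by (auto intro: finite_subset)
    qed
    fix f g assume fg: "f \<in> ?F" "g \<in> ?F"
    have "f \<otimes>\<^bsub>words.C\<^esub> g = f \<otimes>\<^bsub>FA\<^esub> g"
      by (rule free_mult_eq_conv[symmetric]) (use fg cl in auto)
    moreover have "(f \<otimes>\<^bsub>words.C\<^esub> g) w \<in> carrier R" for w
      using words.conv_mult_closed[of f g] words.conv_carrierD(1) fg sub by blast
    ultimately show "f \<otimes>\<^bsub>words.C\<^esub> g \<in> ?F"
      using free_mult_finite_support[OF fg] by (simp add: free_carrier_iff)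
    have "{w. f w \<oplus> g w \<noteq> \<zero>} \<subseteq> {w. f w \<noteq> \<zero>} \<union> {w. g w \<noteq> \<zero>}" by auto
    then show "f \<oplus>\<^bsub>words.C\<^esub> g \<in> ?F"
      using fg unfolding free_carrier_iff add by (auto intro: finite_subset)
  qed
  then show ?thesis
  proof (rule C.ring_of_subring)
    show "x \<otimes>\<^bsub>FA\<^esub> y = x \<otimes>\<^bsub>words.C\<^esub> y" if "x \<in> ?F" "y \<in> ?F" for x y
      using that cl by (intro free_mult_eq_conv)
  qed (auto simp: free_algebra_def conv_ring_def)
qed

end

context ring
begin

lemma free_neg:
  assumes "f \<in> carrier FA"
  shows "(\<ominus>\<^bsub>FA\<^esub> f) w = \<ominus> f w"
proof -
  interpret F: ring "free_algebra R" by (rule free_algebra_ring)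
  have "(\<ominus>\<^bsub>FA\<^esub> f) w \<oplus> f w = \<zero>"
    using fun_cong[OF F.l_neg[OF assms], of w] by simp
  moreover have "(\<ominus>\<^bsub>FA\<^esub> f) w \<in> carrier R" "f w \<in> carrier R"
    using free_carrierD(1) F.a_inv_closed[OF assms] assms by blast+
  ultimately show ?thesis by (metis minus_equality minus_minus)
qed

lemma free_finsum_apply:
  assumes "f \<in> A \<rightarrow> carrier FA"
  shows "finsum (free_algebra R) f A w = (\<Oplus>a\<in>A. f a w)"
proof -
  interpret F: ring "free_algebra R" by (rule free_algebra_ring)
  show ?thesis
    using assms
  proof (induction A rule: infinite_finite_induct)
    case (insert a A)
    then have "(\<lambda>a. f a w) \<in> insert a A \<rightarrow> carrier R" using free_carrierD(1) by blast
    with insert show ?case by simp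
  qed (simp_all add: finsum_infinite)
qed

lemma term_closed: "c \<in> carrier R \<Longrightarrow> term_elem R c w \<in> carrier FA"
  by (auto simp: free_carrier_iff term_elem_def)

lemma term_zero: "term_elem R \<zero> w = \<zero>\<^bsub>FA\<^esub>"
  by (auto simp: term_elem_def)

lemma term_add:
  "c \<in> carrier R \<Longrightarrow> d \<in> carrier R \<Longrightarrow>
    term_elem R (c \<oplus> d) w = term_elem R c w \<oplus>\<^bsub>FA\<^esub> term_elem R d w"
  by (auto simp: term_elem_def fun_eq_iff)

lemma term_mult:
  assumes "c \<in> carrier R" "d \<in> carrier R"
  shows "term_elem R c u \<otimes>\<^bsub>FA\<^esub> term_elem R d v = term_elem R (c \<otimes> d) (u @ v)"
proof
  fix w
  show "(term_elem R c u \<otimes>\<^bsub>FA\<^esub> term_elem R d v) w = term_elem R (c \<otimes> d) (u @ v) w"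
  proof (cases "w = u @ v")
    case True
    have "(term_elem R c u \<otimes>\<^bsub>FA\<^esub> term_elem R d v) w
        = term_elem R c u (take (length u) w) \<otimes> term_elem R d v (drop (length u) w)"
      unfolding free_mult
    proof (rule finsum_eq_single)
      show "term_elem R c u (take i w) \<otimes> term_elem R d v (drop i w) = \<zero>"
        if "i \<in> {..length w}" "i \<noteq> length u" for i
      proof -
        have "take i w \<noteq> u" using that by auto
        then show ?thesis using assms by (simp add: term_elem_def)
      qed
    qed (use True assms in \<open>auto simp: term_elem_def\<close>)
    then show ?thesis using True by (simp add: term_elem_def)
  next
    case False
    then have "take i w \<noteq> u \<or> drop i w \<noteq> v" for i by (metis append_take_drop_id)
    then show ?thesis unfolding free_mult
      using False assms by (subst finsum_eq_zero) (auto simp: term_elem_def)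
  qed
qed

text \<open>Removes one word from the support at a time. The premise \<open>g w = \<zero>\<close>
  says that \<open>w\<close> is new, so nothing cancels and a vanishing condition on the sum passes
  to both summands.\<close>

lemma free_algebra_induct [consumes 1, case_names zero add]:
  assumes "f \<in> carrier FA"
    and zero: "P \<zero>\<^bsub>FA\<^esub>"
    and add: "\<And>c w g. c \<in> carrier R \<Longrightarrow> g \<in> carrier FA \<Longrightarrow> g w = \<zero> \<Longrightarrow> P g \<Longrightarrow>
      P (term_elem R c w \<oplus>\<^bsub>FA\<^esub> g)"
  shows "P f"
proof -
  have "P f" if "finite S" "f \<in> carrier FA" "\<forall>w. w \<notin> S \<longrightarrow> f w = \<zero>" for S f
    using that
  proof (induction S arbitrary: f)
    case empty
    then have "f = \<zero>\<^bsub>FA\<^esub>" by auto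
    then show ?case by (simp only: zero)
  next
    case (insert v S)
    let ?g = "f(v := \<zero>)"
    have "{w. ?g w \<noteq> \<zero>} \<subseteq> {w. f w \<noteq> \<zero>}" by auto
    then have g: "?g \<in> carrier FA"
      using insert.prems(1) by (auto simp: free_carrier_iff intro: finite_subset)
    have fc: "f w \<in> carrier R" for w using insert.prems(1) by (rule free_carrierD)
    have "f = term_elem R (f v) v \<oplus>\<^bsub>FA\<^esub> ?g"
      using fc by (auto simp: fun_eq_iff term_elem_def)
    moreover have "P ?g" by (rule insert.IH[OF g]) (use insert.prems(2) in auto)
    ultimately show ?case using add[OF fc g] by (metis fun_upd_same)
  qed
  from this[OF free_carrierD(2)[OF assms(1)] assms(1)] show ?thesis by blast
qed

end

section \<open>Monomial quotients\<close>

locale monomial_quotient = ring R for R (structure) +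
  fixes W :: "'x list set"
begin

abbreviation "F \<equiv> free_algebra R :: ('x list \<Rightarrow> 'a) ring"
abbreviation "A \<equiv> word_algebra R W"
abbreviation "\<rho> \<equiv> residue_class R W"

sublocale F: ring F by (rule free_algebra_ring)

lemma term_in_word_ideal:
  assumes "c \<in> carrier R" "w \<notin> normal_words W"
  shows "term_elem R c w \<in> word_ideal R W"
proof -
  have sub: "term_elem R \<one> ` W \<subseteq> carrier F" by (auto intro: term_closed)
  interpret I: ideal "word_ideal R W" F
    unfolding word_ideal_def by (rule F.genideal_ideal[OF sub])
  from assms obtain a v b where v: "v \<in> W" "w = a @ v @ b"
    by (auto simp: normal_words_def sublist_def)
  have "term_elem R \<one> v \<in> word_ideal R W"
    unfolding word_ideal_def using F.genideal_self[OF sub] v(1) by blast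
  then have "term_elem R c a \<otimes>\<^bsub>F\<^esub> (term_elem R \<one> v \<otimes>\<^bsub>F\<^esub> term_elem R \<one> b)
      \<in> word_ideal R W"
    using assms(1) by (intro I.I_l_closed I.I_r_closed term_closed) auto
  then show ?thesis using assms(1) v(2) by (simp add: term_mult)
qed

text \<open>Both parts of every splitting of a normal word are normal, so each summand of the
  coefficient of a product at a normal word has a factor zero.\<close>

lemma ideal_vanishing_on_normal_words:
  "ideal {f \<in> carrier F. \<forall>w\<in>normal_words W. f w = \<zero>} F"
    (is "ideal ?I _")
proof -
  show ?thesis
  proof (rule idealI[OF F.ring_axioms])
    show "subgroup ?I (add_monoid F)"
      by (rule F.add.subgroupI) (auto simp: free_neg)
    fix f x assume f: "f \<in> ?I" and x: "x \<in> carrier F"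
    have tk: "f (take i w) = \<zero>" "f (drop i w) = \<zero>" if "w \<in> normal_words W" for i w
      using f normal_sublist[OF that] sublist_take sublist_drop by blast+
    note cl = free_carrierD(1)[OF x]
    show "x \<otimes>\<^bsub>F\<^esub> f \<in> ?I" "f \<otimes>\<^bsub>F\<^esub> x \<in> ?I"
      using f x by (auto simp: free_mult tk cl intro: finsum_eq_zero)
  qed
qed

text \<open>The ideal is spanned by the words that are not normal. This coordinate description
  reduces equality in the quotient to equality of the coefficients at the normal words.\<close>

lemma word_ideal_eq:
  "word_ideal R W = {f \<in> carrier F. \<forall>w\<in>normal_words W. f w = \<zero>}" (is "_ = ?I")
proof
  have sub: "term_elem R \<one> ` W \<subseteq> carrier F" by (auto intro: term_closed)
  have "term_elem R \<one> ` W \<subseteq> ?I"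
    using sub by (auto simp: term_elem_def normal_words_def)
  then show "word_ideal R W \<subseteq> ?I"
    unfolding word_ideal_def by (rule F.genideal_minimal[OF ideal_vanishing_on_normal_words])
  interpret I: ideal "word_ideal R W" F
    unfolding word_ideal_def by (rule F.genideal_ideal[OF sub])
  have "(\<forall>w\<in>normal_words W. f w = \<zero>) \<longrightarrow> f \<in> word_ideal R W" if "f \<in> carrier F" for f
    using that
  proof (induction rule: free_algebra_induct)
    case zero
    then show ?case using I.zero_closed by blast
  next
    case (add c w g)
    show ?case
    proof
      assume van: "\<forall>v\<in>normal_words W. (term_elem R c w \<oplus>\<^bsub>F\<^esub> g) v = \<zero>"
      have "\<forall>v\<in>normal_words W. g v = \<zero>"
      proof
        fix v assume "v \<in> normal_words W"
        then show "g v = \<zero>" using van add.hyps free_carrierD(1)[OF add.hyps(2), of v]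
          by (cases "v = w") (auto simp: term_elem_def)
      qed
      moreover have "term_elem R c w \<in> word_ideal R W"
      proof (cases "w \<in> normal_words W")
        case True
        \<comment> \<open>At the normal word \<open>w\<close> the sum has the coefficient
          \<open>c\<close>, because \<open>g\<close> vanishes there.\<close>
        then have "c = \<zero>" using van add.hyps by (auto simp: term_elem_def)
        then show ?thesis using I.zero_closed term_zero by metis
      qed (use add.hyps term_in_word_ideal in blast)
      ultimately show "term_elem R c w \<oplus>\<^bsub>F\<^esub> g \<in> word_ideal R W"
        using add.IH I.a_closed by blast
    qed
  qed
  then show "?I \<subseteq> word_ideal R W" by blast
qed

lemma word_ideal_ideal: "ideal (word_ideal R W) F"
  unfolding word_ideal_eq by (rule ideal_vanishing_on_normal_words)

lemma word_algebra_ring: "ring A"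
  unfolding word_algebra_def by (rule ideal.quotient_is_ring[OF word_ideal_ideal])

lemma residue_class_hom: "\<rho> \<in> ring_hom F A"
  unfolding word_algebra_def residue_class_def by (rule ideal.rcos_ring_hom[OF word_ideal_ideal])

lemma residue_class_hom_ring: "ring_hom_ring F A (\<rho>)"
  using free_algebra_ring word_algebra_ring residue_class_hom by (rule ring_hom_ringI2)

sublocale A: ring A by (rule word_algebra_ring)
sublocale \<pi>: ring_hom_ring F A \<rho> by (rule residue_class_hom_ring)

lemma carrier_word_algebra:
  "carrier A = \<rho> ` carrier F"
  unfolding word_algebra_def FactRing_def A_RCOSETS_def' residue_class_def by auto

lemma residue_class_eq:
  assumes "f \<in> carrier F"
  shows "\<rho> f
    = {g \<in> carrier F. \<forall>w\<in>normal_words W. g w = f w}"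
proof -
  interpret I: ideal "word_ideal R W" F by (rule word_ideal_ideal)
  have sub: "\<rho> f \<subseteq> carrier F"
    unfolding residue_class_def using F.a_r_coset_subset_G[OF I.a_subset assms] .
  have "g \<in> \<rho> f \<longleftrightarrow> (\<forall>w\<in>normal_words W. g w = f w)"
    if g: "g \<in> carrier F" for g
  proof -
    have "g \<in> \<rho> f
        \<longleftrightarrow> g \<oplus>\<^bsub>F\<^esub> \<ominus>\<^bsub>F\<^esub> f \<in> word_ideal R W"
      unfolding residue_class_def by (rule I.a_rcos_module[OF assms g])
    also have "\<dots> \<longleftrightarrow> (\<forall>w\<in>normal_words W. g w \<ominus> f w = \<zero>)"
    proof -
      have "g \<oplus>\<^bsub>F\<^esub> \<ominus>\<^bsub>F\<^esub> f \<in> carrier F"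
        using assms g by (intro F.a_closed F.a_inv_closed)
      moreover have "(g \<oplus>\<^bsub>F\<^esub> \<ominus>\<^bsub>F\<^esub> f) w = g w \<ominus> f w" for w
        by (simp only: free_add free_neg[OF assms] a_minus_def)
      ultimately show ?thesis by (simp only: word_ideal_eq mem_Collect_eq simp_thms)
    qed
    also have "\<dots> \<longleftrightarrow> (\<forall>w\<in>normal_words W. g w = f w)"
      by (simp only: r_right_minus_eq[OF free_carrierD(1)[OF g] free_carrierD(1)[OF assms]])
    finally show ?thesis .
  qed
  with sub show ?thesis by blast
qed

lemma residue_class_eq_iff:
  assumes "f \<in> carrier F" "g \<in> carrier F"
  shows "\<rho> f = \<rho> g \<longleftrightarrow> (\<forall>w\<in>normal_words W. f w = g w)"
  using assms by (auto simp: residue_class_eq)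

lemma hom_factors_through_word_algebra:
  assumes "ring B" "h \<in> ring_hom F B" "\<And>w. w \<in> W \<Longrightarrow> h (term_elem R \<one> w) = \<zero>\<^bsub>B\<^esub>"
  shows "\<exists>\<phi>\<in>ring_hom A B. \<forall>f\<in>carrier F. \<phi> (\<rho> f) = h f"
proof -
  interpret B: ring B by fact
  interpret h: ring_hom_ring F B h by (rule ring_hom_ringI2[OF F.ring_axioms assms(1,2)])
  interpret I: ideal "word_ideal R W" F by (rule word_ideal_ideal)
  have ker: "word_ideal R W \<subseteq> a_kernel F B h"
    unfolding word_ideal_def
  proof (rule F.genideal_minimal[OF h.kernel_is_ideal])
    show "term_elem R \<one> ` W \<subseteq> a_kernel F B h"
      unfolding a_kernel_def' using assms(3) term_closed[OF one_closed] by blast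
  qed
  have h_eq: "h f = h g" if fg: "f \<in> carrier F" "g \<in> \<rho> f" for f g
  proof -
    obtain i where i: "i \<in> word_ideal R W" "g = i \<oplus>\<^bsub>F\<^esub> f"
      using fg(2) unfolding residue_class_def a_r_coset_def' by blast
    have "h i = \<zero>\<^bsub>B\<^esub>" using ker i(1) unfolding a_kernel_def' by blast
    then have "h g = \<zero>\<^bsub>B\<^esub> \<oplus>\<^bsub>B\<^esub> h f" unfolding i(2) using h.hom_add[OF I.Icarr[OF i(1)] fg(1)] by argo
    then show ?thesis using B.l_zero[OF h.hom_closed[OF fg(1)]] by argo
  qed
  \<comment> \<open>Any representative serves, since \<open>h\<close> is constant on residue classes
    by \<open>h_eq\<close>.\<close>
  define \<phi> where "\<phi> a = h (SOME f. f \<in> a)" for a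
  have \<phi>: "\<phi> (\<rho> f) = h f" if "f \<in> carrier F" for f
  proof -
    have "f \<in> \<rho> f" using that by (simp add: residue_class_eq)
    then have "(SOME g. g \<in> \<rho> f) \<in> \<rho> f"
      by (rule someI[of "\<lambda>g. g \<in> \<rho> f"])
    then show ?thesis unfolding \<phi>_def by (rule h_eq[OF that, symmetric])
  qed
  have "\<phi> \<in> ring_hom A B"
  proof (rule ring_hom_memI)
    fix x assume "x \<in> carrier A"
    then obtain f where f: "f \<in> carrier F" "x = \<rho> f"
      unfolding carrier_word_algebra by blast
    then show "\<phi> x \<in> carrier B" by (simp add: \<phi>)
    fix y assume "y \<in> carrier A"
    then obtain g where g: "g \<in> carrier F" "y = \<rho> g"
      unfolding carrier_word_algebra by blast
    have "x \<otimes>\<^bsub>A\<^esub> y = \<rho> (f \<otimes>\<^bsub>F\<^esub> g)"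
      "x \<oplus>\<^bsub>A\<^esub> y = \<rho> (f \<oplus>\<^bsub>F\<^esub> g)"
      by (simp_all only: f g \<pi>.hom_mult \<pi>.hom_add)
    then show "\<phi> (x \<otimes>\<^bsub>A\<^esub> y) = \<phi> x \<otimes>\<^bsub>B\<^esub> \<phi> y"
      "\<phi> (x \<oplus>\<^bsub>A\<^esub> y) = \<phi> x \<oplus>\<^bsub>B\<^esub> \<phi> y"
      by (simp_all only: f(2) g(2) \<phi> f(1) g(1) F.m_closed F.a_closed h.hom_mult h.hom_add)
  next
    show "\<phi> \<one>\<^bsub>A\<^esub> = \<one>\<^bsub>B\<^esub>"
      using \<phi>[OF F.one_closed] by (simp only: \<pi>.hom_one h.hom_one)
  qed
  then show ?thesis using \<phi> by blast
qed

lemma structure_map_hom: "structure_map R W \<in> ring_hom R A"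
proof -
  have term_hom: "(\<lambda>c. term_elem R c []) \<in> ring_hom R F"
    by (rule ring_hom_memI) (simp_all add: term_closed term_add term_mult free_one)
  have "structure_map R W = \<rho> \<circ> (\<lambda>c. term_elem R c [])"
    by (auto simp: structure_map_def)
  then show ?thesis using ring_hom_trans[OF term_hom residue_class_hom] by simp
qed

end

section \<open>Bases of monomial quotients\<close>

text \<open>Excluding the empty word from \<open>W\<close> keeps the quotient nonzero, so that the
  image of \<open>K\<close> in it is a field of scalars.\<close>

locale word_quotient = field K + monomial_quotient K W
  for K :: "('k, 'm) ring_scheme" (structure) and W :: "'x list set" +
  assumes Nil_notin: "[] \<notin> W"
begin

abbreviation "S \<equiv> scalars K W"

lemma Nil_normal: "[] \<in> normal_words W"
  using Nil_notin by (auto simp: normal_words_def)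

lemma A_nontrivial: "\<one>\<^bsub>A\<^esub> \<noteq> \<zero>\<^bsub>A\<^esub>"
proof
  assume "\<one>\<^bsub>A\<^esub> = \<zero>\<^bsub>A\<^esub>"
  then have "\<rho> \<one>\<^bsub>F\<^esub> = \<rho> \<zero>\<^bsub>F\<^esub>" by simp
  then show False
    using residue_class_eq_iff[OF F.one_closed F.zero_closed] Nil_normal
    by (auto simp: free_one term_elem_def)
qed

lemma subfield_scalars: "subfield S A"
proof -
  interpret \<sigma>: ring_hom_ring K A "structure_map K W"
    by (rule ring_hom_ringI2[OF ring_axioms word_algebra_ring structure_map_hom])
  show ?thesis unfolding scalars_def
    using \<sigma>.img_is_subfield(2)[OF carrier_is_subfield A_nontrivial] .
qed

lemma word_class_closed: "word_class K W w \<in> carrier A"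
  unfolding word_class_def using \<pi>.hom_closed[OF term_closed[OF one_closed]] .

lemma scalar_mult_word_class:
  "c \<in> carrier K \<Longrightarrow> structure_map K W c \<otimes>\<^bsub>A\<^esub> word_class K W w = \<rho> (term_elem K c w)"
  by (simp add: structure_map_def word_class_def term_closed term_mult flip: \<pi>.hom_mult)

text \<open>Turns questions about spans into questions about supports. In the inductive step a
  coefficient function is split into its term at \<open>v\<close> and the function with the value at
  \<open>v\<close> set to zero.\<close>

lemma Span_word_classes:
  "A.Span S (map (word_class K W) ws)
    = \<rho> ` {f \<in> carrier F. \<forall>w. f w \<noteq> \<zero> \<longrightarrow> w \<in> set ws}"
proof (induction ws)
  case Nil
  have "{f \<in> carrier F. \<forall>w. f w = \<zero>} = {\<zero>\<^bsub>F\<^esub>}" by (auto simp: fun_eq_iff)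
  then have "\<rho> ` {f \<in> carrier F. \<forall>w. f w \<noteq> \<zero> \<longrightarrow> w \<in> set []} = {\<zero>\<^bsub>A\<^esub>}"
    using \<pi>.hom_zero by simp
  then show ?case by (simp only: list.map A.Span.simps foldr.simps id_apply)
next
  case (Cons v ws)
  have split: "x \<in> A.Span S (map (word_class K W) (v # ws))
    \<longleftrightarrow> (\<exists>c\<in>carrier K. \<exists>f\<in>{f \<in> carrier F. \<forall>w. f w \<noteq> \<zero> \<longrightarrow> w \<in> set ws}.
          x = \<rho> (term_elem K c v \<oplus>\<^bsub>F\<^esub> f))" for x
    using Cons.IH
    by (auto simp: A.line_extension_mem_iff scalars_def scalar_mult_word_class term_closed)
  show ?case
  proof (intro equalityI subsetI)
    fix x assume "x \<in> A.Span S (map (word_class K W) (v # ws))"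
    then obtain c f where cf: "c \<in> carrier K" "f \<in> carrier F" "\<forall>w. f w \<noteq> \<zero> \<longrightarrow> w \<in> set ws"
      "x = \<rho> (term_elem K c v \<oplus>\<^bsub>F\<^esub> f)"
      unfolding split by blast
    then have "term_elem K c v \<oplus>\<^bsub>F\<^esub> f
        \<in> {f \<in> carrier F. \<forall>w. f w \<noteq> \<zero> \<longrightarrow> w \<in> set (v # ws)}"
      using free_carrierD(1)[OF cf(2)] by (auto simp: term_closed) (auto simp: term_elem_def)
    then show "x \<in> \<rho> ` {f \<in> carrier F. \<forall>w. f w \<noteq> \<zero> \<longrightarrow> w \<in> set (v # ws)}"
      using cf by blast
  next
    fix x assume "x \<in> \<rho> ` {f \<in> carrier F. \<forall>w. f w \<noteq> \<zero> \<longrightarrow> w \<in> set (v # ws)}"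
    then obtain f where f: "f \<in> carrier F" "\<forall>w. f w \<noteq> \<zero> \<longrightarrow> w \<in> set (v # ws)"
      "x = \<rho> f" by blast
    let ?g = "f(v := \<zero>)"
    note fc = free_carrierD(1)[OF f(1)]
    have "{w. ?g w \<noteq> \<zero>} \<subseteq> {w. f w \<noteq> \<zero>}" by auto
    then have "?g \<in> carrier F" using f(1) by (auto simp: free_carrier_iff intro: finite_subset)
    moreover have "f = term_elem K (f v) v \<oplus>\<^bsub>F\<^esub> ?g"
      using fc by (auto simp: fun_eq_iff term_elem_def)
    ultimately show "x \<in> A.Span S (map (word_class K W) (v # ws))"
      unfolding split using fc f by (intro bexI[of _ "f v"] bexI[of _ ?g]) auto
  qed
qed

text \<open>If the class of \<open>v\<close> were in the span of the others, a function supported on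
  \<open>ws\<close> would agree with the word \<open>v\<close> at all normal words, in particular at
  \<open>v\<close>, where it is zero.\<close>

lemma independent_word_classes:
  assumes "distinct ws" "set ws \<subseteq> normal_words W"
  shows "A.independent S (map (word_class K W) ws)"
  using assms
proof (induction ws)
  case (Cons v ws)
  have "word_class K W v \<notin> A.Span S (map (word_class K W) ws)"
  proof
    assume "word_class K W v \<in> A.Span S (map (word_class K W) ws)"
    then obtain f where f: "f \<in> carrier F" "\<forall>w. f w \<noteq> \<zero> \<longrightarrow> w \<in> set ws"
      "\<rho> (term_elem K \<one> v) = \<rho> f"
      unfolding Span_word_classes word_class_def by blast
    then have "term_elem K \<one> v v = f v"
      using residue_class_eq_iff[OF term_closed[OF one_closed] f(1)] Cons.prems(2) by auto
    then have "f v \<noteq> \<zero>" by (metis one_not_zero term_elem_def)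
    then show False using f(2) Cons.prems(1) by auto
  qed
  with Cons show ?case by (auto intro: A.li_Cons word_class_closed)
qed simp

lemma inj_on_word_class: "inj_on (word_class K W) (normal_words W)"
proof (rule inj_onI)
  fix u v assume "u \<in> normal_words W" "v \<in> normal_words W" "word_class K W u = word_class K W v"
  then have "term_elem K \<one> u u = term_elem K \<one> v u"
    unfolding word_class_def using residue_class_eq_iff[OF term_closed[OF one_closed] term_closed[OF one_closed]]
    by blast
  then show "u = v" by (auto simp: term_elem_def split: if_splits)
qed

text \<open>The normal form of a class: dropping the words that are not normal changes nothing
  modulo the ideal and does not enlarge the support, so homogeneity is kept.\<close>

lemma residue_class_restrict:
  assumes "f \<in> carrier F"
  shows "\<exists>g\<in>carrier F. \<rho> f = \<rho> g
    \<and> (\<forall>w. g w \<noteq> \<zero> \<longrightarrow> f w \<noteq> \<zero> \<and> w \<in> normal_words W)"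
proof -
  let ?g = "\<lambda>w. if w \<in> normal_words W then f w else \<zero>"
  have "{w. ?g w \<noteq> \<zero>} \<subseteq> {w. f w \<noteq> \<zero>}" by auto
  then have g: "?g \<in> carrier F"
    using assms unfolding free_carrier_iff by (auto intro: finite_subset)
  then show ?thesis
    using residue_class_eq_iff[OF assms g] by (intro bexI[of _ ?g]) auto
qed

lemma normal_words_form_basis: "words_form_basis K W (normal_words W)"
  unfolding words_form_basis_def vs_basis_def
proof (intro conjI allI ballI impI inj_on_word_class)
  show "word_class K W ` normal_words W \<subseteq> carrier A" using word_class_closed by blast
next
  fix us assume us: "distinct us \<and> set us \<subseteq> word_class K W ` normal_words W"
  define ws where "ws = map (inv_into (normal_words W) (word_class K W)) us"
  have "us = map (word_class K W) ws"
    using us by (auto simp: ws_def o_def f_inv_into_f intro!: map_idI[symmetric])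
  moreover have "set ws \<subseteq> normal_words W"
    using us by (auto simp: ws_def intro!: inv_into_into)
  ultimately show "A.independent S us"
    using us independent_word_classes distinct_map by metis
next
  fix a assume "a \<in> carrier A"
  then obtain f where "f \<in> carrier F" "a = \<rho> f" unfolding carrier_word_algebra by blast
  then obtain g where g: "g \<in> carrier F" "a = \<rho> g"
    "\<forall>w. g w \<noteq> \<zero> \<longrightarrow> w \<in> normal_words W" using residue_class_restrict by metis
  obtain ws where ws: "set ws = {w. g w \<noteq> \<zero>}"
    using free_carrierD(2)[OF g(1)] finite_list by metis
  have "a \<in> A.Span S (map (word_class K W) ws)"
    unfolding Span_word_classes using g ws by blast
  moreover have "set (map (word_class K W) ws) \<subseteq> word_class K W ` normal_words W"
    using ws g(3) by auto
  ultimately show "\<exists>us. set us \<subseteq> word_class K W ` normal_words W \<and> a \<in> A.Span S us"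
    by blast
qed

lemma graded_dim_eq:
  assumes "finite {w \<in> normal_words W. length w = n}"
  shows "graded_dim K W n = card {w \<in> normal_words W. length w = n}"
proof -
  obtain ws where ws: "set ws = {w \<in> normal_words W. length w = n}" "distinct ws"
    using finite_distinct_list[OF assms] by blast
  have "graded_component K W n = A.Span S (map (word_class K W) ws)"
    unfolding Span_word_classes graded_component_def
  proof (intro equalityI subsetI)
    fix a assume "a \<in> \<rho> ` {f \<in> carrier F. \<forall>w. f w \<noteq> \<zero> \<longrightarrow> length w = n}"
    then obtain f where f: "f \<in> carrier F" "\<forall>w. f w \<noteq> \<zero> \<longrightarrow> length w = n" "a = \<rho> f"
      by blast
    then show "a \<in> \<rho> ` {f \<in> carrier F. \<forall>w. f w \<noteq> \<zero> \<longrightarrow> w \<in> set ws}"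
      using residue_class_restrict[OF f(1)] ws(1) by auto
  qed (use ws(1) in auto)
  moreover have "A.dimension (length (map (word_class K W) ws)) S (A.Span S (map (word_class K W) ws))"
    using independent_word_classes[of ws] ws by (intro A.dimension_independent) auto
  ultimately have "A.dimension (length ws) S (graded_component K W n)" by simp
  then have "A.dim S (graded_component K W n) = length ws"
    unfolding A.dim_def using A.dimension_is_inj[OF subfield_scalars] by blast
  then show ?thesis unfolding graded_dim_def using ws distinct_card by metis
qed

end

section \<open>Counting power products\<close>

text \<open>The exponent vectors of the monomials of degree \<open>n\<close> in commuting variables
  of degrees \<open>ds\<close>.\<close>

definition exponents :: "nat list \<Rightarrow> nat \<Rightarrow> nat list set" where
  "exponents ds n = {ks. length ks = length ds \<and> sum_list (map2 (*) ks ds) = n}"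

lemma exponent_le_weight:
  fixes ks ds :: "nat list"
  assumes "\<forall>d\<in>set ds. d \<ge> 1" "length ks = length ds" "k \<in> set ks"
  shows "k \<le> sum_list (map2 (*) ks ds)"
  using assms(2,1,3)
proof (induction ks ds rule: list_induct2)
  case (Cons k' ks d ds)
  then have "1 \<le> d" by simp
  then have "k' * 1 \<le> k' * d" by (rule mult_le_mono2)
  moreover have "k = k' \<or> k \<le> sum_list (map2 (*) ks ds)" using Cons by auto
  ultimately have "k \<le> k' * d + sum_list (map2 (*) ks ds)" by linarith
  then show ?case by simp
qed simp

lemma weight_le:
  fixes ks ds :: "nat list"
  assumes "length ks = length ds" "\<forall>k\<in>set ks. k \<le> q"
  shows "sum_list (map2 (*) ks ds) \<le> q * sum_list ds"
  using assms by (induction ks ds rule: list_induct2) (simp_all add: distrib_left add_mono)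

lemma finite_exponents:
  assumes "\<forall>d\<in>set ds. d \<ge> 1"
  shows "finite (exponents ds n)"
proof (rule finite_subset)
  show "exponents ds n \<subseteq> {ks. set ks \<subseteq> {..n} \<and> length ks = length ds}"
    using exponent_le_weight[OF assms] by (auto simp: exponents_def)
qed (rule finite_lists_length_eq, simp)

text \<open>The first exponent is 0 or can be lowered by one. For the generating functions this says
  that multiplication by \<open>1 - t^d\<close> removes the part \<open>d\<close>.\<close>

lemma card_exponents_Cons:
  assumes "\<forall>d\<in>set (d # ds). d \<ge> 1"
  shows "card (exponents (d # ds) n)
    = card (exponents ds n) + (if n < d then 0 else card (exponents (d # ds) (n - d)))"
proof -
  let ?inc = "\<lambda>ks. Suc (hd ks) # tl ks"
  let ?B = "if n < d then {} else ?inc ` exponents (d # ds) (n - d)"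
  have "exponents (d # ds) n = Cons 0 ` exponents ds n \<union> ?B" (is "?L = ?R")
  proof (intro equalityI subsetI)
    fix ks assume "ks \<in> ?L"
    then obtain k r where k: "ks = k # r" "length r = length ds" "k * d + sum_list (map2 (*) r ds) = n"
      by (auto simp: exponents_def length_Suc_conv)
    show "ks \<in> ?R"
    proof (cases k)
      case 0
      then show ?thesis using k by (auto simp: exponents_def)
    next
      case (Suc j)
      then have jr: "j # r \<in> exponents (d # ds) (n - d)" and "\<not> n < d"
        using k by (auto simp: exponents_def)
      have "ks \<in> ?inc ` exponents (d # ds) (n - d)"
        by (rule image_eqI[OF _ jr]) (use Suc k(1) in simp)
      then show ?thesis using \<open>\<not> n < d\<close> by simp
    qed
  next
    fix ks assume "ks \<in> ?R"
    then consider r where "r \<in> exponents ds n" "ks = 0 # r"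
      | r where "d \<le> n" "r \<in> exponents (d # ds) (n - d)" "ks = ?inc r"
      by (cases "n < d") auto
    then show "ks \<in> ?L"
    proof cases
      case 2
      then obtain j r' where "r = j # r'" by (cases r) (auto simp: exponents_def)
      with 2 show ?thesis by (auto simp: exponents_def)
    qed (simp add: exponents_def)
  qed
  moreover have "Cons 0 ` exponents ds n \<inter> ?B = {}" by auto
  moreover have "finite (exponents ds n)" "finite (exponents (d # ds) m)" for m
    using finite_exponents assms by (simp_all del: One_nat_def)
  moreover have inj: "inj_on ?inc (exponents (d # ds) m)" for m
  proof (rule inj_onI)
    fix x y assume "x \<in> exponents (d # ds) m" "y \<in> exponents (d # ds) m" "?inc x = ?inc y"
    then show "x = y" by (cases x; cases y) (simp_all add: exponents_def)
  qed
  ultimately show ?thesis by (cases "n < d") (simp_all add: card_Un_disjoint card_image)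
qed

lemma fps_exponents:
  assumes "\<forall>d\<in>set ds. d \<ge> 1"
  shows "Abs_fps (\<lambda>n. of_nat (card (exponents ds n)) :: rat)
    = (\<Prod>d\<leftarrow>ds. 1 / (1 - fps_X ^ d))"
  using assms
proof (induction ds)
  case Nil
  have "exponents [] n = (if n = 0 then {[]} else {})" for n
    by (auto simp: exponents_def)
  then show ?case by (auto simp: fps_eq_iff)
next
  case (Cons d ds)
  let ?G = "\<lambda>ds. Abs_fps (\<lambda>n. of_nat (card (exponents ds n)) :: rat)"
  let ?u = "1 - fps_X ^ d :: rat fps"
  have "?u * ?G (d # ds) = ?G ds"
    using card_exponents_Cons[OF Cons.prems]
    by (auto simp: fps_eq_iff left_diff_distrib fps_X_power_mult_nth)
  moreover have "fps_nth ?u 0 \<noteq> 0" using Cons.prems by simp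
  ultimately have "?G (d # ds) = inverse ?u * ?G ds"
    using inverse_mult_eq_1[of ?u] by (metis (no_types, lifting) mult.assoc mult_1)
  also have "inverse ?u = 1 / ?u" using \<open>fps_nth ?u 0 \<noteq> 0\<close> by (simp add: fps_divide_unit)
  finally show ?case using Cons by simp
qed

lemma length_power_product:
  "length ks = length ls \<Longrightarrow> length (power_product ls ks) = sum_list (map2 (*) ks (map length ls))"
  unfolding power_product_eq
  by (induction ks ls rule: list_induct2) (auto simp: length_concat sum_list_replicate)

text \<open>If \<open>m\<close> exceeded \<open>d\<close>, the hypothesis would bound
  \<open>n^(m-d)\<close> by \<open>C * M^m\<close> for all \<open>n\<close>, which fails for large
  \<open>n\<close>.\<close>

lemma power_growth_exponent:
  assumes "M \<ge> 1" "\<And>n::nat. n \<ge> 1 \<Longrightarrow> (real n / M) ^ m \<le> C * real n powr d"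
  shows "real m \<le> d"
proof (rule ccontr)
  define e where "e = real m - d"
  assume "\<not> real m \<le> d"
  then have e: "e > 0" by (simp add: e_def)
  \<comment> \<open>One more than the bound to be violated; the absolute value makes
    \<open>L\<close> positive whatever the sign of \<open>C\<close>.\<close>
  define L where "L = \<bar>C\<bar> * M ^ m + 1"
  have L: "L > 0" using assms(1) by (simp add: L_def add_nonneg_pos)
  \<comment> \<open>Chosen so large that \<open>n powr e\<close> is at least
    \<open>L\<close>.\<close>
  define n where "n = nat \<lceil>L powr (1 / e)\<rceil> + 1"
  have n: "n \<ge> 1" "L powr (1 / e) \<le> real n" unfolding n_def by linarith+
  have "L = (L powr (1 / e)) powr e" using L e by (simp add: powr_powr)
  also have "\<dots> \<le> real n powr e" using n e by (intro powr_mono2) auto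
  also have "\<dots> = real n ^ m / real n powr d"
    using n(1) by (simp add: e_def powr_diff powr_realpow)
  also have "\<dots> \<le> C * M ^ m"
  proof -
    have "real n ^ m \<le> C * real n powr d * M ^ m"
      using assms(2)[OF n(1)] assms(1) by (simp add: power_divide field_simps)
    then show ?thesis using n(1) by (simp add: field_simps)
  qed
  also have "\<dots> \<le> \<bar>C\<bar> * M ^ m" using assms(1) by (intro mult_right_mono) auto
  finally show False by (simp add: L_def)
qed

section \<open>Growth\<close>

locale lyndon_quotient = word_quotient K W
  for K :: "('k, 'm) ring_scheme" (structure) and W :: "'x::{finite,linorder} list set" +
  assumes lyndon_W: "\<forall>w\<in>W. lyndon w"
begin

abbreviation "N \<equiv> lyndon_atoms W"

lemma finite_words_of_length: "finite {w :: 'x list. P w \<and> length w = n}"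
  using finite_lists_length_eq[of "UNIV :: 'x set" n] by (rule rev_finite_subset) auto

lemma finite_words_upto_length: "finite {w :: 'x list. P w \<and> length w \<le> n}"
  using finite_lists_length_le[of "UNIV :: 'x set" n] by (rule rev_finite_subset) auto

lemma graded_dim_eq_card: "graded_dim K W n = card {w \<in> normal_words W. length w = n}"
  by (rule graded_dim_eq[OF finite_words_of_length])

abbreviation "growth n \<equiv> \<Sum>i\<le>n. graded_dim K W i"

lemma sum_graded_dim: "growth n = card {w \<in> normal_words W. length w \<le> n}"
proof -
  have "{w \<in> normal_words W. length w \<le> n} = (\<Union>i\<in>{..n}. {w \<in> normal_words W. length w = i})"
    by auto
  then show ?thesis
    unfolding graded_dim_eq_card by (subst card_UN_disjoint[symmetric]) (auto simp: finite_words_of_length)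
qed

lemma atoms_lyndon: "set ls \<subseteq> N \<Longrightarrow> \<forall>l\<in>set ls. lyndon l"
  by (auto simp: lyndon_atoms_def)

lemma atom_lengths: "set ls \<subseteq> N \<Longrightarrow> \<forall>d\<in>set (map length ls). d \<ge> 1"
  using atoms_lyndon lyndon_nonempty by (auto simp: Suc_le_eq)

text \<open>All exponents up to a fixed fraction of \<open>n\<close> give distinct normal words of
  length at most \<open>n\<close>. Only some of the atoms need be listed, so the bound also serves
  when there are infinitely many.\<close>

lemma sum_graded_dim_lower:
  assumes "sorted_wrt (>) ls" "set ls \<subseteq> N"
  shows "\<exists>M\<ge>1. \<forall>n. (real n / M) ^ length ls \<le> real (growth n)"
proof (intro exI conjI allI)
  fix n
  \<comment> \<open>With all exponents at most \<open>n div ?M\<close> the total length stays within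
    \<open>n\<close>. The successor keeps the divisor positive even for an empty list.\<close>
  let ?M = "Suc (sum_list (map length ls))"
  let ?q = "n div ?M"
  let ?E = "{ks. set ks \<subseteq> {..?q} \<and> length ks = length ls}"
  have "power_product ls ` ?E \<subseteq> {w \<in> normal_words W. length w \<le> n}"
  proof (clarify, intro conjI)
    fix ks assume ks: "set ks \<subseteq> {..?q}" "length ks = length ls"
    show "power_product ls ks \<in> normal_words W" by (rule power_product_normal[OF lyndon_W assms])
    have "length (power_product ls ks) \<le> ?q * sum_list (map length ls)"
      unfolding length_power_product[OF ks(2)] by (rule weight_le) (use ks in auto)
    also have "\<dots> \<le> ?q * ?M" by simp
    also have "\<dots> \<le> n" by (rule div_times_less_eq_dividend)
    finally show "length (power_product ls ks) \<le> n" .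
  qed
  then have "card (power_product ls ` ?E) \<le> growth n"
    unfolding sum_graded_dim by (intro card_mono finite_words_upto_length)
  moreover have "inj_on (power_product ls) ?E"
    using power_product_inj[OF assms(1) atoms_lyndon[OF assms(2)]] by (rule inj_on_subset) auto
  ultimately have "Suc ?q ^ length ls \<le> growth n"
    by (simp add: card_image card_lists_length_eq)
  then have "real (Suc ?q) ^ length ls \<le> real (growth n)"
    by (metis of_nat_le_iff of_nat_power)
  moreover have "real n / real ?M \<le> real (Suc ?q)"
  proof -
    have "n \<le> Suc ?q * ?M" using dividend_less_div_times[of ?M n] by simp
    then have "real n \<le> real (Suc ?q) * real ?M" by (metis of_nat_le_iff of_nat_mult)
    then show ?thesis by (subst pos_divide_le_eq) auto
  qed
  then have "(real n / real ?M) ^ length ls \<le> real (Suc ?q) ^ length ls"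
    by (intro power_mono) auto
  ultimately show "(real n / real ?M) ^ length ls \<le> real (growth n)" by linarith
qed simp

text \<open>Atoms have length at least 1, so in a word of length at most \<open>n\<close> every
  exponent is at most \<open>n\<close>. There are \<open>(n+1)^s\<close> exponent vectors for
  \<open>s\<close> atoms, and \<open>n + 1 \<le> 2 * n\<close> produces the constant
  \<open>2^s\<close>.\<close>

lemma sum_graded_dim_upper:
  assumes "sorted_wrt (>) ls" "set ls = N" "n \<ge> 1"
  shows "real (growth n) \<le> 2 ^ length ls * real n powr real (length ls)"
proof -
  let ?E = "{ks. set ks \<subseteq> {..n} \<and> length ks = length ls}"
  have "{w \<in> normal_words W. length w \<le> n} \<subseteq> power_product ls ` ?E"
  proof
    fix w assume w: "w \<in> {w \<in> normal_words W. length w \<le> n}"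
    then obtain ks where ks: "length ks = length ls" "w = power_product ls ks"
      using normal_words_eq_power_products[OF lyndon_W assms(1,2)] by blast
    have "set ks \<subseteq> {..n}"
    proof
      fix k assume "k \<in> set ks"
      then have "k \<le> length w"
        unfolding ks(2) length_power_product[OF ks(1)]
        using ks(1) assms(2) by (intro exponent_le_weight atom_lengths) auto
      then show "k \<in> {..n}" using w by simp
    qed
    then show "w \<in> power_product ls ` ?E" using ks by blast
  qed
  then have "card {w \<in> normal_words W. length w \<le> n} \<le> card (power_product ls ` ?E)"
    by (intro card_mono finite_imageI finite_lists_length_eq) auto
  also have "\<dots> \<le> card ?E" by (intro card_image_le finite_lists_length_eq) auto
  also have "\<dots> = Suc n ^ length ls" by (simp add: card_lists_length_eq)
  also have "\<dots> \<le> (2 * n) ^ length ls" using assms(3) by (intro power_mono) auto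
  finally have "real (growth n) \<le> real ((2 * n) ^ length ls)"
    unfolding sum_graded_dim of_nat_le_iff .
  also have "\<dots> = 2 ^ length ls * real n powr real (length ls)"
    using assms(3) by (simp add: power_mult_distrib powr_realpow)
  finally show ?thesis .
qed

lemma finite_atoms_imp_polynomial_growth:
  assumes "finite (N)"
  shows "polynomial_growth K W"
proof -
  obtain ls where ls: "sorted_wrt (>) ls" "set ls = N"
    using decreasing_list_exists[OF assms] by blast
  have "real (graded_dim K W n) \<le> 2 ^ length ls * real n powr real (length ls)" if "n \<ge> 1" for n
  proof -
    have "graded_dim K W n \<le> growth n" by (rule member_le_sum) auto
    then show ?thesis using sum_graded_dim_upper[OF ls that] by linarith
  qed
  then show ?thesis unfolding polynomial_growth_def
    by (intro exI[of _ "real (length ls)"] exI[of _ "2 ^ length ls"]) auto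
qed

text \<open>Summing the bounds on the components raises the exponent by one, and by
  \<open>sum_graded_dim_lower\<close> the number of atoms cannot exceed the exponent of cumulative
  growth.\<close>

lemma polynomial_growth_imp_finite_atoms:
  assumes "polynomial_growth K W"
  shows "finite (N)"
proof (rule ccontr)
  assume inf: "infinite (N)"
  obtain d C where C: "C > 0" "\<And>n. n \<ge> 1 \<Longrightarrow> real (graded_dim K W n) \<le> C * real n powr d"
    using assms unfolding polynomial_growth_def by blast
  \<comment> \<open>A negative exponent is replaced by 0, so that the bound increases with the
    degree and its value at \<open>n\<close> covers all degrees from 1 to \<open>n\<close>.\<close>
  define D where "D = max d 0"
  \<comment> \<open>The growth condition says nothing about degree 0, so that component is absorbed
    into the constant.\<close>
  define B where "B = real (graded_dim K W 0) + C"
  have upper: "real (growth n) \<le> B * real n powr (D + 1)" if n: "n \<ge> 1" for n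
  proof -
    have "real (graded_dim K W i) \<le> C * real n powr D" if "i \<in> {1..n}" for i
    proof -
      have "real i powr d \<le> real n powr D"
        using that unfolding D_def
        by (intro order.trans[OF powr_mono[of d "max d 0"] powr_mono2]) auto
      then show ?thesis using C(2)[of i] C(1) that by (smt (verit) atLeastAtMost_iff mult_left_mono)
    qed
    then have "(\<Sum>i\<in>{1..n}. real (graded_dim K W i)) \<le> real (card {1..n}) * (C * real n powr D)"
      by (rule sum_bounded_above)
    also have "\<dots> = C * real n powr (D + 1)" using n by (simp add: powr_add)
    finally have le: "(\<Sum>i\<in>{1..n}. real (graded_dim K W i)) \<le> C * real n powr (D + 1)" .
    have "{..n} = insert 0 {1..n}" by auto
    then have "real (growth n)
        = real (graded_dim K W 0) + (\<Sum>i\<in>{1..n}. real (graded_dim K W i))" by simp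
    also have "real (graded_dim K W 0) \<le> real (graded_dim K W 0) * real n powr (D + 1)"
      using n by (simp add: D_def mult_left_mono[of 1 "real n powr (max d 0 + 1)" "real (graded_dim K W 0)", simplified] ge_one_powr_ge_zero)
    finally show ?thesis using le by (simp add: B_def algebra_simps)
  qed
  \<comment> \<open>More than \<open>D + 1\<close> atoms, which is what the exponent bound
    forbids.\<close>
  obtain L where L: "L \<subseteq> N" "finite L" "card L = nat \<lceil>D + 1\<rceil> + 1"
    using infinite_arbitrarily_large[OF inf] by blast
  obtain ls where ls: "sorted_wrt (>) ls" "set ls = L"
    using decreasing_list_exists[OF L(2)] by blast
  obtain M where M: "M \<ge> 1" "\<And>n. (real n / M) ^ length ls \<le> real (growth n)"
    using sum_graded_dim_lower[OF ls(1)] ls(2) L(1) by auto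
  have "real (length ls) \<le> D + 1"
    by (rule power_growth_exponent[OF M(1)]) (rule order.trans[OF M(2) upper])
  moreover have "card L \<le> length ls" unfolding ls(2)[symmetric] by (rule card_length)
  ultimately show False using L(3) by linarith
qed

lemma GK_dim_eq:
  assumes "sorted_wrt (>) ls" "set ls = N"
  shows "GK_dim K W = ereal (real (length ls))"
  unfolding GK_dim_def
proof (rule antisym)
  let ?X = "{ereal d | d. \<exists>C>0. \<forall>n\<ge>1. real (growth n) \<le> C * real n powr d}"
  have "ereal (real (length ls)) \<in> ?X"
    using sum_graded_dim_upper[OF assms]
    by (intro CollectI exI[of _ "real (length ls)"] conjI refl exI[of _ "2 ^ length ls"]) auto
  then show "Inf ?X \<le> ereal (real (length ls))" by (rule Inf_lower)
  obtain M where M: "M \<ge> 1" "\<And>n. (real n / M) ^ length ls \<le> real (growth n)"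
    using sum_graded_dim_lower[OF assms(1)] assms(2) by auto
  show "ereal (real (length ls)) \<le> Inf ?X"
  proof (rule Inf_greatest)
    fix x assume "x \<in> ?X"
    then obtain d C where d: "x = ereal d"
      "\<And>n. n \<ge> 1 \<Longrightarrow> real (growth n) \<le> C * real n powr d" by blast
    have "real (length ls) \<le> d"
      by (rule power_growth_exponent[OF M(1)]) (rule order.trans[OF M(2) d(2)])
    then show "ereal (real (length ls)) \<le> x" using d(1) by simp
  qed
qed

text \<open>Taking power products is a bijection from exponent vectors to normal words that turns
  weight into length, so the words are counted like monomials in commuting variables.\<close>

lemma hilbert_series_eq:
  assumes "sorted_wrt (>) ls" "set ls = N"
  shows "hilbert_series K W = (\<Prod>l\<leftarrow>ls. 1 / (1 - fps_X ^ length l))"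
proof -
  have "graded_dim K W n = card (exponents (map length ls) n)" for n
  proof -
    have "{w \<in> normal_words W. length w = n} = power_product ls ` exponents (map length ls) n"
      unfolding normal_words_eq_power_products[OF lyndon_W assms]
      by (auto simp: exponents_def length_power_product)
    moreover have "inj_on (power_product ls) (exponents (map length ls) n)"
      using power_product_inj[OF assms(1) atoms_lyndon[OF equalityD1[OF assms(2)]]]
      by (rule inj_on_subset) (auto simp: exponents_def)
    ultimately show ?thesis by (simp add: graded_dim_eq_card card_image)
  qed
  then show ?thesis
    using fps_exponents[OF atom_lengths, of ls] assms(2)
    by (simp add: hilbert_series_def o_def)
qed

end

section \<open>Evaluation of noncommutative polynomials\<close>

lemma (in ring) foldr_mult_closed:
  "(\<And>y. \<phi> y \<in> carrier R) \<Longrightarrow> foldr (\<otimes>) (map \<phi> w) \<one> \<in> carrier R"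
  by (induction w) auto

lemma (in ring_hom_ring) hom_foldr_mult:
  "(\<And>y. \<phi> y \<in> carrier R) \<Longrightarrow>
    h (foldr (\<otimes>\<^bsub>R\<^esub>) (map \<phi> w) \<one>\<^bsub>R\<^esub>) = foldr (\<otimes>\<^bsub>S\<^esub>) (map (\<lambda>y. h (\<phi> y)) w) \<one>\<^bsub>S\<^esub>"
  by (induction w) (simp_all add: R.foldr_mult_closed)

lemma (in ring_hom_ring) hom_nc_eval:
  assumes "\<And>y. \<phi> y \<in> carrier R" "\<And>w. \<iota> (f w) \<in> carrier R"
  shows "h (nc_eval K R \<iota> \<phi> f) = nc_eval K S (\<lambda>c. h (\<iota> c)) (\<lambda>y. h (\<phi> y)) f"
proof -
  have "h (nc_eval K R \<iota> \<phi> f)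
    = finsum S (h \<circ> (\<lambda>w. \<iota> (f w) \<otimes>\<^bsub>R\<^esub> foldr (\<otimes>\<^bsub>R\<^esub>) (map \<phi> w) \<one>\<^bsub>R\<^esub>)) {w. f w \<noteq> \<zero>\<^bsub>K\<^esub>}"
    unfolding nc_eval_def using assms by (intro hom_finsum) (auto intro: R.foldr_mult_closed)
  also have "h \<circ> (\<lambda>w. \<iota> (f w) \<otimes>\<^bsub>R\<^esub> foldr (\<otimes>\<^bsub>R\<^esub>) (map \<phi> w) \<one>\<^bsub>R\<^esub>)
    = (\<lambda>w. h (\<iota> (f w)) \<otimes>\<^bsub>S\<^esub> foldr (\<otimes>\<^bsub>S\<^esub>) (map (\<lambda>y. h (\<phi> y)) w) \<one>\<^bsub>S\<^esub>)"
    using assms by (simp add: fun_eq_iff R.foldr_mult_closed hom_foldr_mult)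
  finally show ?thesis by (simp add: nc_eval_def)
qed

section \<open>Products of sums of words\<close>

context ring
begin

definition indicator_elem :: "'x list set \<Rightarrow> 'x list \<Rightarrow> 'a" where
  "indicator_elem S = (\<lambda>w. if w \<in> S then \<one> else \<zero>)"

lemma indicator_elem_closed: "finite S \<Longrightarrow> indicator_elem S \<in> carrier FA"
  unfolding free_carrier_iff indicator_elem_def by (auto elim: finite_subset[rotated] split: if_splits)

lemma term_Nil_mult:
  assumes "c \<in> carrier R" "g \<in> carrier FA"
  shows "(term_elem R c [] \<otimes>\<^bsub>FA\<^esub> g) u = c \<otimes> g u"
proof -
  have "(term_elem R c [] \<otimes>\<^bsub>FA\<^esub> g) u = term_elem R c [] (take 0 u) \<otimes> g (drop 0 u)"
    unfolding free_mult
    by (rule finsum_eq_single) (use assms free_carrierD(1)[OF assms(2)] in \<open>auto simp: term_elem_def\<close>)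
  then show ?thesis by (simp add: term_elem_def)
qed

abbreviation ind_prod :: "('y \<Rightarrow> 'x list set) \<Rightarrow> 'y list \<Rightarrow> 'x list \<Rightarrow> 'a" where
  "ind_prod S w \<equiv>
    foldr (\<otimes>\<^bsub>FA\<^esub>) (map (\<lambda>y. indicator_elem (S y)) w) \<one>\<^bsub>FA\<^esub>"

lemma ind_prod_closed:
  fixes S :: "'y \<Rightarrow> 'x list set"
  assumes "\<And>y. finite (S y)"
  shows "ind_prod S w \<in> carrier FA"
proof -
  interpret F: ring "free_algebra R :: ('x list \<Rightarrow> 'a) ring" by (rule free_algebra_ring)
  show ?thesis by (rule F.foldr_mult_closed) (rule indicator_elem_closed[OF assms])
qed

text \<open>The coefficient at \<open>u\<close> is the number of factorisations of \<open>u\<close>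
  with the factors taken from the sets prescribed by \<open>w\<close>, read in the ring. In positive
  characteristic that number may vanish, so only two consequences are used: a nonzero coefficient
  yields a factorisation, and a unique factorisation yields the coefficient 1.\<close>

lemma ind_prod_nonzero:
  fixes S :: "'y \<Rightarrow> 'x list set"
  assumes "\<And>y. finite (S y)" "ind_prod S w u \<noteq> \<zero>"
  shows "\<exists>ss. list_all2 (\<lambda>s y. s \<in> S y) ss w \<and> concat ss = u"
  using assms(2)
proof (induction w arbitrary: u)
  case Nil
  then show ?case by (auto simp: free_one term_elem_def split: if_splits)
next
  case (Cons y w)
  have cl: "ind_prod S w v \<in> carrier R" for v
    using free_carrierD(1)[OF ind_prod_closed[OF assms(1)]] .
  have "(\<Oplus>i\<in>{..length u}. indicator_elem (S y) (take i u) \<otimes> ind_prod S w (drop i u)) \<noteq> \<zero>"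
    using Cons.prems
    by (simp only: list.map foldr.simps o_apply free_mult[of "indicator_elem (S y)" "ind_prod S w" u] not_False_eq_True)
  then obtain i where i: "indicator_elem (S y) (take i u) \<otimes> ind_prod S w (drop i u) \<noteq> \<zero>"
    using finsum_eq_zero by meson
  then have "ind_prod S w (drop i u) \<noteq> \<zero>" "take i u \<in> S y"
    using cl by (auto simp: indicator_elem_def split: if_splits)
  moreover from Cons.IH[OF this(1)]
  obtain ss where "list_all2 (\<lambda>s y. s \<in> S y) ss w" "concat ss = drop i u" by blast
  ultimately show ?case by (intro exI[of _ "take i u # ss"]) simp
qed

lemma ind_prod_unique:
  fixes S :: "'y \<Rightarrow> 'x list set"
  assumes finS: "\<And>y. finite (S y)"
    and "list_all2 (\<lambda>s y. s \<in> S y) ss w" "concat ss = u"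
    and "\<And>ss'. list_all2 (\<lambda>s y. s \<in> S y) ss' w \<Longrightarrow> concat ss' = u \<Longrightarrow> ss' = ss"
  shows "ind_prod S w u = \<one>"
  using assms(2-)
proof (induction w arbitrary: u ss rule: list.induct)
  case Nil
  have "list_all2 (\<lambda>s y. s \<in> S y) ss []" by fact
  then have "ss = []" by (simp add: list_all2_Nil2)
  moreover have "concat ss = u" by fact
  ultimately have "u = []" by simp
  then show ?case by (simp add: free_one term_elem_def)
next
  case (Cons y w)
  obtain s r where ss: "ss = s # r" "s \<in> S y" "list_all2 (\<lambda>s y. s \<in> S y) r w"
    using Cons.prems(1) by (auto simp: list_all2_Cons2)
  have u: "u = s @ concat r" using Cons.prems(2) ss(1) by simp
  have cl: "ind_prod S w v \<in> carrier R" for v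
    using free_carrierD(1)[OF ind_prod_closed[OF assms(1)]] .
  have IH: "ind_prod S w (concat r) = \<one>"
  proof (rule Cons.IH[OF ss(3) refl])
    fix r' assume "list_all2 (\<lambda>s y. s \<in> S y) r' w" "concat r' = concat r"
    then have "s # r' = ss" using ss u by (intro Cons.prems(3)) auto
    then show "r' = r" using ss(1) by simp
  qed
  have "ind_prod S (y # w) u
      = indicator_elem (S y) (take (length s) u) \<otimes> ind_prod S w (drop (length s) u)"
    unfolding list.map foldr.simps o_apply free_mult[of "indicator_elem (S y)" "ind_prod S w" u]
  proof (rule finsum_eq_single)
    fix i assume i: "i \<in> {..length u}" "i \<noteq> length s"
    show "indicator_elem (S y) (take i u) \<otimes> ind_prod S w (drop i u) = \<zero>"
    proof (rule ccontr)
      assume *: "indicator_elem (S y) (take i u) \<otimes> ind_prod S w (drop i u) \<noteq> \<zero>"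
      then have "ind_prod S w (drop i u) \<noteq> \<zero>" and mem: "take i u \<in> S y"
        using cl by (auto simp: indicator_elem_def split: if_splits)
      then obtain r' where "list_all2 (\<lambda>s y. s \<in> S y) r' w" "concat r' = drop i u"
        using ind_prod_nonzero[of S w "drop i u", OF assms(1)] by blast
      then have "take i u # r' = ss" using mem by (intro Cons.prems(3)) auto
      then have "take i u = s" using ss(1) by simp
      then show False using i by auto
    qed
  qed (use cl u in \<open>auto simp: indicator_elem_def\<close>)
  then show ?case using IH ss(2) u by (simp add: indicator_elem_def)
qed

end

section \<open>Polynomial identities force finitely many atoms\<close>

text \<open>Let \<open>w\<close> be a longest word of an identity \<open>f\<close>, with letters \<open>y\<^sub>1, \<dots>, y\<^sub>D\<close>, let \<open>v\<^sub>1 > \<dots> > v\<^sub>D\<close> be atoms, and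
  substitute for each variable \<open>y\<close> the sum of the \<open>v\<^sub>p\<close> with \<open>y\<^sub>p = y\<close>. A product of at most \<open>D\<close> of the
  \<open>v\<^sub>p\<close> equals the normal word \<open>v\<^sub>1 \<cdots> v\<^sub>D\<close> only if it is this very product, so the coefficient of that
  word in the value of \<open>f\<close> is the coefficient of \<open>w\<close> in \<open>f\<close>.\<close>

lemma (in lyndon_quotient) PI_imp_finite_atoms:
  assumes "PI_algebra K A (structure_map K W)"
  shows "finite (N)"
proof (rule ccontr)
  assume inf: "infinite (N)"
  obtain f :: "nat list \<Rightarrow> 'k" where f: "f \<in> carrier (free_algebra K)" "f \<noteq> \<zero>\<^bsub>free_algebra K\<^esub>"
    and identity: "\<And>\<phi>. range \<phi> \<subseteq> carrier A \<Longrightarrow> nc_eval K A (structure_map K W) \<phi> f = \<zero>\<^bsub>A\<^esub>"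
    using assms unfolding PI_algebra_def by blast
  note fin = free_carrierD(2)[OF f(1)] and fc = free_carrierD(1)[OF f(1)]
  define D where "D = Max (length ` {w. f w \<noteq> \<zero>})"
  have "{w. f w \<noteq> \<zero>} \<noteq> {}" using f(2) by (auto simp: fun_eq_iff)
  then have "D \<in> length ` {w. f w \<noteq> \<zero>}" unfolding D_def using fin by (intro Max_in) auto
  then obtain w0 where w0: "f w0 \<noteq> \<zero>" "length w0 = D" by auto
  have len: "length w \<le> D" if "f w \<noteq> \<zero>" for w
    unfolding D_def using fin that by (intro Max_ge) auto
  obtain L where L: "finite L" "card L = D" "L \<subseteq> N"
    using infinite_arbitrarily_large[OF inf] by metis
  obtain ls where ls: "sorted_wrt (>) ls" "set ls = L" using decreasing_list_exists[OF L(1)] by blast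
  have dist: "distinct ls" using ls(1) by (induction ls) auto
  then have lenls: "length ls = D" using distinct_card ls(2) L(2) by metis
  have "sorted_wrt (\<ge>) ls" by (rule sorted_wrt_mono_rel[OF _ ls(1)]) auto
  then have lyn: "lyndon_list ls" unfolding lyndon_list_def using atoms_lyndon[of ls] ls(2) L(3) by blast
  define u where "u = concat ls"
  have u: "u \<in> normal_words W"
    unfolding u_def concat_in_normal_words_iff[OF lyndon_W lyn] using ls(2) L(3) by simp
  define T where "T y = {ls ! p | p. p < D \<and> w0 ! p = y}" for y
  have finT: "finite (T y)" for y unfolding T_def by simp
  have TL: "T y \<subseteq> L" for y using ls(2) lenls by (auto simp: T_def)
  have only: "ss = ls \<and> w = w0" if "list_all2 (\<lambda>s y. s \<in> T y) ss w" "concat ss = u" "f w \<noteq> \<zero>" for ss w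
  proof
    have ss: "length ss = length w" "\<forall>p<length w. ss ! p \<in> T (w ! p)"
      using that(1) by (auto simp: list_all2_conv_all_nth)
    have "set ss \<subseteq> L"
    proof
      fix s assume "s \<in> set ss"
      then obtain p where "p < length w" "s = ss ! p" using ss(1) by (auto simp: in_set_conv_nth)
      then show "s \<in> L" using ss(2) TL by blast
    qed
    then have "\<forall>s\<in>set ss. lyndon s" using L(3) by (auto simp: lyndon_atoms_def)
    \<comment> \<open>\<open>ss\<close> has at most \<open>D\<close> words while \<open>ls\<close>
      has exactly \<open>D\<close>, so \<open>lyndon_list_shortest\<close> applies although
      \<open>ss\<close> is not known to be sorted.\<close>
    then show eq: "ss = ls"
      using that(2) len[OF that(3)] ss(1) lenls by (intro lyndon_list_shortest[OF _ lyn]) (auto simp: u_def)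
    \<comment> \<open>The atoms in \<open>ls\<close> are distinct, so each atom reveals its position
      in \<open>ls\<close> and thereby the letter of \<open>w0\<close> there.\<close>
    show "w = w0"
    proof (rule nth_equalityI)
      show "length w = length w0" using eq ss(1) lenls w0(2) by simp
      fix p assume p: "p < length w"
      then obtain q where q: "ls ! p = ls ! q" "q < D" "w0 ! q = w ! p"
        using ss(2) eq by (auto simp: T_def)
      have "p < length ls" using p ss(1) eq by simp
      then have "p = q" using q dist lenls nth_eq_iff_index_eq by metis
      then show "w ! p = w0 ! p" using q by simp
    qed
  qed
  have self: "list_all2 (\<lambda>s y. s \<in> T y) ls w0"
    using lenls w0(2) by (auto simp: list_all2_conv_all_nth T_def)
  define \<xi> where "\<xi> y = indicator_elem (T y)" for y
  have \<xi>: "\<xi> y \<in> carrier F" for y unfolding \<xi>_def by (rule indicator_elem_closed[OF finT])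
  have coeff: "ind_prod T w u = (if w = w0 then \<one> else \<zero>)" if "f w \<noteq> \<zero>" for w
  proof (cases "w = w0")
    case True
    have "ind_prod T w0 u = \<one>"
      by (rule ind_prod_unique[OF finT self u_def[symmetric]]) (use only w0(1) in blast)
    then show ?thesis using True by simp
  next
    case False
    then show ?thesis using ind_prod_nonzero[of T w u, OF finT] only[OF _ _ that] by auto
  qed
  define g where "g = nc_eval K F (\<lambda>c. term_elem K c []) \<xi> f"
  let ?t = "\<lambda>w. term_elem K (f w) [] \<otimes>\<^bsub>F\<^esub> ind_prod T w"
  have t: "?t w \<in> carrier F" for w
    using fc by (intro F.m_closed term_closed ind_prod_closed finT)
  have g_eq: "g = finsum F ?t {w. f w \<noteq> \<zero>}" 
    unfolding g_def nc_eval_def \<xi>_def[abs_def] by (rule refl)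
  have g: "g \<in> carrier F" unfolding g_eq using t by (intro F.finsum_closed) auto
  have "\<rho> g = nc_eval K A (\<lambda>c. \<rho> (term_elem K c [])) (\<lambda>y. \<rho> (\<xi> y)) f"
    unfolding g_def by (rule \<pi>.hom_nc_eval) (use \<xi> fc term_closed in auto)
  also have "\<dots> = \<zero>\<^bsub>A\<^esub>"
    using identity[of "\<lambda>y. \<rho> (\<xi> y)"] \<xi> \<pi>.hom_closed
    unfolding structure_map_def[abs_def] by blast
  also have "\<dots> = \<rho> \<zero>\<^bsub>F\<^esub>" by (rule \<pi>.hom_zero[symmetric])
  finally have "g u = \<zero>" using residue_class_eq_iff[OF g F.zero_closed] u by simp
  moreover have "g u = (\<Oplus>w\<in>{w. f w \<noteq> \<zero>}. f w \<otimes> ind_prod T w u)"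
    unfolding g_eq using t fc
    by (subst free_finsum_apply) (auto simp: term_Nil_mult ind_prod_closed[OF finT])
  moreover have "\<dots> = f w0 \<otimes> ind_prod T w0 u"
    by (rule finsum_eq_single) (use fin w0 coeff fc in auto)
  ultimately show False using w0 fc coeff by auto
qed

section \<open>Matrix rings and the standard identity\<close>

lemma inj_on_map_upt_permutes: "inj_on (\<lambda>p. map p [0..<N]) {p. p permutes {..<N}}"
proof (rule inj_onI)
  fix p q assume pq: "p \<in> {p. p permutes {..<N}}" "q \<in> {p. p permutes {..<N}}"
    "map p [0..<N] = map q [0..<N]"
  have "p i = q i" for i
    using pq by (cases "i < N") (auto simp: permutes_def)
  then show "p = q" by auto
qed

context ring
begin

abbreviation "Mat n \<equiv> matrix_ring R n"

lemma matrix_carrierD: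
  assumes "M \<in> carrier (Mat n)"
  shows "M i j \<in> carrier R" "\<not> (i < n \<and> j < n) \<Longrightarrow> M i j = \<zero>"
  using assms by (auto simp: matrix_ring_def)

lemma matrix_mult: "(M \<otimes>\<^bsub>Mat n\<^esub> N) i j = (\<Oplus>k\<in>{..<n}. M i k \<otimes> N k j)"
  and matrix_add: "(M \<oplus>\<^bsub>Mat n\<^esub> N) i j = M i j \<oplus> N i j"
  and matrix_one: "\<one>\<^bsub>Mat n\<^esub> = scalar_matrix R n \<one>"
  and matrix_zero: "\<zero>\<^bsub>Mat n\<^esub> i j = \<zero>"
  by (simp_all add: matrix_ring_def)

lemma scalar_matrix_mult:
  assumes "c \<in> carrier R" "M \<in> carrier (Mat n)"
  shows "(scalar_matrix R n c \<otimes>\<^bsub>Mat n\<^esub> M) i j = c \<otimes> M i j"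
    "(M \<otimes>\<^bsub>Mat n\<^esub> scalar_matrix R n c) i j = M i j \<otimes> c"
proof -
  note cl [simp] = matrix_carrierD(1)[OF assms(2)]
  show "(scalar_matrix R n c \<otimes>\<^bsub>Mat n\<^esub> M) i j = c \<otimes> M i j"
  proof (cases "i < n")
    case True
    have "(scalar_matrix R n c \<otimes>\<^bsub>Mat n\<^esub> M) i j = scalar_matrix R n c i i \<otimes> M i j"
      unfolding matrix_mult
      by (rule finsum_eq_single) (use True assms in \<open>auto simp: scalar_matrix_def\<close>)
    then show ?thesis using True by (simp add: scalar_matrix_def)
  next
    case False
    then show ?thesis unfolding matrix_mult using matrix_carrierD(2)[OF assms(2)] assms(1)
      by (subst finsum_eq_zero) (auto simp: scalar_matrix_def)
  qed
  show "(M \<otimes>\<^bsub>Mat n\<^esub> scalar_matrix R n c) i j = M i j \<otimes> c"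
  proof (cases "j < n")
    case True
    have "(M \<otimes>\<^bsub>Mat n\<^esub> scalar_matrix R n c) i j = M i j \<otimes> scalar_matrix R n c j j"
      unfolding matrix_mult
      by (rule finsum_eq_single) (use True assms in \<open>auto simp: scalar_matrix_def\<close>)
    then show ?thesis using True by (simp add: scalar_matrix_def)
  next
    case False
    then show ?thesis unfolding matrix_mult using matrix_carrierD(2)[OF assms(2)] assms(1)
      by (subst finsum_eq_zero) (auto simp: scalar_matrix_def)
  qed
qed

lemma scalar_matrix_closed: "c \<in> carrier R \<Longrightarrow> scalar_matrix R n c \<in> carrier (Mat n)"
  by (auto simp: matrix_ring_def scalar_matrix_def)

lemma matrix_mult_closed:
  assumes "M \<in> carrier (Mat n)" "N \<in> carrier (Mat n)"
  shows "M \<otimes>\<^bsub>Mat n\<^esub> N \<in> carrier (Mat n)"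
proof -
  note cl [simp] = assms[THEN matrix_carrierD(1)]
  have "(\<Oplus>k\<in>{..<n}. M i k \<otimes> N k j) = \<zero>" if "\<not> (i < n \<and> j < n)" for i j
    using that matrix_carrierD(2)[OF assms(1)] matrix_carrierD(2)[OF assms(2)]
    by (intro finsum_eq_zero) auto
  then show ?thesis by (auto simp: matrix_ring_def)
qed

lemma matrix_mult_assoc:
  assumes "M \<in> carrier (Mat n)" "N \<in> carrier (Mat n)" "P \<in> carrier (Mat n)"
  shows "M \<otimes>\<^bsub>Mat n\<^esub> N \<otimes>\<^bsub>Mat n\<^esub> P = M \<otimes>\<^bsub>Mat n\<^esub> (N \<otimes>\<^bsub>Mat n\<^esub> P)"
proof (intro ext)
  fix i j
  note cl [simp] = assms[THEN matrix_carrierD(1)]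
  have "(M \<otimes>\<^bsub>Mat n\<^esub> N \<otimes>\<^bsub>Mat n\<^esub> P) i j
      = (\<Oplus>k\<in>{..<n}. \<Oplus>l\<in>{..<n}. M i l \<otimes> N l k \<otimes> P k j)"
    unfolding matrix_mult by (intro finsum_cong') (auto simp: finsum_ldistr)
  also have "\<dots> = (\<Oplus>l\<in>{..<n}. \<Oplus>k\<in>{..<n}. M i l \<otimes> N l k \<otimes> P k j)"
    by (rule finsum_swap) auto
  also have "\<dots> = (M \<otimes>\<^bsub>Mat n\<^esub> (N \<otimes>\<^bsub>Mat n\<^esub> P)) i j"
    unfolding matrix_mult by (intro finsum_cong') (auto simp: finsum_rdistr m_assoc)
  finally show "(M \<otimes>\<^bsub>Mat n\<^esub> N \<otimes>\<^bsub>Mat n\<^esub> P) i j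
      = (M \<otimes>\<^bsub>Mat n\<^esub> (N \<otimes>\<^bsub>Mat n\<^esub> P)) i j" .
qed

lemma matrix_ring_ring: "ring (matrix_ring R n)"
proof (rule ringI)
  let ?R = "matrix_ring R n"
  have "\<exists>N\<in>carrier ?R. N \<oplus>\<^bsub>?R\<^esub> M = \<zero>\<^bsub>?R\<^esub>" if "M \<in> carrier ?R" for M
    by (rule bexI[of _ "\<lambda>i j. \<ominus> M i j"]) (use that in \<open>auto simp: matrix_ring_def l_neg\<close>)
  then show "abelian_group ?R"
    by (intro abelian_groupI) (auto simp: matrix_ring_def a_ac fun_eq_iff)
  show "Group.monoid ?R"
  proof (rule monoidI)
    show "\<one>\<^bsub>?R\<^esub> \<otimes>\<^bsub>?R\<^esub> M = M" "M \<otimes>\<^bsub>?R\<^esub> \<one>\<^bsub>?R\<^esub> = M" if "M \<in> carrier ?R" for M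
      using that matrix_carrierD(1)[OF that] by (auto simp: fun_eq_iff matrix_one scalar_matrix_mult)
  qed (simp_all add: matrix_mult_closed matrix_mult_assoc matrix_one scalar_matrix_closed)
  fix x y z assume c: "x \<in> carrier ?R" "y \<in> carrier ?R" "z \<in> carrier ?R"
  note cl [simp] = c[THEN matrix_carrierD(1)]
  show "(x \<oplus>\<^bsub>?R\<^esub> y) \<otimes>\<^bsub>?R\<^esub> z = x \<otimes>\<^bsub>?R\<^esub> z \<oplus>\<^bsub>?R\<^esub> y \<otimes>\<^bsub>?R\<^esub> z"
    "z \<otimes>\<^bsub>?R\<^esub> (x \<oplus>\<^bsub>?R\<^esub> y) = z \<otimes>\<^bsub>?R\<^esub> x \<oplus>\<^bsub>?R\<^esub> z \<otimes>\<^bsub>?R\<^esub> y"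
    by (auto simp: fun_eq_iff matrix_mult matrix_add l_distr r_distr finsum_addf)
qed

lemma matrix_finsum_apply:
  assumes "f \<in> A \<rightarrow> carrier (Mat n)"
  shows "finsum (matrix_ring R n) f A i j = (\<Oplus>a\<in>A. f a i j)"
proof -
  interpret M: ring "matrix_ring R n" by (rule matrix_ring_ring)
  show ?thesis
    using assms
  proof (induction A rule: infinite_finite_induct)
    case (insert a A)
    then have "(\<lambda>a. f a i j) \<in> insert a A \<rightarrow> carrier R" using matrix_carrierD(1) by blast
    with insert show ?case by (simp add: matrix_add)
  qed (simp_all add: finsum_infinite matrix_zero)
qed

text \<open>The sign as an element of the ring; in characteristic two it is constantly 1.\<close>

definition ring_sign :: "(nat \<Rightarrow> nat) \<Rightarrow> 'a" where
  "ring_sign p = (if evenperm p then \<one> else \<ominus> \<one>)"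

lemma ring_sign_closed: "ring_sign p \<in> carrier R"
  by (simp add: ring_sign_def)

text \<open>The alternating sum of all orderings of \<open>N\<close> variables. Distinct
  permutations have distinct words, so at most one summand is nonzero at each
  \<open>w\<close>.\<close>

definition standard_poly :: "nat \<Rightarrow> nat list \<Rightarrow> 'a" where
  "standard_poly N w = (\<Oplus>p\<in>{p. p permutes {..<N}}. if w = map p [0..<N] then ring_sign p else \<zero>)"

lemma standard_poly_perm:
  assumes "p permutes {..<N}"
  shows "standard_poly N (map p [0..<N]) = ring_sign p"
proof -
  have "standard_poly N (map p [0..<N]) = (if map p [0..<N] = map p [0..<N] then ring_sign p else \<zero>)"
    unfolding standard_poly_def
  proof (rule finsum_eq_single)
    fix q assume q: "q \<in> {p. p permutes {..<N}}" "q \<noteq> p"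
    then have "(map p [0..<N] = map q [0..<N]) = False"
      using inj_onD[OF inj_on_map_upt_permutes[of N]] assms q by blast
    then show "(if map p [0..<N] = map q [0..<N] then ring_sign q else \<zero>) = \<zero>"
      by (simp only: if_False)
  qed (use assms in \<open>auto simp: finite_permutations ring_sign_closed\<close>)
  then show ?thesis by simp
qed

lemma standard_poly_other:
  assumes "w \<notin> (\<lambda>p. map p [0..<N]) ` {p. p permutes {..<N}}"
  shows "standard_poly N w = \<zero>"
  unfolding standard_poly_def by (rule finsum_eq_zero) (use assms in auto)

lemma standard_poly_closed: "standard_poly N \<in> carrier (free_algebra R)"
proof -
  have "{w. standard_poly N w \<noteq> \<zero>} \<subseteq> (\<lambda>p. map p [0..<N]) ` {p. p permutes {..<N}}"
    using standard_poly_other by blast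
  moreover have "finite ((\<lambda>p. map p [0..<N]) ` {p. p permutes {..<N}})"
    by (intro finite_imageI finite_permutations) simp
  moreover have "standard_poly N w \<in> carrier R" for w
    unfolding standard_poly_def by (rule finsum_closed) (auto simp: ring_sign_closed)
  ultimately show ?thesis unfolding free_carrier_iff using finite_subset by blast
qed

end

context cring
begin

text \<open>Swapping two positions that carry the same data reverses the sign.\<close>

lemma alternating_sum_eq_zero:
  assumes ab: "a < N" "b < N" "a \<noteq> b" "e a = e b" and cl: "\<And>y k. x y (e k) \<in> carrier R"
  shows "(\<Oplus>p\<in>{p. p permutes {..<N}}. ring_sign p \<otimes> (\<Otimes>k\<in>{..<N}. x (p k) (e k))) = \<zero>"
proof -
  define \<tau> where "\<tau> = Transposition.transpose a b"
  have \<tau>: "\<tau> permutes {..<N}" unfolding \<tau>_def using ab by (intro permutes_swap_id) auto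
  have \<tau>\<tau>: "\<tau> \<circ> \<tau> = id" by (simp add: \<tau>_def)
  define G where "G p = (\<Otimes>k\<in>{..<N}. x (p k) (e k))" for p
  have Gcl: "G p \<in> carrier R" for p unfolding G_def using cl by (intro finprod_closed) auto
  have e\<tau>: "e (\<tau> k) = e k" for k using ab(4) by (simp add: \<tau>_def Transposition.transpose_def)
  have G\<tau>: "G (p \<circ> \<tau>) = G p" for p
  proof -
    have "G (p \<circ> \<tau>) = (\<Otimes>k\<in>{..<N}. x (p (\<tau> k)) (e (\<tau> k)))" unfolding G_def by (simp add: e\<tau>)
    also have "\<dots> = (\<Otimes>k\<in>\<tau> ` {..<N}. x (p k) (e k))"
      using cl by (intro finprod_reindex[symmetric] permutes_inj_on[OF \<tau>]) auto
    also have "\<tau> ` {..<N} = {..<N}" by (rule permutes_image[OF \<tau>])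
    finally show ?thesis by (simp add: G_def)
  qed
  let ?P = "{p. p permutes {..<N}}"
  let ?E = "{p \<in> ?P. evenperm p}"
  have fin: "finite ?P" by (rule finite_permutations) simp
  have ev: "evenperm (p \<circ> \<tau>) \<longleftrightarrow> \<not> evenperm p" if "p \<in> ?P" for p
  proof -
    have "permutation p" "permutation \<tau>" using that \<tau> permutation_permutes by blast+
    then show ?thesis using ab(3) by (simp add: evenperm_comp \<tau>_def evenperm_swap)
  qed
  have odd: "?P - ?E = (\<lambda>p. p \<circ> \<tau>) ` ?E"
  proof (intro equalityI subsetI)
    fix p assume p: "p \<in> ?P - ?E"
    then have "p \<circ> \<tau> \<in> ?E" using ev permutes_compose[OF \<tau>] by auto
    moreover have "p = (p \<circ> \<tau>) \<circ> \<tau>" using \<tau>\<tau> by (simp add: comp_assoc)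
    ultimately show "p \<in> (\<lambda>p. p \<circ> \<tau>) ` ?E" by blast
  qed (use ev permutes_compose[OF \<tau>] in auto)
  have inj: "inj_on (\<lambda>p. p \<circ> \<tau>) ?E"
    by (rule inj_onI) (metis \<tau>\<tau> comp_assoc comp_id)
  have "(\<Oplus>p\<in>?P. ring_sign p \<otimes> G p) = (\<Oplus>p\<in>?E \<union> (?P - ?E). ring_sign p \<otimes> G p)"
    by (rule arg_cong[where f = "finsum R _"]) auto
  also have "\<dots> = (\<Oplus>p\<in>?E. ring_sign p \<otimes> G p) \<oplus> (\<Oplus>p\<in>?P - ?E. ring_sign p \<otimes> G p)"
    using fin Gcl ring_sign_closed by (intro finsum_Un_disjoint) auto
  also have "(\<Oplus>p\<in>?P - ?E. ring_sign p \<otimes> G p) = (\<Oplus>p\<in>?E. ring_sign (p \<circ> \<tau>) \<otimes> G (p \<circ> \<tau>))"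
    unfolding odd using Gcl ring_sign_closed inj by (intro finsum_reindex) auto
  also have "(\<Oplus>p\<in>?E. ring_sign p \<otimes> G p) \<oplus> \<dots>
      = (\<Oplus>p\<in>?E. ring_sign p \<otimes> G p \<oplus> ring_sign (p \<circ> \<tau>) \<otimes> G (p \<circ> \<tau>))"
    using Gcl ring_sign_closed by (intro finsum_addf[symmetric]) auto
  also have "\<dots> = \<zero>"
    using ev Gcl by (intro finsum_eq_zero) (auto simp: G\<tau> ring_sign_def l_minus r_neg)
  finally show ?thesis by (simp add: G_def)
qed

lemma finprod_lessThan_Suc_shift:
  assumes "\<And>k. f k \<in> carrier R"
  shows "(\<Otimes>k\<in>{..<Suc m}. f k) = f 0 \<otimes> (\<Otimes>k\<in>{..<m}. f (Suc k))"
proof -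
  have "(\<Otimes>k\<in>{..<Suc m}. f k) = (\<Otimes>k\<in>insert 0 (Suc ` {..<m}). f k)"
    by (simp add: lessThan_Suc_eq_insert_0)
  also have "\<dots> = f 0 \<otimes> (\<Otimes>k\<in>Suc ` {..<m}. f k)"
    using assms by (intro finprod_insert) auto
  also have "(\<Otimes>k\<in>Suc ` {..<m}. f k) = (\<Otimes>k\<in>{..<m}. f (Suc k))"
    using assms by (intro finprod_reindex) auto
  finally show ?thesis .
qed

abbreviation "index_lists n m \<equiv> {rs. set rs \<subseteq> {..<n} \<and> length rs = m}"

text \<open>The expansion over index paths that start at \<open>i\<close>: \<open>rs\<close> lists
  the indices visited afterwards. The last factor comes from the identity matrix at the end of the
  product and forces the path to end at \<open>j\<close>.\<close>

lemma matrix_word_entry: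
  assumes "\<And>y. \<xi> y \<in> carrier (Mat n)" "i < n"
  shows "foldr (\<otimes>\<^bsub>Mat n\<^esub>) (map \<xi> w) \<one>\<^bsub>Mat n\<^esub> i j
    = (\<Oplus>rs\<in>index_lists n (length w). (\<Otimes>k\<in>{..<length w}. \<xi> (w ! k) ((i # rs) ! k) (rs ! k))
        \<otimes> (if last (i # rs) = j then \<one> else \<zero>))"
  using assms(2)
proof (induction w arbitrary: i)
  case Nil
  have "index_lists n 0 = {[]}" by auto
  then show ?case using Nil by (simp add: matrix_one scalar_matrix_def)
next
  case (Cons y w)
  note cl [simp] = matrix_carrierD(1)[OF assms(1)]
  let ?m = "length w"
  let ?g = "\<lambda>i rs. (\<Otimes>k\<in>{..<?m}. \<xi> (w ! k) ((i # rs) ! k) (rs ! k)) \<otimes> (if last (i # rs) = j then \<one> else \<zero>)"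
  let ?h = "\<lambda>rs. (\<Otimes>k\<in>{..<Suc ?m}. \<xi> ((y # w) ! k) ((i # rs) ! k) (rs ! k)) \<otimes> (if last (i # rs) = j then \<one> else \<zero>)"
  have fin: "finite (index_lists n m)" for m by (rule finite_lists_length_eq) simp
  have gcl: "?g i rs \<in> carrier R" for i rs by (auto intro!: m_closed finprod_closed)
  have hcl: "?h rs \<in> carrier R" for rs by (auto intro!: m_closed finprod_closed)
  have step: "\<xi> y i r \<otimes> ?g r rs = ?h (r # rs)" for r rs
    by (subst finprod_lessThan_Suc_shift) (auto simp: m_assoc intro!: finprod_closed)
  have "foldr (\<otimes>\<^bsub>Mat n\<^esub>) (map \<xi> (y # w)) \<one>\<^bsub>Mat n\<^esub> i j
      = (\<Oplus>r\<in>{..<n}. \<xi> y i r \<otimes> (\<Oplus>rs\<in>index_lists n ?m. ?g r rs))"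
    unfolding list.map foldr.simps o_apply matrix_mult[where M = "\<xi> y"]
    using Cons.IH gcl by (intro finsum_cong') (auto intro!: finsum_closed)
  also have "\<dots> = (\<Oplus>r\<in>{..<n}. \<Oplus>rs\<in>index_lists n ?m. ?h (r # rs))"
    unfolding step[symmetric] using gcl fin by (intro finsum_cong') (auto simp: finsum_rdistr intro!: finsum_closed)
  also have "\<dots> = (\<Oplus>p\<in>{..<n} \<times> index_lists n ?m. ?h (fst p # snd p))"
    using fin hcl by (subst finsum_Sigma) auto
  also have "\<dots> = (\<Oplus>rs\<in>(\<lambda>p. fst p # snd p) ` ({..<n} \<times> index_lists n ?m). ?h rs)"
    using hcl by (intro finsum_reindex[symmetric]) (auto simp: inj_on_def)
  also have "(\<lambda>p. fst p # snd p) ` ({..<n} \<times> index_lists n ?m) = index_lists n (Suc ?m)"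
    by (force simp: length_Suc_conv image_iff)
  finally show ?case by simp
qed

text \<open>Interchanges the sums over permutations and paths, so that vanishing can be checked for
  one path at a time.\<close>

lemma finsum_weighted_eq_zero:
  assumes "finite P" "finite I" "\<And>p. s p \<in> carrier R" "\<And>p r. g p r \<in> carrier R"
    "\<And>r. l r \<in> carrier R" and zero: "\<And>r. r \<in> I \<Longrightarrow> (\<Oplus>p\<in>P. s p \<otimes> g p r) = \<zero>"
  shows "(\<Oplus>p\<in>P. s p \<otimes> (\<Oplus>r\<in>I. g p r \<otimes> l r)) = \<zero>"
proof -
  have "(\<Oplus>p\<in>P. s p \<otimes> (\<Oplus>r\<in>I. g p r \<otimes> l r)) = (\<Oplus>p\<in>P. \<Oplus>r\<in>I. s p \<otimes> g p r \<otimes> l r)"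
    using assms(1-5) by (intro finsum_cong') (auto simp: finsum_rdistr m_assoc intro!: finsum_closed)
  also have "\<dots> = (\<Oplus>r\<in>I. \<Oplus>p\<in>P. s p \<otimes> g p r \<otimes> l r)"
    using assms(1-5) by (intro finsum_swap) auto
  also have "\<dots> = (\<Oplus>r\<in>I. (\<Oplus>p\<in>P. s p \<otimes> g p r) \<otimes> l r)"
    using assms(1-5) by (intro finsum_cong') (auto simp: finsum_ldistr intro!: finsum_closed)
  also have "\<dots> = \<zero>" by (intro finsum_eq_zero) (simp only: zero l_null[OF assms(5)])
  finally show ?thesis .
qed

text \<open>A path of more than \<open>n * n\<close> steps uses some matrix position twice, and
  exchanging the matrices at these two steps cancels its contributions in pairs. This elementary
  pigeonhole bound is weaker than the degree \<open>2n\<close> of Amitsur and Levitzki but suffices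
  for a PI.\<close>

lemma standard_identity:
  assumes "\<And>y. \<xi> y \<in> carrier (Mat n)" and N: "N > n * n"
  shows "(\<Oplus>p\<in>{p. p permutes {..<N}}. ring_sign p \<otimes>
      foldr (\<otimes>\<^bsub>Mat n\<^esub>) (map \<xi> (map p [0..<N])) \<one>\<^bsub>Mat n\<^esub> i j) = \<zero>"
proof (cases "i < n")
  \<comment> \<open>Rows outside the index range are zero in every matrix of the carrier, including
    the identity.\<close>
  case False
  interpret M: ring "matrix_ring R n" by (rule matrix_ring_ring)
  have "foldr (\<otimes>\<^bsub>Mat n\<^esub>) (map \<xi> w) \<one>\<^bsub>Mat n\<^esub> i j = \<zero>" for w
  proof (rule matrix_carrierD(2))
    show "foldr (\<otimes>\<^bsub>Mat n\<^esub>) (map \<xi> w) \<one>\<^bsub>Mat n\<^esub> \<in> carrier (Mat n)"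
      by (rule M.foldr_mult_closed) (rule assms(1))
  qed (use False in simp)
  then show ?thesis by (intro finsum_eq_zero) (simp only: r_null[OF ring_sign_closed])
next
  case True
  note cl [simp] = matrix_carrierD(1)[OF assms(1)]
  let ?P = "{p. p permutes {..<N}}"
  let ?I = "index_lists n N"
  let ?x = "\<lambda>y (e :: nat \<times> nat). \<xi> y (fst e) (snd e)"
  let ?e = "\<lambda>rs k. ((i # rs) ! k, rs ! k)"
  let ?G = "\<lambda>p rs. \<Otimes>k\<in>{..<N}. ?x (p k) (?e rs k)"
  let ?l = "\<lambda>rs. if last (i # rs) = j then \<one> else \<zero>"
  have fin: "finite ?P" "finite ?I" by (auto intro: finite_permutations finite_lists_length_eq)
  have Gcl: "?G p rs \<in> carrier R" for p rs by (auto intro!: finprod_closed)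
  have lcl: "?l rs \<in> carrier R" for rs by simp
  have entry: "foldr (\<otimes>\<^bsub>Mat n\<^esub>) (map \<xi> (map p [0..<N])) \<one>\<^bsub>Mat n\<^esub> i j
      = (\<Oplus>rs\<in>?I. ?G p rs \<otimes> ?l rs)" for p
  proof -
    have "(\<Otimes>k\<in>{..<N}. \<xi> (map p [0..<N] ! k) ((i # rs) ! k) (rs ! k)) = ?G p rs" for rs
      by (intro finprod_cong') auto
    then show ?thesis using matrix_word_entry[OF assms(1) True, where w = "map p [0..<N]"]
      by (simp del: last.simps)
  qed
  have zero: "(\<Oplus>p\<in>?P. ring_sign p \<otimes> ?G p rs) = \<zero>" if rs: "rs \<in> ?I" for rs
  proof -
    have sub: "?e rs ` {..<N} \<subseteq> {..<n} \<times> {..<n}"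
    proof (rule image_subsetI, rule SigmaI)
      fix k assume "k \<in> {..<N}"
      then have "rs ! k \<in> set rs" "(i # rs) ! k \<in> set (i # rs)"
        using rs by (intro nth_mem; simp)+
      moreover have "set rs \<subseteq> {..<n}" "set (i # rs) \<subseteq> {..<n}" using rs True by auto
      ultimately show "rs ! k \<in> {..<n}" "(i # rs) ! k \<in> {..<n}" by blast+
    qed
    have "card (?e rs ` {..<N}) \<le> card ({..<n} \<times> {..<n})" by (rule card_mono[OF _ sub]) simp
    then have "card (?e rs ` {..<N}) \<le> n * n" by (simp only: card_cartesian_product card_lessThan)
    then have "\<not> inj_on (?e rs) {..<N}" using N by (intro pigeonhole) simp
    then obtain a b where "a < N" "b < N" "a \<noteq> b" "?e rs a = ?e rs b"
      unfolding inj_on_def by blast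
    then show ?thesis by (rule alternating_sum_eq_zero) (rule cl)
  qed
  show ?thesis unfolding entry
    by (rule finsum_weighted_eq_zero[OF fin ring_sign_closed Gcl lcl zero])
qed

end

text \<open>The coefficients of the standard polynomial are signs, which \<open>\<sigma>\<close>
  preserves, so the identity of the matrices over \<open>F\<close> has coefficients in
  \<open>K\<close> and pulls back along the injection.\<close>

lemma matrix_embeddable_imp_PI:
  fixes K :: "('k, 'm) ring_scheme" and A :: "('a, 'n) ring_scheme"
  assumes "field K" "ring A" "\<iota> \<in> ring_hom K A" "matrix_embeddable K A \<iota>"
  shows "PI_algebra K A \<iota>"
proof -
  obtain F :: "(nat \<Rightarrow> 'k) ring" and \<sigma> n \<phi> where "field F" and \<sigma>: "\<sigma> \<in> ring_hom K F"
    and \<phi>: "\<phi> \<in> ring_hom A (matrix_ring F n)" "inj_on \<phi> (carrier A)"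
      "\<And>c. c \<in> carrier K \<Longrightarrow> \<phi> (\<iota> c) = scalar_matrix F n (\<sigma> c)"
    using assms(4) unfolding matrix_embeddable_def by blast
  interpret K: field K by fact
  interpret A: ring A by fact
  interpret F: field F by fact
  interpret M: ring "matrix_ring F n" by (rule F.matrix_ring_ring)
  interpret \<sigma>: ring_hom_ring K F \<sigma> by (rule ring_hom_ringI2[OF K.ring_axioms F.ring_axioms \<sigma>])
  interpret \<phi>: ring_hom_ring A "matrix_ring F n" \<phi>
    by (rule ring_hom_ringI2[OF A.ring_axioms M.ring_axioms \<phi>(1)])
  define N where "N = Suc (n * n)"
  let ?f = "K.standard_poly N"
  let ?P = "{p. p permutes {..<N}}"
  let ?w = "\<lambda>p. map p [0..<N]"
  \<comment> \<open>Nonzero in every characteristic, as \<open>-1\<close> is; hence the identity is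
    not the zero polynomial.\<close>
  have sign: "K.ring_sign p \<noteq> \<zero>\<^bsub>K\<^esub>" for p
  proof -
    have "\<ominus>\<^bsub>K\<^esub> \<one>\<^bsub>K\<^esub> \<noteq> \<zero>\<^bsub>K\<^esub>"
    proof
      assume "\<ominus>\<^bsub>K\<^esub> \<one>\<^bsub>K\<^esub> = \<zero>\<^bsub>K\<^esub>"
      then have "\<ominus>\<^bsub>K\<^esub> (\<ominus>\<^bsub>K\<^esub> \<one>\<^bsub>K\<^esub>) = \<zero>\<^bsub>K\<^esub>" by simp
      then show False by (simp only: K.minus_minus[OF K.one_closed] K.one_not_zero)
    qed
    then show ?thesis unfolding K.ring_sign_def using K.one_not_zero by presburger
  qed
  have supp: "{w. ?f w \<noteq> \<zero>\<^bsub>K\<^esub>} = ?w ` ?P"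
  proof (intro equalityI subsetI)
    fix w assume "w \<in> {w. ?f w \<noteq> \<zero>\<^bsub>K\<^esub>}"
    then show "w \<in> ?w ` ?P" using K.standard_poly_other[of w N] by blast
  next
    fix w assume "w \<in> ?w ` ?P"
    then obtain p where "p permutes {..<N}" "w = ?w p" by blast
    then have "?f w = K.ring_sign p" by (simp only: K.standard_poly_perm)
    then show "w \<in> {w. ?f w \<noteq> \<zero>\<^bsub>K\<^esub>}" using sign[of p] by (simp only: mem_Collect_eq not_False_eq_True)
  qed
  have \<sigma>_sign: "\<sigma> (K.ring_sign p) = F.ring_sign p" for p
    by (simp add: K.ring_sign_def F.ring_sign_def)
  have "id \<in> ?P" by (simp add: permutes_id)
  then have "?f (?w id) \<noteq> \<zero>\<^bsub>K\<^esub>" using supp by blast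
  then have nz: "?f \<noteq> \<zero>\<^bsub>free_algebra K\<^esub>" by (metis K.free_zero)
  have "nc_eval K A \<iota> \<xi> ?f = \<zero>\<^bsub>A\<^esub>" if "range \<xi> \<subseteq> carrier A" for \<xi>
  proof -
    have \<xi>: "\<xi> y \<in> carrier A" for y using that by blast
    define \<eta> where "\<eta> y = \<phi> (\<xi> y)" for y
    have \<eta>: "\<eta> y \<in> carrier (F.Mat n)" for y
      unfolding \<eta>_def by (rule \<phi>.hom_closed[OF \<xi>])
    let ?m = "\<lambda>w. foldr (\<otimes>\<^bsub>F.Mat n\<^esub>) (map \<eta> w) \<one>\<^bsub>F.Mat n\<^esub>"
    have m: "?m w \<in> carrier (F.Mat n)" for w by (rule M.foldr_mult_closed) (rule \<eta>)
    have fK: "?f w \<in> carrier K" for w by (rule K.free_carrierD(1)[OF K.standard_poly_closed])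
    have \<iota>f: "\<phi> (\<iota> (?f w)) = scalar_matrix F n (\<sigma> (?f w))" for w by (rule \<phi>(3)[OF fK])
    have "\<phi> (nc_eval K A \<iota> \<xi> ?f) = nc_eval K (matrix_ring F n) (\<lambda>c. \<phi> (\<iota> c)) \<eta> ?f"
      unfolding \<eta>_def by (rule \<phi>.hom_nc_eval) (rule \<xi>, rule ring_hom_closed[OF assms(3) fK])
    also have "\<dots> = \<zero>\<^bsub>F.Mat n\<^esub>"
    proof (rule ext, rule ext)
      fix i j
      have "nc_eval K (matrix_ring F n) (\<lambda>c. \<phi> (\<iota> c)) \<eta> ?f i j
          = (\<Oplus>\<^bsub>F\<^esub>w\<in>?w ` ?P. (scalar_matrix F n (\<sigma> (?f w)) \<otimes>\<^bsub>F.Mat n\<^esub> ?m w) i j)"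
        unfolding nc_eval_def \<iota>f supp
        by (rule F.matrix_finsum_apply) (intro Pi_I M.m_closed m F.scalar_matrix_closed \<sigma>.hom_closed fK)
      also have "\<dots> = (\<Oplus>\<^bsub>F\<^esub>w\<in>?w ` ?P. \<sigma> (?f w) \<otimes>\<^bsub>F\<^esub> ?m w i j)"
        by (simp only: F.scalar_matrix_mult(1)[OF \<sigma>.hom_closed[OF fK] m])
      also have "\<dots> = (\<Oplus>\<^bsub>F\<^esub>p\<in>?P. \<sigma> (?f (?w p)) \<otimes>\<^bsub>F\<^esub> ?m (?w p) i j)"
        by (rule F.finsum_reindex[OF _ inj_on_map_upt_permutes])
          (intro Pi_I F.m_closed \<sigma>.hom_closed fK F.matrix_carrierD(1)[OF m])
      also have "\<dots> = (\<Oplus>\<^bsub>F\<^esub>p\<in>?P. F.ring_sign p \<otimes>\<^bsub>F\<^esub> ?m (?w p) i j)"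
        by (rule F.finsum_cong')
          (simp_all only: K.standard_poly_perm \<sigma>_sign mem_Collect_eq Pi_iff
            F.m_closed[OF F.ring_sign_closed F.matrix_carrierD(1)[OF m]] simp_thms ball_simps)
      also have "\<dots> = \<zero>\<^bsub>F\<^esub>" by (rule F.standard_identity[OF \<eta>]) (simp add: N_def)
      finally show "nc_eval K (matrix_ring F n) (\<lambda>c. \<phi> (\<iota> c)) \<eta> ?f i j = \<zero>\<^bsub>F.Mat n\<^esub> i j"
        by (simp only: F.matrix_zero)
    qed
    also have "\<dots> = \<phi> \<zero>\<^bsub>A\<^esub>" by (rule \<phi>.hom_zero[symmetric])
    finally have eq: "\<phi> (nc_eval K A \<iota> \<xi> ?f) = \<phi> \<zero>\<^bsub>A\<^esub>" .
    have "nc_eval K A \<iota> \<xi> ?f \<in> carrier A"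
      unfolding nc_eval_def
      by (rule A.finsum_closed) (intro Pi_I A.m_closed ring_hom_closed[OF assms(3) fK] A.foldr_mult_closed \<xi>)
    then show ?thesis using inj_onD[OF \<phi>(2) eq] by simp
  qed
  then show ?thesis unfolding PI_algebra_def using K.standard_poly_closed nz by blast
qed

section \<open>Fields of fractions\<close>

context domain
begin

definition frac_pairs :: "('a \<times> 'a) set" where
  "frac_pairs = carrier R \<times> (carrier R - {\<zero>})"

definition fraction :: "'a \<Rightarrow> 'a \<Rightarrow> ('a \<times> 'a) set" where
  "fraction a b = {p \<in> frac_pairs. a \<otimes> snd p = fst p \<otimes> b}"

definition frac_num :: "('a \<times> 'a) set \<Rightarrow> 'a" where "frac_num U = fst (SOME p. p \<in> U)"
definition frac_den :: "('a \<times> 'a) set \<Rightarrow> 'a" where "frac_den U = snd (SOME p. p \<in> U)"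

text \<open>The operations act on chosen representatives; \<open>fraction_mult\<close> and
  \<open>fraction_add\<close> show that the choice does not matter.\<close>

definition fraction_field :: "('a \<times> 'a) set ring" where
  "fraction_field = \<lparr>
     carrier = {fraction a b | a b. (a, b) \<in> frac_pairs},
     monoid.mult = (\<lambda>U V. fraction (frac_num U \<otimes> frac_num V) (frac_den U \<otimes> frac_den V)),
     one = fraction \<one> \<one>,
     ring.zero = fraction \<zero> \<one>,
     add = (\<lambda>U V. fraction (frac_num U \<otimes> frac_den V \<oplus> frac_num V \<otimes> frac_den U) (frac_den U \<otimes> frac_den V))\<rparr>"

lemma frac_pairs_iff: "(a, b) \<in> frac_pairs \<longleftrightarrow> a \<in> carrier R \<and> b \<in> carrier R \<and> b \<noteq> \<zero>"
  by (auto simp: frac_pairs_def)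

text \<open>The content is transitivity of cross multiplication: multiply by a nonzero denominator,
  rearrange, and cancel it again.\<close>

lemma fraction_eq_iff:
  assumes "(a, b) \<in> frac_pairs" "(c, d) \<in> frac_pairs"
  shows "fraction a b = fraction c d \<longleftrightarrow> a \<otimes> d = c \<otimes> b"
proof
  assume "fraction a b = fraction c d"
  moreover have "(c, d) \<in> fraction c d" using assms(2) by (simp add: fraction_def)
  ultimately have "(c, d) \<in> fraction a b" by simp
  then show "a \<otimes> d = c \<otimes> b" by (simp add: fraction_def)
next
  assume eq: "a \<otimes> d = c \<otimes> b"
  note cl = assms[unfolded frac_pairs_iff]
  have "a \<otimes> y = x \<otimes> b \<longleftrightarrow> c \<otimes> y = x \<otimes> d" if xy: "x \<in> carrier R" "y \<in> carrier R" for x y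
  proof
    assume e: "a \<otimes> y = x \<otimes> b"
    have "b \<otimes> (c \<otimes> y) = (c \<otimes> b) \<otimes> y" using cl xy by (simp add: m_ac)
    also have "\<dots> = (a \<otimes> y) \<otimes> d" unfolding eq[symmetric] using cl xy by (simp add: m_ac)
    also have "\<dots> = b \<otimes> (x \<otimes> d)" unfolding e using cl xy by (simp add: m_ac)
    finally show "c \<otimes> y = x \<otimes> d" using cl xy by (subst (asm) m_lcancel) auto
  next
    assume e: "c \<otimes> y = x \<otimes> d"
    have "d \<otimes> (a \<otimes> y) = (a \<otimes> d) \<otimes> y" using cl xy by (simp add: m_ac)
    also have "\<dots> = (c \<otimes> y) \<otimes> b" unfolding eq using cl xy by (simp add: m_ac)
    also have "\<dots> = d \<otimes> (x \<otimes> b)" unfolding e using cl xy by (simp add: m_ac)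
    finally show "a \<otimes> y = x \<otimes> b" using cl xy by (subst (asm) m_lcancel) auto
  qed
  then show "fraction a b = fraction c d"
    unfolding fraction_def by (intro Collect_cong) (auto simp: frac_pairs_def)
qed

lemma fraction_num_den:
  assumes "(a, b) \<in> frac_pairs"
  shows "(frac_num (fraction a b), frac_den (fraction a b)) \<in> frac_pairs"
    "a \<otimes> frac_den (fraction a b) = frac_num (fraction a b) \<otimes> b"
proof -
  have "(a, b) \<in> fraction a b" using assms by (simp add: fraction_def)
  then have "(SOME p. p \<in> fraction a b) \<in> fraction a b" by (rule someI[of "\<lambda>p. p \<in> fraction a b"])
  then show "(frac_num (fraction a b), frac_den (fraction a b)) \<in> frac_pairs"
    "a \<otimes> frac_den (fraction a b) = frac_num (fraction a b) \<otimes> b"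
    by (auto simp: frac_num_def frac_den_def fraction_def)
qed

lemma mult_pairs:
  assumes "(a, b) \<in> frac_pairs" "(c, d) \<in> frac_pairs"
  shows "(a \<otimes> c, b \<otimes> d) \<in> frac_pairs" "(a \<otimes> d \<oplus> c \<otimes> b, b \<otimes> d) \<in> frac_pairs"
  using assms integral by (auto simp: frac_pairs_iff)

lemma fraction_mult:
  assumes "(a, b) \<in> frac_pairs" "(c, d) \<in> frac_pairs"
  shows "fraction a b \<otimes>\<^bsub>fraction_field\<^esub> fraction c d = fraction (a \<otimes> c) (b \<otimes> d)"
proof -
  define a' b' where "a' = frac_num (fraction a b)" and "b' = frac_den (fraction a b)"
  define c' d' where "c' = frac_num (fraction c d)" and "d' = frac_den (fraction c d)"
  have 1: "(a', b') \<in> frac_pairs" "a \<otimes> b' = a' \<otimes> b"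
    unfolding a'_def b'_def by (rule fraction_num_den[OF assms(1)])+
  have 2: "(c', d') \<in> frac_pairs" "c \<otimes> d' = c' \<otimes> d"
    unfolding c'_def d'_def by (rule fraction_num_den[OF assms(2)])+
  note cl = assms[unfolded frac_pairs_iff] 1(1)[unfolded frac_pairs_iff] 2(1)[unfolded frac_pairs_iff]
  have "a' \<otimes> c' \<otimes> (b \<otimes> d) = (a' \<otimes> b) \<otimes> (c' \<otimes> d)" using cl by (simp add: m_ac)
  also have "\<dots> = (a \<otimes> c) \<otimes> (b' \<otimes> d')" unfolding 1(2)[symmetric] 2(2)[symmetric] using cl by (simp add: m_ac)
  finally have "fraction (a' \<otimes> c') (b' \<otimes> d') = fraction (a \<otimes> c) (b \<otimes> d)"
    by (subst fraction_eq_iff[OF mult_pairs(1)[OF 1(1) 2(1)] mult_pairs(1)[OF assms]])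
  then show ?thesis by (simp add: fraction_field_def a'_def b'_def c'_def d'_def)
qed

lemma fraction_add:
  assumes "(a, b) \<in> frac_pairs" "(c, d) \<in> frac_pairs"
  shows "fraction a b \<oplus>\<^bsub>fraction_field\<^esub> fraction c d = fraction (a \<otimes> d \<oplus> c \<otimes> b) (b \<otimes> d)"
proof -
  define a' b' where "a' = frac_num (fraction a b)" and "b' = frac_den (fraction a b)"
  define c' d' where "c' = frac_num (fraction c d)" and "d' = frac_den (fraction c d)"
  have 1: "(a', b') \<in> frac_pairs" "a \<otimes> b' = a' \<otimes> b"
    unfolding a'_def b'_def by (rule fraction_num_den[OF assms(1)])+
  have 2: "(c', d') \<in> frac_pairs" "c \<otimes> d' = c' \<otimes> d"
    unfolding c'_def d'_def by (rule fraction_num_den[OF assms(2)])+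
  note cl = assms[unfolded frac_pairs_iff] 1(1)[unfolded frac_pairs_iff] 2(1)[unfolded frac_pairs_iff]
  have "(a' \<otimes> d' \<oplus> c' \<otimes> b') \<otimes> (b \<otimes> d) = (a' \<otimes> b) \<otimes> (d' \<otimes> d) \<oplus> (c' \<otimes> d) \<otimes> (b' \<otimes> b)"
    using cl by (simp add: l_distr r_distr m_ac)
  also have "\<dots> = (a \<otimes> d \<oplus> c \<otimes> b) \<otimes> (b' \<otimes> d')"
    unfolding 1(2)[symmetric] 2(2)[symmetric] using cl by (simp add: l_distr r_distr m_ac)
  finally have "fraction (a' \<otimes> d' \<oplus> c' \<otimes> b') (b' \<otimes> d') = fraction (a \<otimes> d \<oplus> c \<otimes> b) (b \<otimes> d)"
    by (subst fraction_eq_iff[OF mult_pairs(2)[OF 1(1) 2(1)] mult_pairs(2)[OF assms]])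
  then show ?thesis by (simp add: fraction_field_def a'_def b'_def c'_def d'_def)
qed

lemma fraction_carrierE:
  assumes "U \<in> carrier fraction_field"
  obtains a b where "U = fraction a b" "(a, b) \<in> frac_pairs"
  using assms by (auto simp: fraction_field_def)

lemma fraction_closed: "(a, b) \<in> frac_pairs \<Longrightarrow> fraction a b \<in> carrier fraction_field"
  by (auto simp: fraction_field_def)

lemma fraction_one: "\<one>\<^bsub>fraction_field\<^esub> = fraction \<one> \<one>"
  and fraction_zero: "\<zero>\<^bsub>fraction_field\<^esub> = fraction \<zero> \<one>"
  by (simp_all add: fraction_field_def)

lemma fraction_field: "field fraction_field"
proof -
  let ?Q = fraction_field
  have one: "(\<one>, \<one>) \<in> frac_pairs" and zero: "(\<zero>, \<one>) \<in> frac_pairs"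
    by (simp_all add: frac_pairs_iff)
  have ab: "abelian_group ?Q"
  proof (rule abelian_groupI)
    fix U V Z assume "U \<in> carrier ?Q" "V \<in> carrier ?Q" "Z \<in> carrier ?Q"
    then obtain a b c d e f where U: "U = fraction a b" "(a, b) \<in> frac_pairs"
      and V: "V = fraction c d" "(c, d) \<in> frac_pairs"
      and Z: "Z = fraction e f" "(e, f) \<in> frac_pairs"
      by (metis fraction_carrierE)
    note cl = U(2)[unfolded frac_pairs_iff] V(2)[unfolded frac_pairs_iff] Z(2)[unfolded frac_pairs_iff]
    show "U \<oplus>\<^bsub>?Q\<^esub> V \<oplus>\<^bsub>?Q\<^esub> Z = U \<oplus>\<^bsub>?Q\<^esub> (V \<oplus>\<^bsub>?Q\<^esub> Z)"
      unfolding U(1) V(1) Z(1) fraction_add[OF U(2) V(2)] fraction_add[OF V(2) Z(2)]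
        fraction_add[OF mult_pairs(2)[OF U(2) V(2)] Z(2)] fraction_add[OF U(2) mult_pairs(2)[OF V(2) Z(2)]]
      using cl by (intro arg_cong2[where f = fraction]) (simp_all add: l_distr r_distr m_ac a_ac)
  next
    fix U V assume "U \<in> carrier ?Q" "V \<in> carrier ?Q"
    then obtain a b c d where U: "U = fraction a b" "(a, b) \<in> frac_pairs"
      and V: "V = fraction c d" "(c, d) \<in> frac_pairs"
      by (metis fraction_carrierE)
    note cl = U(2)[unfolded frac_pairs_iff] V(2)[unfolded frac_pairs_iff]
    show "U \<oplus>\<^bsub>?Q\<^esub> V \<in> carrier ?Q"
      unfolding U(1) V(1) fraction_add[OF U(2) V(2)] by (rule fraction_closed[OF mult_pairs(2)[OF U(2) V(2)]])
    show "U \<oplus>\<^bsub>?Q\<^esub> V = V \<oplus>\<^bsub>?Q\<^esub> U"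
      unfolding U(1) V(1) fraction_add[OF U(2) V(2)] fraction_add[OF V(2) U(2)]
      using cl by (intro arg_cong2[where f = fraction]) (simp_all add: m_ac a_ac)
  next
    fix U assume "U \<in> carrier ?Q"
    then obtain a b where U: "U = fraction a b" "(a, b) \<in> frac_pairs"
      by (metis fraction_carrierE)
    note cl = U(2)[unfolded frac_pairs_iff]
    show "\<zero>\<^bsub>?Q\<^esub> \<oplus>\<^bsub>?Q\<^esub> U = U"
      unfolding U(1) fraction_zero fraction_add[OF zero U(2)] using cl by simp
    have neg: "(\<ominus> a, b) \<in> frac_pairs" using cl by (simp add: frac_pairs_iff)
    have "\<ominus> a \<otimes> b \<oplus> a \<otimes> b = \<zero>" using cl by (simp add: l_neg flip: l_distr)
    then have "fraction (\<ominus> a \<otimes> b \<oplus> a \<otimes> b) (b \<otimes> b) = fraction \<zero> \<one>"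
      using cl by (subst fraction_eq_iff[OF mult_pairs(2)[OF neg U(2)] zero]) simp
    then have "fraction (\<ominus> a) b \<oplus>\<^bsub>?Q\<^esub> U = \<zero>\<^bsub>?Q\<^esub>"
      unfolding U(1) fraction_zero fraction_add[OF neg U(2)] .
    then show "\<exists>V\<in>carrier ?Q. V \<oplus>\<^bsub>?Q\<^esub> U = \<zero>\<^bsub>?Q\<^esub>"
      using fraction_closed[OF neg] by blast
  qed (simp add: fraction_zero fraction_closed zero)
  have cm: "comm_monoid ?Q"
  proof (rule comm_monoidI)
    fix U V Z assume "U \<in> carrier ?Q" "V \<in> carrier ?Q" "Z \<in> carrier ?Q"
    then obtain a b c d e f where U: "U = fraction a b" "(a, b) \<in> frac_pairs"
      and V: "V = fraction c d" "(c, d) \<in> frac_pairs"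
      and Z: "Z = fraction e f" "(e, f) \<in> frac_pairs"
      by (metis fraction_carrierE)
    note cl = U(2)[unfolded frac_pairs_iff] V(2)[unfolded frac_pairs_iff] Z(2)[unfolded frac_pairs_iff]
    show "U \<otimes>\<^bsub>?Q\<^esub> V \<otimes>\<^bsub>?Q\<^esub> Z = U \<otimes>\<^bsub>?Q\<^esub> (V \<otimes>\<^bsub>?Q\<^esub> Z)"
      unfolding U(1) V(1) Z(1) fraction_mult[OF U(2) V(2)] fraction_mult[OF V(2) Z(2)]
        fraction_mult[OF mult_pairs(1)[OF U(2) V(2)] Z(2)] fraction_mult[OF U(2) mult_pairs(1)[OF V(2) Z(2)]]
      using cl by (simp add: m_assoc)
  next
    fix U V assume "U \<in> carrier ?Q" "V \<in> carrier ?Q"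
    then obtain a b c d where U: "U = fraction a b" "(a, b) \<in> frac_pairs"
      and V: "V = fraction c d" "(c, d) \<in> frac_pairs"
      by (metis fraction_carrierE)
    note cl = U(2)[unfolded frac_pairs_iff] V(2)[unfolded frac_pairs_iff]
    show "U \<otimes>\<^bsub>?Q\<^esub> V \<in> carrier ?Q"
      unfolding U(1) V(1) fraction_mult[OF U(2) V(2)] by (rule fraction_closed[OF mult_pairs(1)[OF U(2) V(2)]])
    show "U \<otimes>\<^bsub>?Q\<^esub> V = V \<otimes>\<^bsub>?Q\<^esub> U"
      unfolding U(1) V(1) fraction_mult[OF U(2) V(2)] fraction_mult[OF V(2) U(2)]
      using cl by (simp add: m_comm)
  next
    fix U assume "U \<in> carrier ?Q"
    then obtain a b where U: "U = fraction a b" "(a, b) \<in> frac_pairs"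
      by (metis fraction_carrierE)
    note cl = U(2)[unfolded frac_pairs_iff]
    show "\<one>\<^bsub>?Q\<^esub> \<otimes>\<^bsub>?Q\<^esub> U = U"
      unfolding U(1) fraction_one fraction_mult[OF one U(2)] using cl by simp
  qed (simp add: fraction_one fraction_closed one)
  have "cring ?Q"
  proof (rule cringI[OF ab cm])
    fix U V Z assume "U \<in> carrier ?Q" "V \<in> carrier ?Q" "Z \<in> carrier ?Q"
    then obtain a b c d e f where U: "U = fraction a b" "(a, b) \<in> frac_pairs"
      and V: "V = fraction c d" "(c, d) \<in> frac_pairs"
      and Z: "Z = fraction e f" "(e, f) \<in> frac_pairs"
      by (metis fraction_carrierE)
    note cl = U(2)[unfolded frac_pairs_iff] V(2)[unfolded frac_pairs_iff] Z(2)[unfolded frac_pairs_iff]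
    note UV = mult_pairs(2)[OF U(2) V(2)] and UZ = mult_pairs(1)[OF U(2) Z(2)] and VZ = mult_pairs(1)[OF V(2) Z(2)]
    show "(U \<oplus>\<^bsub>?Q\<^esub> V) \<otimes>\<^bsub>?Q\<^esub> Z
        = U \<otimes>\<^bsub>?Q\<^esub> Z \<oplus>\<^bsub>?Q\<^esub> V \<otimes>\<^bsub>?Q\<^esub> Z"
      unfolding U(1) V(1) Z(1) fraction_add[OF U(2) V(2)] fraction_mult[OF U(2) Z(2)] fraction_mult[OF V(2) Z(2)]
        fraction_mult[OF UV Z(2)] fraction_add[OF UZ VZ] fraction_eq_iff[OF mult_pairs(1)[OF UV Z(2)] mult_pairs(2)[OF UZ VZ]]
      using cl by (simp add: l_distr r_distr m_ac)
  qed
  then interpret Q: cring fraction_field .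
  show ?thesis
  proof (rule Q.cring_fieldI2)
    show "\<zero>\<^bsub>?Q\<^esub> \<noteq> \<one>\<^bsub>?Q\<^esub>"
      unfolding fraction_zero fraction_one fraction_eq_iff[OF zero one] by simp
    fix U assume "U \<in> carrier ?Q" and nz: "U \<noteq> \<zero>\<^bsub>?Q\<^esub>"
    then obtain a b where U: "U = fraction a b" "(a, b) \<in> frac_pairs"
      by (metis fraction_carrierE)
    note cl = U(2)[unfolded frac_pairs_iff]
    have "a \<noteq> \<zero>" using nz cl unfolding U(1) fraction_zero fraction_eq_iff[OF U(2) zero] by auto
    then have ba: "(b, a) \<in> frac_pairs" using cl by (simp add: frac_pairs_iff)
    have "U \<otimes>\<^bsub>?Q\<^esub> fraction b a = \<one>\<^bsub>?Q\<^esub>"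
      unfolding U(1) fraction_one fraction_mult[OF U(2) ba] fraction_eq_iff[OF mult_pairs(1)[OF U(2) ba] one]
      using cl by (simp add: m_comm)
    then show "\<exists>V\<in>carrier ?Q. U \<otimes>\<^bsub>?Q\<^esub> V = \<one>\<^bsub>?Q\<^esub>"
      using fraction_closed[OF ba] by blast
  qed
qed

lemma fraction_embedding:
  "(\<lambda>a. fraction a \<one>) \<in> ring_hom R fraction_field" "inj_on (\<lambda>a. fraction a \<one>) (carrier R)"
proof -
  have p: "(a, \<one>) \<in> frac_pairs" if "a \<in> carrier R" for a
    using that by (simp add: frac_pairs_iff)
  show "(\<lambda>a. fraction a \<one>) \<in> ring_hom R fraction_field"
    by (rule ring_hom_memI) (simp_all add: fraction_closed fraction_mult fraction_add fraction_one p)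
  show "inj_on (\<lambda>a. fraction a \<one>) (carrier R)"
    by (rule inj_onI) (simp add: fraction_eq_iff p)
qed

end

section \<open>Formal Dirichlet series\<close>

text \<open>
  The monoid of positive integers under multiplication is the free commutative monoid on the primes, and
  it is ordered. Hence the convolution ring over it is a domain in which the unit masses at the integers
  are the monomials in infinitely many algebraically independent elements.\<close>

definition dirichlet :: "('k, 'm) ring_scheme \<Rightarrow> (nat \<Rightarrow> 'k) ring" where
  "dirichlet K = conv_ring K {0<..} (*) 1"

lemma splits_times_finite: "finite (splits {0<..} (*) (n::nat))"
proof (rule finite_subset)
  have "a \<le> a * b" "b \<le> a * b" if "0 < a" "0 < b" for a b :: nat using that by auto
  then show "splits {0<..} (*) n \<subseteq> {..n} \<times> {..n}" by (auto simp: splits_def)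
qed simp

lemma (in ring) convolution_times: "convolution R {0<..} (*) (1::nat)"
  by unfold_locales (auto simp: splits_times_finite)

text \<open>Compare leading terms: if \<open>a\<close> and \<open>b\<close> are the least points of
  the supports, only the pair \<open>(a, b)\<close> contributes to the product at
  \<open>a * b\<close>, and its contribution is nonzero.\<close>

lemma (in domain) dirichlet_domain: "domain (dirichlet R)"
proof -
  interpret C: convolution R "{0<..}" "(*)" "1::nat" by (rule convolution_times)
  interpret D: ring C.C by (rule C.conv_ring)
  have comm: "f \<otimes>\<^bsub>C.C\<^esub> g = g \<otimes>\<^bsub>C.C\<^esub> f" if "f \<in> carrier C.C" "g \<in> carrier C.C" for f g
  proof
    fix n :: nat
    note cl [simp] = C.conv_carrierD(1)[OF that(1)] C.conv_carrierD(1)[OF that(2)]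
    have swap_mem: "prod.swap p \<in> splits {0<..} (*) n" if "p \<in> splits {0<..} (*) n" for p
      using that by (auto simp: splits_def mult.commute)
    have swap_image: "prod.swap ` splits {0<..} (*) n = splits {0<..} (*) n"
    proof (intro equalityI subsetI)
      fix p assume "p \<in> splits {0<..} (*) n"
      then show "p \<in> prod.swap ` splits {0<..} (*) n"
        using image_eqI[of p prod.swap "prod.swap p"] swap_mem by simp
    qed (use swap_mem in blast)
    have "(g \<otimes>\<^bsub>C.C\<^esub> f) n = (\<Oplus>p\<in>prod.swap ` splits {0<..} (*) n. g (fst p) \<otimes> f (snd p))"
      unfolding swap_image C.conv_mult ..
    also have "\<dots> = (\<Oplus>p\<in>splits {0<..} (*) n. g (fst (prod.swap p)) \<otimes> f (snd (prod.swap p)))"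
      by (rule finsum_reindex) (auto simp: inj_on_def)
    also have "\<dots> = (\<Oplus>p\<in>splits {0<..} (*) n. f (fst p) \<otimes> g (snd p))"
      by (rule finsum_cong') (auto simp: m_comm)
    also have "\<dots> = (f \<otimes>\<^bsub>C.C\<^esub> g) n" unfolding C.conv_mult ..
    finally show "(f \<otimes>\<^bsub>C.C\<^esub> g) n = (g \<otimes>\<^bsub>C.C\<^esub> f) n" by simp
  qed
  have "comm_monoid C.C"
    by (rule D.monoid_comm_monoidI) (rule comm)
  then interpret D: cring C.C by (intro cring.intro D.ring_axioms)
  show ?thesis unfolding dirichlet_def
  proof (intro domain.intro D.cring_axioms domain_axioms.intro)
    have "\<one>\<^bsub>C.C\<^esub> 1 \<noteq> \<zero>\<^bsub>C.C\<^esub> 1" by (simp add: conv_ring_def)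
    then show "\<one>\<^bsub>C.C\<^esub> \<noteq> \<zero>\<^bsub>C.C\<^esub>" by metis
    fix f g assume fg: "f \<otimes>\<^bsub>C.C\<^esub> g = \<zero>\<^bsub>C.C\<^esub>" "f \<in> carrier C.C" "g \<in> carrier C.C"
    note cl = C.conv_carrierD(1)[OF fg(2)] C.conv_carrierD(1)[OF fg(3)]
    show "f = \<zero>\<^bsub>C.C\<^esub> \<or> g = \<zero>\<^bsub>C.C\<^esub>"
    proof (rule ccontr)
      assume "\<not> ?thesis"
      then have ex: "\<exists>a. f a \<noteq> \<zero>" "\<exists>b. g b \<noteq> \<zero>" by (auto simp: conv_ring_def)
      define a b where "a = (LEAST a. f a \<noteq> \<zero>)" and "b = (LEAST b. g b \<noteq> \<zero>)"
      have a: "f a \<noteq> \<zero>" "\<And>c. c < a \<Longrightarrow> f c = \<zero>"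
        unfolding a_def using LeastI_ex[OF ex(1)] not_less_Least by blast+
      have b: "g b \<noteq> \<zero>" "\<And>c. c < b \<Longrightarrow> g c = \<zero>"
        unfolding b_def using LeastI_ex[OF ex(2)] not_less_Least by blast+
      have "a \<in> {0<..}" "b \<in> {0<..}"
        using C.conv_carrierD(2)[OF fg(2), of a] C.conv_carrierD(2)[OF fg(3), of b] a(1) b(1) by blast+
      then have pos: "0 < a" "0 < b" by auto
      have "(f \<otimes>\<^bsub>C.C\<^esub> g) (a * b) = f (fst (a, b)) \<otimes> g (snd (a, b))"
        unfolding C.conv_mult
      proof (rule finsum_eq_single[OF splits_times_finite])
        fix p assume p: "p \<in> splits {0<..} (*) (a * b)" "p \<noteq> (a, b)"
        obtain c d where cd: "p = (c, d)" by (cases p)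
        have "c * d = a * b" using p(1) cd by (simp add: splits_def)
        \<comment> \<open>Multiplication of positive integers is strictly monotone, so another
          factorisation of \<open>a * b\<close> cannot have both parts at least \<open>a\<close> and
          \<open>b\<close>.\<close>
        have "c < a \<or> d < b"
        proof (rule ccontr)
          assume "\<not> ?thesis"
          then have ge: "a \<le> c" "b \<le> d" by auto
          have "c = a"
          proof (rule ccontr)
            assume "c \<noteq> a"
            then have "a * b < c * b" using ge pos by simp
            also have "\<dots> \<le> c * d" using ge by simp
            finally show False using \<open>c * d = a * b\<close> by simp
          qed
          then have "d = b" using \<open>c * d = a * b\<close> pos by simp
          with \<open>c = a\<close> show False using p(2) cd by simp
        qed
        then show "f (fst p) \<otimes> g (snd p) = \<zero>" using a(2) b(2) cl cd by auto
      qed (use pos cl in \<open>auto simp: splits_def\<close>)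
      moreover have "\<zero>\<^bsub>C.C\<^esub> n = \<zero>" for n by (simp add: conv_ring_def)
      ultimately have "f a \<otimes> g b = \<zero>" unfolding fg(1) by simp
      then show False using integral[OF _ cl] a(1) b(1) by blast
    qed
  qed
qed

text \<open>The Dirichlet monomial \<open>c / n^s\<close>; at \<open>n = 1\<close> it is a
  constant.\<close>

definition unit_mass :: "('k, 'm) ring_scheme \<Rightarrow> 'k \<Rightarrow> nat \<Rightarrow> nat \<Rightarrow> 'k" where
  "unit_mass K c n = (\<lambda>m. if m = n then c else \<zero>\<^bsub>K\<^esub>)"

context ring
begin

lemma unit_mass_closed: "c \<in> carrier R \<Longrightarrow> 0 < n \<Longrightarrow> unit_mass R c n \<in> carrier (dirichlet R)"
  by (auto simp: dirichlet_def conv_ring_def unit_mass_def)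

lemma unit_mass_mult:
  assumes "c \<in> carrier R" "d \<in> carrier R" "0 < a" "0 < b"
  shows "unit_mass R c a \<otimes>\<^bsub>dirichlet R\<^esub> unit_mass R d b = unit_mass R (c \<otimes> d) (a * b)"
proof
  interpret C: convolution R "{0<..}" "(*)" "1::nat" by (rule convolution_times)
  fix n
  show "(unit_mass R c a \<otimes>\<^bsub>dirichlet R\<^esub> unit_mass R d b) n = unit_mass R (c \<otimes> d) (a * b) n"
  proof (cases "n = a * b")
    case True
    have "(unit_mass R c a \<otimes>\<^bsub>dirichlet R\<^esub> unit_mass R d b) n
        = unit_mass R c a (fst (a, b)) \<otimes> unit_mass R d b (snd (a, b))"
      unfolding dirichlet_def C.conv_mult
      by (rule finsum_eq_single[OF splits_times_finite])
        (use True assms in \<open>auto simp: splits_def unit_mass_def\<close>)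
    then show ?thesis using True by (simp add: unit_mass_def)
  next
    case False
    then show ?thesis unfolding dirichlet_def C.conv_mult using assms
      by (subst finsum_eq_zero) (auto simp: splits_def unit_mass_def)
  qed
qed

lemma unit_mass_hom: "(\<lambda>c. unit_mass R c 1) \<in> ring_hom R (dirichlet R)"
proof (rule ring_hom_memI)
  fix c d assume "c \<in> carrier R" "d \<in> carrier R"
  then show "unit_mass R (c \<otimes> d) 1 = unit_mass R c 1 \<otimes>\<^bsub>dirichlet R\<^esub> unit_mass R d 1"
    by (simp add: unit_mass_mult)
qed (auto simp: unit_mass_closed simp del: One_nat_def, auto simp: unit_mass_def dirichlet_def conv_ring_def fun_eq_iff)

lemma dirichlet_finsum_apply:
  assumes "f \<in> A \<rightarrow> carrier (dirichlet R)"
  shows "finsum (dirichlet R) f A n = (\<Oplus>a\<in>A. f a n)"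
proof -
  interpret C: convolution R "{0<..}" "(*)" "1::nat" by (rule convolution_times)
  interpret D: ring "dirichlet R" unfolding dirichlet_def by (rule C.conv_ring)
  have add: "(f \<oplus>\<^bsub>dirichlet R\<^esub> g) n = f n \<oplus> g n" and zero: "\<zero>\<^bsub>dirichlet R\<^esub> n = \<zero>" for f g
    by (simp_all add: dirichlet_def conv_ring_def)
  have cl: "f n \<in> carrier R" if "f \<in> carrier (dirichlet R)" for f
    using that C.conv_carrierD(1) unfolding dirichlet_def by blast
  show ?thesis
    using assms
  proof (induction A rule: infinite_finite_induct)
    case (insert a A)
    then have "(\<lambda>a. f a n) \<in> insert a A \<rightarrow> carrier R" using cl by blast
    with insert show ?case by (simp add: add)
  qed (simp_all add: finsum_infinite zero)
qed

text \<open>Evaluation at \<open>c s\<close> isolates the summand of \<open>s\<close>, since the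
  masses sit at different integers.\<close>

lemma unit_masses_independent:
  assumes "finite S" "inj_on c S" "\<And>s. s \<in> S \<Longrightarrow> 0 < c s" "\<And>s. s \<in> S \<Longrightarrow> f s \<in> carrier R"
    "(\<Oplus>\<^bsub>dirichlet R\<^esub>s\<in>S. unit_mass R (f s) (c s)) = \<zero>\<^bsub>dirichlet R\<^esub>" "s \<in> S"
  shows "f s = \<zero>"
proof -
  have "(\<Oplus>\<^bsub>dirichlet R\<^esub>s\<in>S. unit_mass R (f s) (c s)) (c s) = (\<Oplus>t\<in>S. unit_mass R (f t) (c t) (c s))"
    by (rule dirichlet_finsum_apply) (use assms(3,4) unit_mass_closed in blast)
  also have "\<dots> = unit_mass R (f s) (c s) (c s)"
    using assms(1,4,6) inj_onD[OF assms(2)]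
    by (intro finsum_eq_single) (auto simp: unit_mass_def)
  finally show ?thesis unfolding assms(5) by (simp add: unit_mass_def dirichlet_def conv_ring_def)
qed

end

text \<open>The fractions are encoded as single sequences, numerators at even and denominators at odd places.\<close>

lemma dirichlet_fractions:
  assumes "field K"
  shows "\<exists>(F :: (nat \<Rightarrow> 'k) ring) j. field F \<and> j \<in> ring_hom (dirichlet (K :: ('k, 'm) ring_scheme)) F
    \<and> inj_on j (carrier (dirichlet K))"
proof -
  interpret K: field K by fact
  interpret D: "domain" "dirichlet K" by (rule K.dirichlet_domain)
  interpret Q: field D.fraction_field by (rule D.fraction_field)
  define enc :: "((nat \<Rightarrow> 'k) \<times> (nat \<Rightarrow> 'k)) set \<Rightarrow> nat \<Rightarrow> 'k"
    where "enc U n = (if even n then D.frac_num U (n div 2) else D.frac_den U (n div 2))" for U n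
  have enc_num: "D.frac_num U n = enc U (2 * n)" and enc_den: "D.frac_den U n = enc U (2 * n + 1)" for U n
    by (simp_all add: enc_def)
  have "inj_on enc (carrier D.fraction_field)"
  proof (rule inj_onI)
    fix U V assume U: "U \<in> carrier D.fraction_field" and V: "V \<in> carrier D.fraction_field"
      and eq: "enc U = enc V"
    have nd: "D.frac_num U = D.frac_num V" "D.frac_den U = D.frac_den V"
      by (simp_all add: fun_eq_iff enc_num enc_den eq)
    have rep: "D.fraction (D.frac_num Z) (D.frac_den Z) = Z" if Z: "Z \<in> carrier D.fraction_field" for Z
    proof -
      obtain a b where ab: "Z = D.fraction a b" "(a, b) \<in> D.frac_pairs"
        using D.fraction_carrierE[OF Z] by blast
      show ?thesis
        unfolding ab(1) D.fraction_eq_iff[OF D.fraction_num_den(1)[OF ab(2)] ab(2)]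
        by (rule D.fraction_num_den(2)[OF ab(2), symmetric])
    qed
    show "U = V" using rep[OF U] rep[OF V] nd by metis
  qed
  note inj = this
  \<comment> \<open>Transport along \<open>enc\<close> moves the fraction field to the type on which
    \<open>matrix_embeddable\<close> expects its field.\<close>
  let ?F = "image_ring enc D.fraction_field"
  let ?j = "enc \<circ> (\<lambda>a. D.fraction a \<one>\<^bsub>dirichlet K\<^esub>)"
  have "field ?F" by (rule Q.inj_imp_image_ring_is_field[OF inj])
  moreover have "enc \<in> ring_hom D.fraction_field ?F"
    using inj_imp_image_ring_iso[OF inj] by (simp add: ring_iso_def)
  then have "?j \<in> ring_hom (dirichlet K) ?F"
    by (rule ring_hom_trans[OF D.fraction_embedding(1)])
  moreover have "inj_on ?j (carrier (dirichlet K))"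
  proof (rule comp_inj_on[OF D.fraction_embedding(2)])
    show "inj_on enc ((\<lambda>a. D.fraction a \<one>\<^bsub>dirichlet K\<^esub>) ` carrier (dirichlet K))"
      using inj ring_hom_closed[OF D.fraction_embedding(1)] by (auto intro: inj_on_subset)
  qed
  ultimately show ?thesis by blast
qed

section \<open>Evaluation homomorphisms\<close>

text \<open>The scalars have to commute with the substituted elements; otherwise evaluation would
  not be multiplicative, as the scalar of a right factor must pass the word of the left one.\<close>

locale nc_evaluation = K: ring K + A: ring A
  for K :: "('k, 'm) ring_scheme" and A :: "('a, 'n) ring_scheme" (structure) +
  fixes \<iota> :: "'k \<Rightarrow> 'a" and \<phi> :: "'x \<Rightarrow> 'a"
  assumes \<iota>_hom: "\<iota> \<in> ring_hom K A"
    and \<phi>_closed: "\<phi> y \<in> carrier A"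
    and \<iota>_central: "c \<in> carrier K \<Longrightarrow> \<iota> c \<otimes> \<phi> y = \<phi> y \<otimes> \<iota> c"
begin

sublocale \<iota>: ring_hom_ring K A \<iota>
  by (rule ring_hom_ringI2[OF K.ring_axioms A.ring_axioms \<iota>_hom])

abbreviation "F \<equiv> free_algebra K :: ('x list \<Rightarrow> 'k) ring"
abbreviation "word_val w \<equiv> foldr (\<otimes>) (map \<phi> w) \<one>"
abbreviation "ev \<equiv> nc_eval K A \<iota> \<phi>"

sublocale F: ring F by (rule K.free_algebra_ring)

lemma word_val_closed: "word_val w \<in> carrier A"
  by (rule A.foldr_mult_closed) (rule \<phi>_closed)

lemma word_val_append: "word_val (u @ v) = word_val u \<otimes> word_val v"
  by (induction u) (simp_all add: word_val_closed \<phi>_closed A.m_assoc)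

lemma word_val_central:
  assumes c: "c \<in> carrier K"
  shows "\<iota> c \<otimes> word_val w = word_val w \<otimes> \<iota> c"
proof (induction w)
  case Nil
  show ?case using \<iota>.hom_closed[OF c] by simp
next
  case (Cons y w)
  note cl = \<iota>.hom_closed[OF c] word_val_closed[of w] \<phi>_closed[of y]
  have "\<iota> c \<otimes> word_val (y # w) = (\<iota> c \<otimes> \<phi> y) \<otimes> word_val w" using cl by (simp add: A.m_assoc)
  also have "\<dots> = \<phi> y \<otimes> (\<iota> c \<otimes> word_val w)" unfolding \<iota>_central[OF c] using cl by (simp add: A.m_assoc)
  also have "\<dots> = word_val (y # w) \<otimes> \<iota> c" unfolding Cons.IH using cl by (simp add: A.m_assoc)
  finally show ?case .
qed

lemma ev_summand_closed: "f \<in> carrier F \<Longrightarrow> \<iota> (f w) \<otimes> word_val w \<in> carrier A"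
  by (intro A.m_closed \<iota>.hom_closed K.free_carrierD(1) word_val_closed)

lemma ev_superset:
  assumes "f \<in> carrier F" "finite T" "{w. f w \<noteq> \<zero>\<^bsub>K\<^esub>} \<subseteq> T"
  shows "ev f = (\<Oplus>w\<in>T. \<iota> (f w) \<otimes> word_val w)"
  unfolding nc_eval_def
proof (rule A.add.finprod_mono_neutral_cong_left[OF assms(2,3)])
  fix w assume "w \<in> T - {w. f w \<noteq> \<zero>\<^bsub>K\<^esub>}"
  then have "\<iota> (f w) = \<zero>" by simp
  then show "\<iota> (f w) \<otimes> word_val w = \<zero>" using word_val_closed by simp
qed (use ev_summand_closed[OF assms(1)] in auto)

lemma ev_closed: "f \<in> carrier F \<Longrightarrow> ev f \<in> carrier A"
  unfolding nc_eval_def by (rule A.finsum_closed) (use ev_summand_closed in blast)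

lemma ev_add:
  assumes "f \<in> carrier F" "g \<in> carrier F"
  shows "ev (f \<oplus>\<^bsub>F\<^esub> g) = ev f \<oplus> ev g"
proof -
  let ?T = "{w. f w \<noteq> \<zero>\<^bsub>K\<^esub>} \<union> {w. g w \<noteq> \<zero>\<^bsub>K\<^esub>}"
  note fc = K.free_carrierD(1)[OF assms(1)] and gc = K.free_carrierD(1)[OF assms(2)]
  have fin: "finite ?T" using assms K.free_carrierD(2) by blast
  have "ev (f \<oplus>\<^bsub>F\<^esub> g) = (\<Oplus>w\<in>?T. \<iota> ((f \<oplus>\<^bsub>F\<^esub> g) w) \<otimes> word_val w)"
    by (rule ev_superset[OF F.a_closed[OF assms] fin]) (auto simp: K.free_add)
  also have "\<dots> = (\<Oplus>w\<in>?T. \<iota> (f w) \<otimes> word_val w \<oplus> \<iota> (g w) \<otimes> word_val w)"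
    using fc gc word_val_closed by (intro A.finsum_cong') (auto simp: K.free_add A.l_distr)
  also have "\<dots> = (\<Oplus>w\<in>?T. \<iota> (f w) \<otimes> word_val w) \<oplus> (\<Oplus>w\<in>?T. \<iota> (g w) \<otimes> word_val w)"
    using ev_summand_closed assms by (intro A.finsum_addf) auto
  also have "(\<Oplus>w\<in>?T. \<iota> (f w) \<otimes> word_val w) = ev f"
    by (rule ev_superset[OF assms(1) fin, symmetric]) auto
  also have "(\<Oplus>w\<in>?T. \<iota> (g w) \<otimes> word_val w) = ev g"
    by (rule ev_superset[OF assms(2) fin, symmetric]) auto
  finally show ?thesis .
qed

lemma ev_zero: "ev \<zero>\<^bsub>F\<^esub> = \<zero>"
  unfolding nc_eval_def by (simp add: K.free_zero)

lemma ev_term: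
  assumes "c \<in> carrier K"
  shows "ev (term_elem K c w) = \<iota> c \<otimes> word_val w"
proof -
  have "ev (term_elem K c w) = (\<Oplus>v\<in>{w}. \<iota> (term_elem K c w v) \<otimes> word_val v)"
    by (rule ev_superset[OF K.term_closed[OF assms]]) (auto simp: term_elem_def)
  then show ?thesis
    using \<iota>.hom_closed[OF assms] word_val_closed[of w] by (simp add: term_elem_def)
qed

text \<open>First half of multiplicativity: the left factor is a single term and the right one is
  built up by induction. A second induction on the left factor completes it.\<close>

lemma ev_mult_term:
  assumes c: "c \<in> carrier K" and "g \<in> carrier F"
  shows "ev (term_elem K c u \<otimes>\<^bsub>F\<^esub> g) = ev (term_elem K c u) \<otimes> ev g"
  using assms(2)
proof (induction rule: K.free_algebra_induct)
  case zero
  show ?case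
    using ev_closed[OF K.term_closed[OF c]] by (simp only: F.r_null[OF K.term_closed[OF c]] ev_zero A.r_null)
next
  case (add d v g)
  note tc = K.term_closed[OF c, of u] and td = K.term_closed[OF add.hyps(1), of v]
  note cl = \<iota>.hom_closed[OF c] \<iota>.hom_closed[OF add.hyps(1)] word_val_closed[of u] word_val_closed[of v]
  have "ev (term_elem K c u \<otimes>\<^bsub>F\<^esub> term_elem K d v) = \<iota> c \<otimes> (\<iota> d \<otimes> word_val u) \<otimes> word_val v"
    unfolding K.term_mult[OF c add.hyps(1)] ev_term[OF K.m_closed[OF c add.hyps(1)]] word_val_append
    using cl c add.hyps(1) by (simp add: A.m_assoc)
  also have "\<dots> = ev (term_elem K c u) \<otimes> ev (term_elem K d v)"
    unfolding word_val_central[OF add.hyps(1)] using cl c add.hyps(1) by (simp add: ev_term A.m_assoc)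
  finally have *: "ev (term_elem K c u \<otimes>\<^bsub>F\<^esub> term_elem K d v) = ev (term_elem K c u) \<otimes> ev (term_elem K d v)" .
  show ?case
    unfolding F.r_distr[OF td add.hyps(2) tc] ev_add[OF F.m_closed[OF tc td] F.m_closed[OF tc add.hyps(2)]]
      ev_add[OF td add.hyps(2)] * add.IH
    by (rule A.r_distr[symmetric]) (intro ev_closed tc td add.hyps)+
qed

lemma ev_mult:
  assumes "f \<in> carrier F" and g: "g \<in> carrier F"
  shows "ev (f \<otimes>\<^bsub>F\<^esub> g) = ev f \<otimes> ev g"
  using assms(1)
proof (induction rule: K.free_algebra_induct)
  case zero
  show ?case using ev_closed[OF g] by (simp only: F.l_null[OF g] ev_zero A.l_null)
next
  case (add c u f)
  note tc = K.term_closed[OF add.hyps(1), of u]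
  show ?case
    unfolding F.l_distr[OF tc add.hyps(2) g] ev_add[OF F.m_closed[OF tc g] F.m_closed[OF add.hyps(2) g]]
      ev_add[OF tc add.hyps(2)] ev_mult_term[OF add.hyps(1) g] add.IH
    by (rule A.l_distr[symmetric]) (intro ev_closed tc g add.hyps)+
qed

lemma ev_hom: "ev \<in> ring_hom F A"
proof (rule ring_hom_memI)
  show "ev \<one>\<^bsub>F\<^esub> = \<one>" unfolding K.free_one by (simp add: ev_term)
qed (simp_all add: ev_closed ev_mult ev_add)

end

section \<open>Codes of normal words\<close>

text \<open>A Goedel number of the multiset of Lyndon factors, when \<open>P\<close> assigns a prime
  to each atom.\<close>

definition word_code :: "('x::linorder list \<Rightarrow> nat) \<Rightarrow> 'x list \<Rightarrow> nat" where
  "word_code P w = prod_list (map P (lyndon_factors w))"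

lemma word_code_pos:
  assumes "\<And>l. l \<in> set (lyndon_factors w) \<Longrightarrow> Factorial_Ring.prime (P l)"
  shows "0 < word_code P w"
proof -
  have "0 \<notin> set (map P (lyndon_factors w))"
  proof
    assume "0 \<in> set (map P (lyndon_factors w))"
    then obtain l where "l \<in> set (lyndon_factors w)" "P l = 0" by auto
    with assms[OF this(1)] show False by simp
  qed
  then show ?thesis unfolding word_code_def by (metis neq0_conv prod_list_zero_iff)
qed

text \<open>Unique prime factorisation recovers the multiset of factors because \<open>P\<close> is
  injective on \<open>N\<close>. A nonincreasing list is determined by its multiset, and the word is
  the concatenation of that list.\<close>

lemma word_code_inj:
  assumes "set (lyndon_factors u) \<subseteq> N" "set (lyndon_factors v) \<subseteq> N"
    "inj_on P N" "\<And>l. l \<in> N \<Longrightarrow> Factorial_Ring.prime (P l)" "word_code P u = word_code P v"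
  shows "u = v"
proof -
  have fact: "prime_factorization (word_code P w) = mset (map P (lyndon_factors w))"
    if "set (lyndon_factors w) \<subseteq> N" for w
  proof -
    have "word_code P w = prod_mset (mset (map P (lyndon_factors w)))"
      unfolding word_code_def by (simp only: prod_mset_prod_list)
    then show ?thesis
      using prime_factorization_prod_mset_primes[of "mset (map P (lyndon_factors w))"] assms(4) that by auto
  qed
  have "image_mset P (mset (lyndon_factors u)) = image_mset P (mset (lyndon_factors v))"
    using fact[OF assms(1)] fact[OF assms(2)] assms(5) by (simp add: mset_map)
  moreover have "image_mset (inv_into N P) (image_mset P M) = M" if "set_mset M \<subseteq> N" for M
  proof -
    have "image_mset (inv_into N P \<circ> P) M = M"
      by (rule multiset.map_ident_strong) (use that inv_into_f_f[OF assms(3)] in auto)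
    then show ?thesis by (simp only: multiset.map_comp)
  qed
  ultimately have "mset (lyndon_factors u) = mset (lyndon_factors v)"
    using assms(1,2) by (metis set_mset_mset)
  then have "mset (rev (lyndon_factors u)) = mset (rev (lyndon_factors v))" by simp
  moreover have "sorted (rev (lyndon_factors w))" for w :: "'a list"
    using lyndon_factors(1)[of w] by (simp add: lyndon_list_def sorted_wrt_rev)
  ultimately have "rev (lyndon_factors u) = rev (lyndon_factors v)"
    using properties_for_sort sorted_sort_id by metis
  then show ?thesis using lyndon_factors(2) by (metis rev_rev_ident)
qed

lemma injection_into_primes:
  assumes "finite (N :: 'a set)"
  shows "\<exists>P :: 'a \<Rightarrow> nat. inj_on P N \<and> (\<forall>l\<in>N. Factorial_Ring.prime (P l))"
proof -
  obtain B :: "nat set" where B: "B \<subseteq> {p. Factorial_Ring.prime p}" "finite B" "card B = card N"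
    using infinite_arbitrarily_large[OF primes_infinite] by metis
  then obtain P where "bij_betw P N B" using finite_same_card_bij[OF assms] by metis
  then show ?thesis using B(1) by (auto simp: bij_betw_def)
qed

section \<open>The automaton of the atoms\<close>

lemma (in ring) scalar_matrix_hom: "scalar_matrix R n \<in> ring_hom R (matrix_ring R n)"
proof (rule ring_hom_memI)
  fix c d assume cd: "c \<in> carrier R" "d \<in> carrier R"
  show "scalar_matrix R n (c \<otimes> d) = scalar_matrix R n c \<otimes>\<^bsub>matrix_ring R n\<^esub> scalar_matrix R n d"
    by (rule ext, rule ext, simp only: scalar_matrix_mult(1)[OF cd(1) scalar_matrix_closed[OF cd(2)]])
      (use cd in \<open>simp add: scalar_matrix_def\<close>)
  show "scalar_matrix R n (c \<oplus> d) = scalar_matrix R n c \<oplus>\<^bsub>matrix_ring R n\<^esub> scalar_matrix R n d"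
    by (rule ext, rule ext, simp only: matrix_add) (use cd in \<open>simp add: scalar_matrix_def\<close>)
qed (simp_all add: scalar_matrix_closed matrix_one)

text \<open>
  The states are pairs of an atom \<open>l\<close> and a proper suffix \<open>s\<close> of it: the rest of \<open>l\<close> still has to be read,
  and the atoms after it must not exceed \<open>l\<close>. Every word that labels a path is a factor of a nonincreasing
  product of atoms, hence normal. A path picks up the weight \<open>\<mu> (P l)\<close> whenever it enters an atom \<open>l\<close>, so a
  normal word read from the state of the greatest atom has total weight \<open>\<mu>\<close> of its code, and these
  weights are linearly independent over \<open>K\<close>.\<close>

locale atom_automaton = lyndon_quotient K W + G: field G
  for K :: "('k, 'm) ring_scheme" and W :: "'x::{finite,linorder} list set"
    and G :: "('g, 'p) ring_scheme" (structure) +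
  fixes \<sigma> :: "'k \<Rightarrow> 'g" and \<mu> :: "nat \<Rightarrow> 'g" and P :: "'x list \<Rightarrow> nat"
    and Q :: "('x list \<times> 'x list) list"
  assumes \<sigma>_hom: "\<sigma> \<in> ring_hom K G"
    and \<mu>_closed: "0 < a \<Longrightarrow> \<mu> a \<in> carrier G"
    and \<mu>_one: "\<mu> 1 = \<one>"
    and \<mu>_mult: "0 < a \<Longrightarrow> 0 < b \<Longrightarrow> \<mu> (a * b) = \<mu> a \<otimes> \<mu> b"
    and \<mu>_independent: "finite T \<Longrightarrow> inj_on c T \<Longrightarrow> (\<And>w. w \<in> T \<Longrightarrow> 0 < c w) \<Longrightarrow>
      (\<And>w. w \<in> T \<Longrightarrow> f w \<in> carrier K) \<Longrightarrow>
      (\<Oplus>w\<in>T. \<sigma> (f w) \<otimes> \<mu> (c w)) = \<zero> \<Longrightarrow> (v :: 'x list) \<in> T \<Longrightarrow> f v = \<zero>\<^bsub>K\<^esub>"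
    and P_inj: "inj_on P (N)"
    and P_prime: "l \<in> N \<Longrightarrow> Factorial_Ring.prime (P l)"
    and finite_atoms: "finite (N)"
    and atoms_nonempty: "N \<noteq> {}"
    and Q_states: "set Q = {(l, s). l \<in> N \<and> strict_suffix s l}"
    and Q_distinct: "distinct Q"
begin

abbreviation "code \<equiv> word_code P"

sublocale \<sigma>: ring_hom_ring K G \<sigma>
  by (rule ring_hom_ringI2[OF ring_axioms G.ring_axioms \<sigma>_hom])

lemma normal_factors: "u \<in> normal_words W \<longleftrightarrow> set (lyndon_factors u) \<subseteq> N"
  by (rule normal_iff_factors[OF lyndon_W])

lemma code_pos: "u \<in> normal_words W \<Longrightarrow> 0 < code u"
  by (rule word_code_pos) (use normal_factors P_prime in blast)

lemma code_inj: "inj_on code (normal_words W)"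
  by (rule inj_onI, rule word_code_inj[OF _ _ P_inj P_prime]) (use normal_factors in auto)

text \<open>The words that may follow once the atom \<open>l\<close> has been read
  completely.\<close>

definition bounded :: "'x list \<Rightarrow> 'x list \<Rightarrow> bool" where
  "bounded l u \<longleftrightarrow> u \<in> normal_words W \<and> (\<forall>v\<in>set (lyndon_factors u). v \<le> l)"

text \<open>Closed form for the total weight of the paths that start in \<open>q\<close>, are
  labelled \<open>u\<close> and end in a state with nothing left to read. The rest of the current
  atom is read free of charge; what follows contributes \<open>\<mu>\<close> of its code.\<close>

definition weight :: "'x list \<times> 'x list \<Rightarrow> 'x list \<Rightarrow> 'g" where
  "weight q u = (if prefix (snd q) u \<and> bounded (fst q) (drop (length (snd q)) u)
     then \<mu> (code (drop (length (snd q)) u)) else \<zero>)"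

text \<open>The first case reads the next letter of the current atom. In the second the current atom
  is exhausted: a next atom not above it is entered by its first letter and paid for at once, which
  is why proper suffixes suffice as states.\<close>

definition transition :: "'x \<Rightarrow> 'x list \<times> 'x list \<Rightarrow> 'x list \<times> 'x list \<Rightarrow> 'g" where
  "transition x q r = (if snd q = x # snd r \<and> fst r = fst q then \<one>
     else if snd q = [] \<and> fst r \<le> fst q \<and> fst r = x # snd r then \<mu> (P (fst r)) else \<zero>)"

text \<open>The bound on \<open>u\<close> makes \<open>l'\<close> followed by the factors of
  \<open>u\<close> nonincreasing, so by uniqueness this is the factorisation of the product and the
  codes multiply.\<close>

lemma bounded_prepend:
  assumes "l' \<in> N" "l' \<le> l" "bounded l' u"
  shows "bounded l (l' @ u)" "lyndon_factors (l' @ u) = l' # lyndon_factors u"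
    "code (l' @ u) = P l' * code u"
proof -
  have list: "lyndon_list (l' # lyndon_factors u)"
    using assms lyndon_factors(1)[of u] by (auto simp: lyndon_list_Cons bounded_def lyndon_atoms_def)
  show factors: "lyndon_factors (l' @ u) = l' # lyndon_factors u"
    using lyndon_factors_concat[OF list] lyndon_factors(2)[of u] by simp
  then show "bounded l (l' @ u)"
    using assms by (auto simp: bounded_def normal_factors)
  show "code (l' @ u) = P l' * code u" by (simp add: word_code_def factors)
qed

lemma bounded_split:
  assumes "bounded l w" "w \<noteq> []"
  obtains l' u where "w = l' @ u" "l' \<in> N" "l' \<le> l" "bounded l' u"
proof -
  obtain l' vs where vs: "lyndon_factors w = l' # vs"
    using assms(2) lyndon_factors(2)[of w] by (cases "lyndon_factors w") auto
  have list: "lyndon_list (l' # vs)" using lyndon_factors(1)[of w] vs by simp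
  have f: "lyndon_factors (concat vs) = vs"
    using list by (intro lyndon_factors_concat) (simp add: lyndon_list_Cons)
  show ?thesis
  proof (rule that)
    show "w = l' @ concat vs" using lyndon_factors(2)[of w] vs by simp
    show "l' \<in> N" "l' \<le> l" using assms(1) vs by (auto simp: bounded_def normal_factors)
    show "bounded l' (concat vs)"
      using assms(1) list vs f by (auto simp: bounded_def normal_factors lyndon_list_Cons)
  qed
qed

lemma weight_closed: "weight q u \<in> carrier G"
  unfolding weight_def using \<mu>_closed code_pos by (auto simp: bounded_def)

lemma transition_closed: "r \<in> set Q \<Longrightarrow> transition x q r \<in> carrier G"
  unfolding transition_def using \<mu>_closed P_prime prime_gt_0_nat by (auto simp: Q_states)

text \<open>At most one successor contributes. Inside an atom it is forced by the letter; at the end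
  of an atom the next one must be the first Lyndon factor of the word still to be read.\<close>

lemma transition_weight:
  assumes "q \<in> set Q"
  shows "(\<Oplus>r\<in>set Q. transition x q r \<otimes> weight r u) = weight q (x # u)"
proof -
  obtain l s where q: "q = (l, s)" by (cases q)
  then have l: "l \<in> N" "strict_suffix s l" using assms by (auto simp: Q_states)
  have cl: "transition x q r \<otimes> weight r u \<in> carrier G" if "r \<in> set Q" for r
    using transition_closed[OF that] weight_closed by blast
  have zero: "transition x q r \<otimes> weight r u = \<zero>"
    if "r \<in> set Q" "transition x q r = \<zero> \<or> weight r u = \<zero>" for r
    using that G.l_null[OF weight_closed] G.r_null[OF transition_closed[OF that(1)]] by metis
  show ?thesis
  proof (cases s)
    case (Cons y t)
    show ?thesis
    proof (cases "y = x")
      case True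
      have mem: "(l, t) \<in> set Q"
        using l Cons unfolding Q_states by (auto simp: strict_suffix_def suffix_def)
      have "(\<Oplus>r\<in>set Q. transition x q r \<otimes> weight r u) = transition x q (l, t) \<otimes> weight (l, t) u"
      proof (rule G.finsum_eq_single)
        fix r assume r: "r \<in> set Q" "r \<noteq> (l, t)"
        then have "transition x q r = \<zero>"
          using q Cons True by (cases r) (auto simp: transition_def)
        with r(1) show "transition x q r \<otimes> weight r u = \<zero>" using zero by blast
      qed (use mem cl[OF mem] in simp_all)
      also have "transition x q (l, t) = \<one>" using q Cons True by (simp add: transition_def)
      also have "weight (l, t) u = weight q (x # u)" using q Cons True by (simp add: weight_def)
      finally show ?thesis using weight_closed by simp
    next
      case False
      have "transition x q r = \<zero>" for r
        using q Cons False by (simp add: transition_def)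
      moreover have "weight q (x # u) = \<zero>" using q Cons False by (simp add: weight_def)
      ultimately show ?thesis using zero by (simp add: G.finsum_eq_zero)
    qed
  next
    case Nil
    \<comment> \<open>A contributing successor exhibits the whole word as an admissible atom
      followed by a word bounded by it, so that atom is the first Lyndon factor.\<close>
    have nonzero: "bounded l (x # u) \<and> (\<exists>vs. lyndon_factors (x # u) = fst r # vs)
        \<and> fst r = x # snd r \<and> transition x q r = \<mu> (P (fst r)) \<and> weight r u = \<mu> (code (drop (length (snd r)) u))
        \<and> code (x # u) = P (fst r) * code (drop (length (snd r)) u) \<and> drop (length (snd r)) u \<in> normal_words W"
      if r: "r \<in> set Q" "transition x q r \<noteq> \<zero>" "weight r u \<noteq> \<zero>" for r
    proof -
      have t: "fst r \<le> l" "fst r = x # snd r" "transition x q r = \<mu> (P (fst r))"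
        using r(2) q Nil by (auto simp: transition_def split: if_splits)
      let ?d = "drop (length (snd r)) u"
      have w: "prefix (snd r) u" "bounded (fst r) ?d" "weight r u = \<mu> (code ?d)"
        using r(3) by (auto simp: weight_def split: if_splits)
      have N: "fst r \<in> N" using r(1) by (auto simp: Q_states)
      have eq: "x # u = fst r @ ?d" using w(1) t(2) by (auto elim: prefixE)
      note b = bounded_prepend[OF N t(1) w(2), folded eq]
      show ?thesis using b t(2,3) w(2,3) by (auto simp: bounded_def)
    qed
    show ?thesis
    proof (cases "bounded l (x # u)")
      case True
      obtain l' d where ld: "x # u = l' @ d" "l' \<in> N" "l' \<le> l" "bounded l' d"
        using bounded_split[OF True] by blast
      have "l' \<noteq> []" using ld(2) lyndon_nonempty by (auto simp: lyndon_atoms_def)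
      then obtain t where t: "l' = x # t" using ld(1) by (cases l') auto
      have u: "u = t @ d" using ld(1) t by simp
      have mem: "(l', t) \<in> set Q"
        using ld(2) t unfolding Q_states by (auto simp: strict_suffix_def suffix_def)
      note b = bounded_prepend[OF ld(2,3,4), folded ld(1)]
      have "(\<Oplus>r\<in>set Q. transition x q r \<otimes> weight r u) = transition x q (l', t) \<otimes> weight (l', t) u"
      proof (rule G.finsum_eq_single)
        fix r assume r: "r \<in> set Q" "r \<noteq> (l', t)"
        show "transition x q r \<otimes> weight r u = \<zero>"
        proof (rule ccontr)
          assume "\<not> ?thesis"
          then have "fst r = x # snd r" "\<exists>vs. lyndon_factors (x # u) = fst r # vs"
            using nonzero[OF r(1)] zero[OF r(1)] by blast+
          then have "fst r = l'" "snd r = t" using b(2) t by auto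
          then show False using r(2) by (cases r) simp
        qed
      qed (use mem cl[OF mem] in simp_all)
      also have "transition x q (l', t) = \<mu> (P l')" using q Nil t ld(3) by (simp add: transition_def)
      also have "weight (l', t) u = \<mu> (code d)" using u ld(4) by (simp add: weight_def)
      also have "\<mu> (P l') \<otimes> \<mu> (code d) = \<mu> (code (x # u))"
        unfolding b(3) using P_prime[OF ld(2)] prime_gt_0_nat code_pos ld(4)
        by (intro \<mu>_mult[symmetric]) (auto simp: bounded_def)
      also have "\<dots> = weight q (x # u)" using q Nil True by (simp add: weight_def)
      finally show ?thesis .
    next
      case False
      have "transition x q r \<otimes> weight r u = \<zero>" if "r \<in> set Q" for r
        using nonzero[OF that] zero[OF that] False by blast
      moreover have "weight q (x # u) = \<zero>" using q Nil False by (simp add: weight_def)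
      ultimately show ?thesis by (simp add: G.finsum_eq_zero)
    qed
  qed
qed

section \<open>The matrices of the automaton\<close>

abbreviation "n \<equiv> length Q"
abbreviation "MQ \<equiv> matrix_ring G n"

definition letter_matrix :: "'x \<Rightarrow> nat \<Rightarrow> nat \<Rightarrow> 'g" where
  "letter_matrix x i j = (if i < n \<and> j < n then transition x (Q ! i) (Q ! j) else \<zero>)"

lemma letter_matrix_closed: "letter_matrix x \<in> carrier MQ"
  using transition_closed by (auto simp: matrix_ring_def letter_matrix_def)

sublocale M: ring MQ by (rule G.matrix_ring_ring)

sublocale ev: nc_evaluation K MQ "scalar_matrix G n \<circ> \<sigma>" letter_matrix
proof (intro nc_evaluation.intro nc_evaluation_axioms.intro ring_axioms M.ring_axioms)
  show "scalar_matrix G n \<circ> \<sigma> \<in> ring_hom K MQ"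
    by (rule ring_hom_trans[OF \<sigma>_hom G.scalar_matrix_hom])
  show "letter_matrix y \<in> carrier MQ" for y by (rule letter_matrix_closed)
  fix c y assume "c \<in> carrier K"
  then have c: "\<sigma> c \<in> carrier G" by (rule \<sigma>.hom_closed)
  show "(scalar_matrix G n \<circ> \<sigma>) c \<otimes>\<^bsub>MQ\<^esub> letter_matrix y
      = letter_matrix y \<otimes>\<^bsub>MQ\<^esub> (scalar_matrix G n \<circ> \<sigma>) c"
    unfolding o_apply
    by (rule ext, rule ext, simp only: G.scalar_matrix_mult[OF c letter_matrix_closed])
      (rule G.m_comm[OF c G.matrix_carrierD(1)[OF letter_matrix_closed]])
qed

abbreviation "val \<equiv> ev.word_val"

lemma sum_states: "(\<And>q. q \<in> set Q \<Longrightarrow> g q \<in> carrier G) \<Longrightarrow>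
    (\<Oplus>j\<in>{..<n}. g (Q ! j)) = (\<Oplus>q\<in>set Q. g q)"
proof -
  assume g: "\<And>q. q \<in> set Q \<Longrightarrow> g q \<in> carrier G"
  have im: "(!) Q ` {..<n} = set Q" by (auto simp: set_conv_nth)
  have inj: "inj_on ((!) Q) {..<n}" using Q_distinct by (auto simp: inj_on_def nth_eq_iff_index_eq)
  have "g \<in> (!) Q ` {..<n} \<rightarrow> carrier G" unfolding im using g by blast
  then have "finsum G g ((!) Q ` {..<n}) = (\<Oplus>j\<in>{..<n}. g (Q ! j))"
    using inj by (rule G.finsum_reindex)
  then show ?thesis unfolding im ..
qed

lemma word_val_entry_closed: "val w i j \<in> carrier G"
  by (rule G.matrix_carrierD(1)[OF ev.word_val_closed])

text \<open>By \<open>transition_weight\<close> the matrix of a letter \<open>x\<close> maps the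
  column of the weights of \<open>u\<close> to that of \<open>x # u\<close>; the matrix of a word
  iterates this.\<close>

lemma word_val_weight:
  assumes "i < n"
  shows "(\<Oplus>j\<in>{..<n}. val w i j \<otimes> weight (Q ! j) u) = weight (Q ! i) (w @ u)"
  using assms
proof (induction w arbitrary: i)
  case Nil
  have "(\<Oplus>j\<in>{..<n}. val [] i j \<otimes> weight (Q ! j) u) = val [] i i \<otimes> weight (Q ! i) u"
    using Nil weight_closed
    by (intro G.finsum_eq_single) (auto simp: G.matrix_one scalar_matrix_def)
  then show ?case using Nil weight_closed by (simp add: G.matrix_one scalar_matrix_def)
next
  case (Cons x w)
  note lm = G.matrix_carrierD(1)[OF letter_matrix_closed]
  note cl = lm word_val_entry_closed weight_closed
  let ?t = "\<lambda>j k. letter_matrix x i k \<otimes> (val w k j \<otimes> weight (Q ! j) u)"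
  have entry: "val (x # w) i j = (\<Oplus>k\<in>{..<n}. letter_matrix x i k \<otimes> val w k j)" for j
    unfolding list.map foldr.simps o_apply by (rule G.matrix_mult)
  have "(\<Oplus>j\<in>{..<n}. val (x # w) i j \<otimes> weight (Q ! j) u)
      = (\<Oplus>j\<in>{..<n}. \<Oplus>k\<in>{..<n}. ?t j k)"
  proof (rule G.finsum_cong'[OF refl])
    fix j
    show "val (x # w) i j \<otimes> weight (Q ! j) u
        = (\<Oplus>k\<in>{..<n}. ?t j k)"
      unfolding entry by (subst G.finsum_ldistr) (use cl in \<open>auto simp: G.m_assoc\<close>)
  qed (intro Pi_I G.finsum_closed G.m_closed cl)
  also have "\<dots> = (\<Oplus>k\<in>{..<n}. \<Oplus>j\<in>{..<n}. ?t j k)"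
    by (rule G.finsum_swap) (rule finite_lessThan G.m_closed cl)+
  also have "\<dots> = (\<Oplus>k\<in>{..<n}. transition x (Q ! i) (Q ! k) \<otimes> weight (Q ! k) (w @ u))"
  proof (rule G.finsum_cong'[OF refl])
    fix k assume "k \<in> {..<n}"
    then have k: "k < n" by simp
    have "(\<Oplus>j\<in>{..<n}. ?t j k)
        = letter_matrix x i k \<otimes> weight (Q ! k) (w @ u)"
      unfolding Cons.IH[OF k, symmetric]
      by (rule G.finsum_rdistr[symmetric]) (rule finite_lessThan Pi_I G.m_closed cl)+
    then show "(\<Oplus>j\<in>{..<n}. ?t j k)
        = transition x (Q ! i) (Q ! k) \<otimes> weight (Q ! k) (w @ u)"
      using k Cons.prems by (simp add: letter_matrix_def)
  qed (use transition_closed weight_closed in auto)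
  also have "\<dots> = (\<Oplus>r\<in>set Q. transition x (Q ! i) r \<otimes> weight r (w @ u))"
    using transition_closed weight_closed by (intro sum_states) auto
  also have "\<dots> = weight (Q ! i) (x # w @ u)" using Cons.prems by (intro transition_weight) auto
  finally show ?case by simp
qed

text \<open>A nonzero entry comes from some path, and \<open>vs\<close> are the atoms entered along
  it. The rest \<open>snd (Q ! j)\<close> is what the last atom still lacks, so appending it
  completes the product.\<close>

lemma word_val_path:
  assumes "i < n" "j < n" "val w i j \<noteq> \<zero>"
  shows "\<exists>vs. lyndon_list (fst (Q ! i) # vs) \<and> set vs \<subseteq> N \<and> snd (Q ! i) @ concat vs = w @ snd (Q ! j)"
  using assms(1,3)
proof (induction w arbitrary: i)
  case Nil
  then have ij: "i = j" by (auto simp: G.matrix_one scalar_matrix_def split: if_splits)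
  have "fst (Q ! i) \<in> N" using nth_mem[OF Nil(1)] by (auto simp: Q_states)
  then show ?case using ij by (intro exI[of _ "[]"]) (simp add: lyndon_list_Cons lyndon_atoms_def)
next
  case (Cons x w)
  note lm = G.matrix_carrierD(1)[OF letter_matrix_closed]
  have "(\<Oplus>k\<in>{..<n}. letter_matrix x i k \<otimes> val w k j) \<noteq> \<zero>"
    using Cons.prems(2) unfolding list.map foldr.simps o_apply
    by (simp only: G.matrix_mult[where M = "letter_matrix x"] not_False_eq_True)
  then obtain k where k: "k < n" "letter_matrix x i k \<otimes> val w k j \<noteq> \<zero>"
    using G.finsum_eq_zero by (metis (no_types, lifting) lessThan_iff)
  then have nz: "letter_matrix x i k \<noteq> \<zero>" "val w k j \<noteq> \<zero>"
    using lm word_val_entry_closed by auto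
  obtain vs where vs: "lyndon_list (fst (Q ! k) # vs)" "set vs \<subseteq> N"
    "snd (Q ! k) @ concat vs = w @ snd (Q ! j)"
    using Cons.IH[OF k(1) nz(2)] by blast
  have Ni: "fst (Q ! i) \<in> N" and Nk: "fst (Q ! k) \<in> N"
    using nth_mem[OF Cons.prems(1)] nth_mem[OF k(1)] by (auto simp: Q_states)
  have "transition x (Q ! i) (Q ! k) \<noteq> \<zero>"
    using nz(1) k(1) Cons.prems(1) by (simp add: letter_matrix_def)
  then consider "snd (Q ! i) = x # snd (Q ! k)" "fst (Q ! k) = fst (Q ! i)"
    | "snd (Q ! i) = []" "fst (Q ! k) \<le> fst (Q ! i)" "fst (Q ! k) = x # snd (Q ! k)"
    unfolding transition_def by (auto split: if_splits)
  then show ?case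
  proof cases
    case 1
    then show ?thesis using vs by (intro exI[of _ vs]) simp
  next
    case 2
    have "lyndon_list (fst (Q ! i) # fst (Q ! k) # vs)"
      using vs(1) 2(2) Ni by (auto simp: lyndon_list_Cons lyndon_atoms_def)
    moreover have "fst (Q ! k) @ concat vs = (x # w) @ snd (Q ! j)"
      using 2(3) vs(3) by (metis append_Cons)
    ultimately show ?thesis using 2(1) vs(2) Nk by (intro exI[of _ "fst (Q ! k) # vs"]) simp
  qed
qed

lemma word_val_not_normal:
  assumes "w \<notin> normal_words W"
  shows "val w = \<zero>\<^bsub>MQ\<^esub>"
proof (rule ext, rule ext)
  fix i j
  show "val w i j = \<zero>\<^bsub>MQ\<^esub> i j"
  proof (rule ccontr)
    assume "\<not> ?thesis"
    then have nz: "val w i j \<noteq> \<zero>" by (simp only: G.matrix_zero not_False_eq_True)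
    then have ij: "i < n" "j < n" using G.matrix_carrierD(2)[OF ev.word_val_closed] by blast+
    obtain vs where vs: "lyndon_list (fst (Q ! i) # vs)" "set vs \<subseteq> N"
      "snd (Q ! i) @ concat vs = w @ snd (Q ! j)"
      using word_val_path[OF ij nz] by blast
    have i: "fst (Q ! i) \<in> N" "strict_suffix (snd (Q ! i)) (fst (Q ! i))"
      using nth_mem[OF ij(1)] by (auto simp: Q_states)
    \<comment> \<open>\<open>a\<close> is the part of the current atom that was read before the path
      began. With it in front and the missing rest behind, \<open>w\<close> becomes a factor of a
      product of atoms.\<close>
    then obtain a where "fst (Q ! i) = a @ snd (Q ! i)" by (auto simp: strict_suffix_def suffix_def)
    then have "concat (fst (Q ! i) # vs) = a @ w @ snd (Q ! j)" using vs(3) by (metis append.assoc concat.simps(2))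
    moreover have "concat (fst (Q ! i) # vs) \<in> normal_words W"
      unfolding concat_in_normal_words_iff[OF lyndon_W vs(1)] using i(1) vs(2) by simp
    ultimately have "w \<in> normal_words W" using normal_sublist sublist_appendI by metis
    then show False using assms by blast
  qed
qed

text \<open>Applying the row of the start state to the column of the weights of the empty word turns
  the vanishing matrix into a linear relation between the weights of distinct codes.\<close>

lemma ev_injective:
  assumes f: "f \<in> carrier F" "\<And>w. f w \<noteq> \<zero>\<^bsub>K\<^esub> \<Longrightarrow> w \<in> normal_words W" and "ev.ev f = \<zero>\<^bsub>MQ\<^esub>"
  shows "f w = \<zero>\<^bsub>K\<^esub>"
proof (rule ccontr)
  assume w: "f w \<noteq> \<zero>\<^bsub>K\<^esub>"
  let ?S = "{w. f w \<noteq> \<zero>\<^bsub>K\<^esub>}"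
  note fin = free_carrierD(2)[OF f(1)] and fc = free_carrierD(1)[OF f(1)]
  have \<sigma>f: "\<sigma> (f v) \<in> carrier G" for v by (rule \<sigma>.hom_closed[OF fc])
  \<comment> \<open>From the greatest atom, completely read, the order condition excludes no normal
    word.\<close>
  define l where "l = Max N"
  have l: "l \<in> N" "\<And>v. v \<in> N \<Longrightarrow> v \<le> l"
    using finite_atoms atoms_nonempty by (auto simp: l_def)
  have "(l, []) \<in> set Q"
    using l(1) lyndon_nonempty[of l] by (auto simp: Q_states strict_suffix_def lyndon_atoms_def)
  then obtain i where i: "i < n" "Q ! i = (l, [])" by (metis in_set_conv_nth)
  have start: "weight (Q ! i) v = \<mu> (code v)" if "v \<in> normal_words W" for v
    using that l(2) normal_factors[of v] by (auto simp: weight_def bounded_def i(2))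
  have entry: "ev.ev f i j = (\<Oplus>v\<in>?S. \<sigma> (f v) \<otimes> val v i j)" for j
  proof -
    have "ev.ev f i j = (\<Oplus>v\<in>?S. ((scalar_matrix G n \<circ> \<sigma>) (f v) \<otimes>\<^bsub>MQ\<^esub> val v) i j)"
      unfolding nc_eval_def by (rule G.matrix_finsum_apply) (use ev.ev_summand_closed[OF f(1)] in blast)
    then show ?thesis by (simp only: o_apply G.scalar_matrix_mult(1)[OF \<sigma>f ev.word_val_closed])
  qed
  let ?t = "\<lambda>v j. \<sigma> (f v) \<otimes> (val v i j \<otimes> weight (Q ! j) [])"
  have "(\<Oplus>v\<in>?S. \<sigma> (f v) \<otimes> \<mu> (code v))
      = (\<Oplus>v\<in>?S. \<Oplus>j\<in>{..<n}. ?t v j)"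
  proof (rule G.finsum_cong'[OF refl])
    fix v assume "v \<in> ?S"
    then have "\<mu> (code v) = (\<Oplus>j\<in>{..<n}. val v i j \<otimes> weight (Q ! j) [])"
      using start f(2) word_val_weight[OF i(1), of v "[]"] by simp
    then show "\<sigma> (f v) \<otimes> \<mu> (code v)
        = (\<Oplus>j\<in>{..<n}. ?t v j)"
      by (simp only:) (rule G.finsum_rdistr, (rule finite_lessThan Pi_I G.m_closed \<sigma>f word_val_entry_closed weight_closed)+)
  qed (intro Pi_I G.finsum_closed G.m_closed \<sigma>f word_val_entry_closed weight_closed)
  also have "\<dots> = (\<Oplus>j\<in>{..<n}. \<Oplus>v\<in>?S. ?t v j)"
    using fin by (rule G.finsum_swap) (simp_all only: finite_lessThan G.m_closed \<sigma>f word_val_entry_closed weight_closed)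
  also have "\<dots> = \<zero>"
  proof (rule G.finsum_eq_zero)
    fix j
    have "(\<Oplus>v\<in>?S. ?t v j)
        = (\<Oplus>v\<in>?S. \<sigma> (f v) \<otimes> val v i j \<otimes> weight (Q ! j) [])"
      by (simp only: G.m_assoc \<sigma>f word_val_entry_closed weight_closed)
    also have "\<dots> = ev.ev f i j \<otimes> weight (Q ! j) []"
      unfolding entry by (rule G.finsum_ldistr[symmetric, OF fin weight_closed])
        (intro Pi_I G.m_closed \<sigma>f word_val_entry_closed)
    also have "\<dots> = \<zero>"
      unfolding assms(3) G.matrix_zero by (rule G.l_null[OF weight_closed])
    finally show "(\<Oplus>v\<in>?S. ?t v j) = \<zero>" .
  qed
  finally have sum: "(\<Oplus>v\<in>?S. \<sigma> (f v) \<otimes> \<mu> (code v)) = \<zero>" .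
  have "inj_on code ?S" using code_inj by (rule inj_on_subset) (use f(2) in blast)
  then have "f w = \<zero>\<^bsub>K\<^esub>"
    by (rule \<mu>_independent[OF fin _ _ fc sum]) (use code_pos f(2) w in blast)+
  then show False using w by blast
qed

text \<open>Evaluation kills \<open>W\<close> because its words are not normal. Every class in the
  kernel has a representative supported on normal words, to which \<open>ev_injective\<close>
  applies.\<close>

lemma embedding:
  "\<exists>\<phi>\<in>ring_hom A MQ. inj_on \<phi> (carrier A)
    \<and> (\<forall>c\<in>carrier K. \<phi> (structure_map K W c) = scalar_matrix G n (\<sigma> c))"
proof -
  have kill: "ev.ev (term_elem K \<one>\<^bsub>K\<^esub> w) = \<zero>\<^bsub>MQ\<^esub>" if "w \<in> W" for w
  proof -
    have "w \<notin> normal_words W" using that by (auto simp: normal_words_def)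
    then show ?thesis
      unfolding ev.ev_term[OF one_closed] word_val_not_normal[OF \<open>w \<notin> normal_words W\<close>]
      by (intro M.r_null[OF ev.\<iota>.hom_closed[OF one_closed]])
  qed
  obtain \<phi> where \<phi>: "\<phi> \<in> ring_hom A MQ"
    "\<And>f. f \<in> carrier F \<Longrightarrow> \<phi> (\<rho> f) = ev.ev f"
    using hom_factors_through_word_algebra[OF M.ring_axioms ev.ev_hom kill] by blast
  interpret \<phi>: ring_hom_ring A MQ \<phi>
    by (rule ring_hom_ringI2[OF A.ring_axioms M.ring_axioms \<phi>(1)])
  have "a_kernel A MQ \<phi> = {\<zero>\<^bsub>A\<^esub>}"
  proof (intro equalityI subsetI)
    fix a assume "a \<in> a_kernel A MQ \<phi>"
    then have a: "a \<in> carrier A" "\<phi> a = \<zero>\<^bsub>MQ\<^esub>" unfolding a_kernel_def' by blast+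
    then obtain f where "f \<in> carrier F" "a = \<rho> f" unfolding carrier_word_algebra by blast
    then obtain g where g: "g \<in> carrier F" "a = \<rho> g" "\<And>w. g w \<noteq> \<zero>\<^bsub>K\<^esub> \<Longrightarrow> w \<in> normal_words W"
      using residue_class_restrict by metis
    have "ev.ev g = \<zero>\<^bsub>MQ\<^esub>"
      unfolding \<phi>(2)[OF g(1), symmetric] g(2)[symmetric] by (rule a(2))
    then have "g w = \<zero>\<^bsub>K\<^esub>" for w using ev_injective[OF g(1,3)] by blast
    then have "g = \<zero>\<^bsub>F\<^esub>" by (intro ext) (simp only: free_zero)
    then show "a \<in> {\<zero>\<^bsub>A\<^esub>}" using g(2) \<pi>.hom_zero by (simp only: singleton_iff)
  next
    fix a assume "a \<in> {\<zero>\<^bsub>A\<^esub>}"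
    then show "a \<in> a_kernel A MQ \<phi>"
      unfolding a_kernel_def' using A.zero_closed \<phi>.hom_zero by blast
  qed
  then have "inj_on \<phi> (carrier A)" by (rule \<phi>.trivial_ker_imp_inj)
  moreover have "\<phi> (structure_map K W c) = scalar_matrix G n (\<sigma> c)" if c: "c \<in> carrier K" for c
    unfolding structure_map_def \<phi>(2)[OF term_closed[OF c]] ev.ev_term[OF c] list.map foldr.simps id_apply o_apply
    by (rule M.r_one[OF ev.\<iota>.hom_closed[OF c], unfolded o_apply])
  ultimately show ?thesis using \<phi>(1) by blast
qed

end

text \<open>Supplies the automaton with weights from the fraction field of the Dirichlet series.
  Finiteness of \<open>N\<close> makes the set of states finite, and nonemptiness provides the start
  state.\<close>

lemma (in lyndon_quotient) finite_atoms_imp_matrix_embeddable: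
  assumes fin: "finite (N)" and ne: "N \<noteq> {}"
  shows "matrix_embeddable K A (structure_map K W)"
proof -
  obtain G :: "(nat \<Rightarrow> 'k) ring" and j where "field G" and j: "j \<in> ring_hom (dirichlet K) G"
    and inj: "inj_on j (carrier (dirichlet K))"
    using dirichlet_fractions[OF field_axioms] by blast
  interpret G: field G by fact
  interpret D: "domain" "dirichlet K" by (rule dirichlet_domain)
  interpret j: ring_hom_ring "dirichlet K" G j
    by (rule ring_hom_ringI2[OF D.ring_axioms G.ring_axioms j])
  obtain P :: "'x list \<Rightarrow> nat" where P: "inj_on P (N)"
    "\<forall>l\<in>N. Factorial_Ring.prime (P l)"
    using injection_into_primes[OF fin] by blast
  let ?Q = "{(l, s). l \<in> N \<and> strict_suffix s l}"
  have "?Q \<subseteq> N \<times> (\<Union>l\<in>N. set (suffixes l))"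
    by (auto simp: strict_suffix_def)
  then have "finite ?Q" by (rule finite_subset) (use fin in auto)
  then obtain Q where Q: "set Q = ?Q" "distinct Q" using finite_distinct_list by blast
  \<comment> \<open>Scalars become the constant series and \<open>?\<mu> a\<close> the monomial at
    \<open>a\<close>, both viewed in the fraction field.\<close>
  let ?\<sigma> = "j \<circ> (\<lambda>c. unit_mass K c 1)"
  let ?\<mu> = "\<lambda>a. j (unit_mass K \<one> a)"
  interpret atom_automaton K W G ?\<sigma> ?\<mu> P Q
  proof (intro atom_automaton.intro atom_automaton_axioms.intro lyndon_quotient_axioms \<open>field G\<close>)
    show "?\<sigma> \<in> ring_hom K G" by (rule ring_hom_trans[OF unit_mass_hom j])
    show "?\<mu> a \<in> carrier G" if "0 < a" for a by (rule j.hom_closed[OF unit_mass_closed[OF one_closed that]])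
    have "unit_mass K \<one> 1 = \<one>\<^bsub>dirichlet K\<^esub>" by (rule ring_hom_one[OF unit_mass_hom])
    then show "?\<mu> 1 = \<one>\<^bsub>G\<^esub>" using j.hom_one by (simp only:)
    show "?\<mu> (a * b) = ?\<mu> a \<otimes>\<^bsub>G\<^esub> ?\<mu> b" if "0 < a" "0 < b" for a b
      unfolding j.hom_mult[OF unit_mass_closed[OF one_closed that(1)] unit_mass_closed[OF one_closed that(2)], symmetric]
        unit_mass_mult[OF one_closed one_closed that] l_one[OF one_closed] ..
  next
    fix T :: "'x list set" and c f v
    assume T: "finite T" "inj_on c T" "\<And>w. w \<in> T \<Longrightarrow> 0 < c w" "\<And>w. w \<in> T \<Longrightarrow> f w \<in> carrier K"
      and sum: "(\<Oplus>\<^bsub>G\<^esub>w\<in>T. ?\<sigma> (f w) \<otimes>\<^bsub>G\<^esub> ?\<mu> (c w)) = \<zero>\<^bsub>G\<^esub>" and "v \<in> T"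
    let ?s = "\<lambda>w. unit_mass K (f w) (c w)"
    have s: "?s w \<in> carrier (dirichlet K)" if "w \<in> T" for w
      by (rule unit_mass_closed[OF T(4)[OF that] T(3)[OF that]])
    \<comment> \<open>A constant times a monomial is again one unit mass, so the relation in
      \<open>G\<close> is the image of a relation between unit masses at distinct integers.\<close>
    have prod: "?\<sigma> (f w) \<otimes>\<^bsub>G\<^esub> ?\<mu> (c w) = j (?s w)" if w: "w \<in> T" for w
      unfolding o_apply
        j.hom_mult[OF unit_mass_closed[OF T(4)[OF w] zero_less_one] unit_mass_closed[OF one_closed T(3)[OF w]], symmetric]
        unit_mass_mult[OF T(4)[OF w] one_closed zero_less_one T(3)[OF w]] r_one[OF T(4)[OF w]] mult_1 ..
    have "j (finsum (dirichlet K) ?s T) = (\<Oplus>\<^bsub>G\<^esub>w\<in>T. j (?s w))"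
      using s by (subst j.hom_finsum) (auto simp: o_def)
    also have "\<dots> = (\<Oplus>\<^bsub>G\<^esub>w\<in>T. ?\<sigma> (f w) \<otimes>\<^bsub>G\<^esub> ?\<mu> (c w))"
      by (rule G.finsum_cong'[OF refl]) (use prod s j.hom_closed in auto)
    also have "\<dots> = j \<zero>\<^bsub>dirichlet K\<^esub>" unfolding sum by (rule j.hom_zero[symmetric])
    finally have zero: "finsum (dirichlet K) ?s T = \<zero>\<^bsub>dirichlet K\<^esub>"
      by (rule inj_onD[OF inj]) (use s in \<open>auto intro!: D.finsum_closed\<close>)
    show "f v = \<zero>"
      by (rule unit_masses_independent[where S = T and c = c and f = f]) (use T zero \<open>v \<in> T\<close> in blast)+
  qed (use P fin ne Q in auto)
  show ?thesis
    unfolding matrix_embeddable_def using embedding \<open>field G\<close> \<sigma>_hom by blast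
qed

theorem theoremA:
  fixes K :: "('k, 'm) ring_scheme"
    and W :: "'x::{finite, linorder} list set"
  assumes "field K"
    and "card (UNIV :: 'x set) \<ge> 2"
    and "W \<noteq> {}"
    and "\<forall>w\<in>W. lyndon w"
    and "word_antichain W"
    and "\<forall>x. [x] \<notin> W"
  shows
    "words_form_basis K W
       {power_product ls ks | ls ks. length ls \<ge> 1 \<and> length ks = length ls
          \<and> lex_decreasing ls \<and> set ls \<subseteq> lyndon_atoms W}
     \<and> {power_product ls ks | ls ks. length ls \<ge> 1 \<and> length ks = length ls
          \<and> lex_decreasing ls \<and> set ls \<subseteq> lyndon_atoms W} = normal_words W
     \<and> (finite (lyndon_atoms W) \<longleftrightarrow> polynomial_growth K W)
     \<and> (finite (lyndon_atoms W) \<longleftrightarrow> PI_algebra K (word_algebra K W) (structure_map K W))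
     \<and> (finite (lyndon_atoms W) \<longleftrightarrow> matrix_embeddable K (word_algebra K W) (structure_map K W))
     \<and> (finite (lyndon_atoms W) \<longrightarrow>
          (\<exists>ls. lex_decreasing ls \<and> set ls = lyndon_atoms W
            \<and> normal_words W = {power_product ls \<alpha>s | \<alpha>s. length \<alpha>s = length ls}
            \<and> words_form_basis K W {power_product ls \<alpha>s | \<alpha>s. length \<alpha>s = length ls}
            \<and> GK_dim K W = ereal (real (length ls))
            \<and> hilbert_series K W = (\<Prod>l\<leftarrow>ls. 1 / (1 - fps_X ^ length l))))"
proof -
  interpret lyndon_quotient K W
  proof (intro lyndon_quotient.intro word_quotient.intro monomial_quotient.intro
      word_quotient_axioms.intro lyndon_quotient_axioms.intro)
    show "field K" by fact
    then show "ring K" by (simp add: field.is_ring)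
    show "[] \<notin> W" using assms(4) lyndon_nonempty by blast
    show "\<forall>w\<in>W. lyndon w" by fact
  qed
  let ?P = "{power_product ls ks | ls ks. length ls \<ge> 1 \<and> length ks = length ls
      \<and> lex_decreasing ls \<and> set ls \<subseteq> lyndon_atoms W}"
  have products: "?P = normal_words W" by (rule normal_words_eq_decreasing_products[OF assms(4,6)])
  \<comment> \<open>Every letter is an atom, so the automaton has a start state.\<close>
  have "lyndon_atoms W \<noteq> {}" using letter_atom[OF assms(4,6)] by blast
  then have embeddable: "matrix_embeddable K A (structure_map K W)" if "finite (lyndon_atoms W)"
    using finite_atoms_imp_matrix_embeddable[OF that] by blast
  have PI: "PI_algebra K A (structure_map K W)" if "matrix_embeddable K A (structure_map K W)"
    by (rule matrix_embeddable_imp_PI[OF assms(1) A.ring_axioms structure_map_hom that])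
  have "\<exists>ls. lex_decreasing ls \<and> set ls = lyndon_atoms W
      \<and> normal_words W = {power_product ls \<alpha>s | \<alpha>s. length \<alpha>s = length ls}
      \<and> words_form_basis K W {power_product ls \<alpha>s | \<alpha>s. length \<alpha>s = length ls}
      \<and> GK_dim K W = ereal (real (length ls))
      \<and> hilbert_series K W = (\<Prod>l\<leftarrow>ls. 1 / (1 - fps_X ^ length l))" if fin: "finite (lyndon_atoms W)"
  proof -
    obtain ls where ls: "sorted_wrt (>) ls" "set ls = lyndon_atoms W"
      using decreasing_list_exists[OF fin] by blast
    have eq: "normal_words W = {power_product ls \<alpha>s | \<alpha>s. length \<alpha>s = length ls}"
      by (rule normal_words_eq_power_products[OF assms(4) ls])
    then have "words_form_basis K W {power_product ls \<alpha>s | \<alpha>s. length \<alpha>s = length ls}"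
      using normal_words_form_basis by metis
    then show ?thesis
      using ls eq GK_dim_eq[OF ls] hilbert_series_eq[OF ls] lex_decreasing_iff by blast
  qed
  \<comment> \<open>Finiteness gives an embedding, an embedding a polynomial identity, and an
    identity finiteness; polynomial growth is equivalent to finiteness directly.\<close>
  then show ?thesis
    unfolding products
    using normal_words_form_basis finite_atoms_imp_polynomial_growth polynomial_growth_imp_finite_atoms
      embeddable PI PI_imp_finite_atoms by blast
qed

end
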